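(* Let $X$ and $Y$ be operator spaces and assume that $X$ is separable. If $X$ almost completely Lipschitzly embeds into $Y^*$, then $X$ almost completely $\mathbb{R}$-linearly embeds into $Y^*$.
   Context: An operator space is a closed $\mathbb{C}$-linear subspace $X\subset \mathcal{B}(H)$ for a (complex) Hilbert space $H$; $\mathrm{M}_n(X)$ carries the norm inherited from $\mathcal{B}(H^{\oplus n})$. The dual $Y^*$ of an operator space $Y$ is an operator space via the identification $\mathrm{M}_n(Y^* )\cong \mathrm{CB}(Y,\mathrm{M}_n)$ (completely bounded maps with the cb-norm). For a map $f:X\to Z$ (not necessarily linear), the $n$-th amplification is $f_n:\mathrm{M}_n(X)\to \mathrm{M}_n(Z)$, $f_n([x_{ij}])=[f(x_{ij})]$. The Lipschitz distortion of an injective map $g$ between metric spaces $(A,d)$ and $(B,\partial)$ is the infimum of all $D>0$ for which there is $r>0$ with $r\,d(x,y)\le \partial(g(x),g(y))\le Dr\,d(x,y)$ for all $x,y\in A$; $g$ is a Lipschitz embedding if it is injective, Lipschitz and $g^{-1}:g(A)\to A$ is Lipschitz. $X$ almost completely Lipschitzly embeds into $Z$ if there are $D>0$ and a sequence of (arbitrary) maps $(f^n:X\to Z)_{n\in\mathbb{N}}$ such that for each $n$ the $n$-th amplification $f^n_n:\mathrm{M}_n(X)\to \mathrm{M}_n(Z)$ of $f^n$ is a Lipschitz embedding with distortion at most $D$. $X$ almost completely $\mathbb{R}$-linearly embeds (equivalently, almost completely $\mathbb{R}$-isomorphically embeds) into $Z$ if there are such a $D$ and such a sequence in which, in addition, each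 $f^n$ is $\mathbb{R}$-linear. *)

theory Defs
  imports
    "HOL-Analysis.Analysis"
    "HOL-Library.Function_Algebras"
    "Jordan_Normal_Form.Matrix"
begin

section \<open>Complex Hilbert spaces\<close>

class complex_vector = real_vector +
  fixes scaleC :: "complex \<Rightarrow> 'a \<Rightarrow> 'a" (infixr \<open>*\<^sub>C\<close> 75)
  assumes scaleC_add_right: "a *\<^sub>C (x + y) = a *\<^sub>C x + a *\<^sub>C y"
    and scaleC_add_left: "(a + b) *\<^sub>C x = a *\<^sub>C x + b *\<^sub>C x"
    and scaleC_scaleC: "a *\<^sub>C (b *\<^sub>C x) = (a * b) *\<^sub>C x"
    and scaleC_one: "1 *\<^sub>C x = x"
    and scaleR_scaleC: "r *\<^sub>R x = complex_of_real r *\<^sub>C x"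

class complex_normed_vector = complex_vector + real_normed_vector +
  assumes norm_scaleC: "norm (a *\<^sub>C x) = cmod a * norm x"

text \<open>The inner product is linear in the first argument and conjugate-linear in the second;
  completeness comes from the class \<open>banach\<close>.\<close>

class complex_hilbert = complex_normed_vector + banach +
  fixes cinner :: "'a \<Rightarrow> 'a \<Rightarrow> complex"
  assumes cinner_commute: "cinner x y = cnj (cinner y x)"
    and cinner_add_left: "cinner (x + y) z = cinner x z + cinner y z"
    and cinner_scaleC_left: "cinner (a *\<^sub>C x) y = a * cinner x y"
    and cinner_self: "cinner x x = complex_of_real ((norm x)\<^sup>2)"

instantiation complex :: complex_hilbert
begin

definition scaleC_complex :: "complex \<Rightarrow> complex \<Rightarrow> complex"
  where "scaleC_complex a x = a * x"

definition cinner_complex :: "complex \<Rightarrow> complex \<Rightarrow> complex"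
  where "cinner_complex x y = x * cnj y"

instance
proof
  show "cinner x x = complex_of_real ((norm x)\<^sup>2)" for x :: complex
    by (simp only: cinner_complex_def complex_norm_square)
qed (simp_all add: scaleC_complex_def cinner_complex_def distrib_left distrib_right norm_mult
    scaleR_conv_of_real mult.commute)

end

instantiation blinfun :: (real_normed_vector, complex_normed_vector) complex_normed_vector
begin

lift_definition scaleC_blinfun :: "complex \<Rightarrow> 'a \<Rightarrow>\<^sub>L 'b \<Rightarrow> 'a \<Rightarrow>\<^sub>L 'b"
  is "\<lambda>c f x. c *\<^sub>C f x"
proof -
  fix c :: complex and f :: "'a \<Rightarrow> 'b"
  assume "bounded_linear f"
  then interpret bounded_linear f .
  show "bounded_linear (\<lambda>x. c *\<^sub>C f x)"
  proof (rule bounded_linear_intro[where K = "cmod c * onorm f"])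
    show "c *\<^sub>C f (x + y) = c *\<^sub>C f x + c *\<^sub>C f y" for x y
      by (simp add: add scaleC_add_right)
    show "c *\<^sub>C f (r *\<^sub>R x) = r *\<^sub>R (c *\<^sub>C f x)" for r x
      by (simp add: scaleR scaleR_scaleC scaleC_scaleC mult.commute)
    show "norm (c *\<^sub>C f x) \<le> norm x * (cmod c * onorm f)" for x
      using onorm[OF \<open>bounded_linear f\<close>, of x] mult_left_mono[of "norm (f x)" "onorm f * norm x" "cmod c"]
      by (simp add: norm_scaleC ac_simps)
  qed
qed

instance
proof
  fix a b :: complex and f g :: "'a \<Rightarrow>\<^sub>L 'b" and r :: real
  show "a *\<^sub>C (f + g) = a *\<^sub>C f + a *\<^sub>C g"
    by transfer (simp add: scaleC_add_right)
  show "(a + b) *\<^sub>C f = a *\<^sub>C f + b *\<^sub>C f"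
    by transfer (simp add: scaleC_add_left)
  show "a *\<^sub>C (b *\<^sub>C f) = (a * b) *\<^sub>C f"
    by transfer (simp add: scaleC_scaleC)
  show "1 *\<^sub>C f = f"
    by transfer (simp add: scaleC_one)
  show "r *\<^sub>R f = complex_of_real r *\<^sub>C f"
    by transfer (simp add: scaleR_scaleC)
  have bl: "bounded_linear (blinfun_apply f)"
    by (rule blinfun.bounded_linear_right)
  have le: "norm (c *\<^sub>C h) \<le> cmod c * norm h" for c and h :: "'a \<Rightarrow>\<^sub>L 'b"
  proof (rule norm_blinfun_bound)
    show "norm (blinfun_apply (c *\<^sub>C h) x) \<le> cmod c * norm h * norm x" for x
      using mult_left_mono[OF norm_blinfun[of h x], of "cmod c"]
      by (simp add: scaleC_blinfun.rep_eq norm_scaleC mult.assoc)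
  qed simp
  show "norm (a *\<^sub>C f) = cmod a * norm f"
  proof (cases "a = 0")
    case True
    then show ?thesis using le[of a f] by simp
  next
    case False
    have "f = inverse a *\<^sub>C (a *\<^sub>C f)"
      using False by transfer (simp add: scaleC_scaleC scaleC_one)
    then have "norm f \<le> cmod (inverse a) * norm (a *\<^sub>C f)"
      using le[of "inverse a" "a *\<^sub>C f"] by simp
    then have "cmod a * norm f \<le> cmod a * (cmod (inverse a) * norm (a *\<^sub>C f))"
      by (rule mult_left_mono) simp
    also have "\<dots> = norm (a *\<^sub>C f)"
      using False by (simp add: norm_inverse)
    finally have "cmod a * norm f \<le> norm (a *\<^sub>C f)" .
    with le[of a f] show ?thesis by simp
  qed
qed

end

text \<open>Pointwise real vector space structure on functions; the additive part is in
  \<^theory>\<open>HOL-Library.Function_Algebras\<close>.\<close>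

instantiation "fun" :: (type, real_vector) real_vector
begin

definition scaleR_fun :: "real \<Rightarrow> ('a \<Rightarrow> 'b) \<Rightarrow> 'a \<Rightarrow> 'b"
  where "scaleR_fun r f = (\<lambda>x. r *\<^sub>R f x)"

instance
  by standard (auto simp: scaleR_fun_def fun_eq_iff scaleR_add_right scaleR_add_left)

end


section \<open>Operator spaces\<close>

definition csubspace :: "'a::complex_vector set \<Rightarrow> bool"
  where "csubspace X \<longleftrightarrow>
    0 \<in> X \<and> (\<forall>x\<in>X. \<forall>y\<in>X. x + y \<in> X) \<and> (\<forall>c. \<forall>x\<in>X. c *\<^sub>C x \<in> X)"

text \<open>The type \<open>'h \<Rightarrow>\<^sub>L 'h\<close> consists of the bounded real-linear operators;
  \<open>bounded_operators\<close> is $B(H)$.\<close>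

definition bounded_operators :: "('h::complex_hilbert \<Rightarrow>\<^sub>L 'h) set"
  where "bounded_operators =
    {T. \<forall>c h. blinfun_apply T (c *\<^sub>C h) = c *\<^sub>C blinfun_apply T h}"

definition operator_space :: "('h::complex_hilbert \<Rightarrow>\<^sub>L 'h) set \<Rightarrow> bool"
  where "operator_space X \<longleftrightarrow> X \<subseteq> bounded_operators \<and> csubspace X \<and> closed X"

definition matrices :: "nat \<Rightarrow> 'a set \<Rightarrow> 'a mat set"
  where "matrices n X = {A \<in> carrier_mat n n. elements_mat A \<subseteq> X}"

text \<open>The norm of an $n \times n$ operator matrix is its operator norm on the $n$-fold Hilbert sum;
  a vector of that sum is represented by \<open>\<lambda>i. h i\<close> restricted to \<open>i < n\<close>.\<close>

definition op_norm :: "nat \<Rightarrow> ('h::complex_hilbert \<Rightarrow>\<^sub>L 'h) mat \<Rightarrow> real"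
  where "op_norm n A =
    (SUP h \<in> {h. L2_set (\<lambda>j. norm (h j)) {..<n} \<le> 1}.
      L2_set (\<lambda>i. norm (\<Sum>j<n. blinfun_apply (A $$ (i, j)) (h j))) {..<n})"

text \<open>The norm of $\mathrm{M}_m(\mathrm{M}_n)$, that is, the operator norm on
  $(\mathbb{C}^n)^m$; \<open>v (k, i)\<close> is the \<open>i\<close>-th coordinate of the \<open>k\<close>-th block.\<close>

definition scalar_norm :: "nat \<Rightarrow> nat \<Rightarrow> complex mat mat \<Rightarrow> real"
  where "scalar_norm m n B =
    (SUP v \<in> {v. L2_set (\<lambda>p. cmod (v p)) ({..<m} \<times> {..<n}) \<le> 1}.
      L2_set (\<lambda>(k, i). cmod (\<Sum>l<m. \<Sum>j<n. (B $$ (k, l)) $$ (i, j) * v (l, j)))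
        ({..<m} \<times> {..<n}))"


section \<open>Duals of operator spaces\<close>

text \<open>Functionals on \<open>Y\<close> are represented by functions on the ambient type vanishing
  outside \<open>Y\<close>, so that each functional on \<open>Y\<close> has a unique representative.\<close>

definition dual_space :: "('h::complex_hilbert \<Rightarrow>\<^sub>L 'h) set \<Rightarrow> (('h \<Rightarrow>\<^sub>L 'h) \<Rightarrow> complex) set"
  where "dual_space Y = {\<phi>.
    (\<forall>x\<in>Y. \<forall>y\<in>Y. \<phi> (x + y) = \<phi> x + \<phi> y) \<and>
    (\<forall>c. \<forall>y\<in>Y. \<phi> (c *\<^sub>C y) = c * \<phi> y) \<and>
    (\<exists>K. \<forall>y\<in>Y. cmod (\<phi> y) \<le> K * norm y) \<and>
    (\<forall>y. y \<notin> Y \<longrightarrow> \<phi> y = 0)}"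

text \<open>The norm of a linear map $u : Y \to \mathrm{M}_n$ in $\mathrm{CB}(Y, \mathrm{M}_n)$. It is a
  real supremum, hence only meaningful for completely bounded \<open>u\<close>.\<close>

definition cb_norm ::
    "('h::complex_hilbert \<Rightarrow>\<^sub>L 'h) set \<Rightarrow> nat \<Rightarrow> (('h \<Rightarrow>\<^sub>L 'h) \<Rightarrow> complex mat) \<Rightarrow> real"
  where "cb_norm Y n u =
    (SUP (m, A) \<in> {(m, A). 1 \<le> m \<and> A \<in> matrices m Y \<and> op_norm m A \<le> 1}.
      scalar_norm m n (map_mat u A))"

text \<open>The matrix norms of the dual come from $\mathrm{M}_n(Y^*) \cong \mathrm{CB}(Y, \mathrm{M}_n)$:
  a matrix \<open>F\<close> of functionals is identified with $y \mapsto [F_{ij}(y)]$. Bounded functionals on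
  an operator space are completely bounded, so for \<open>F\<close> over \<open>dual_space Y\<close> this map is completely
  bounded, and every completely bounded map arises in this way.\<close>

definition dual_norm ::
    "('h::complex_hilbert \<Rightarrow>\<^sub>L 'h) set \<Rightarrow> nat \<Rightarrow> (('h \<Rightarrow>\<^sub>L 'h) \<Rightarrow> complex) mat \<Rightarrow> real"
  where "dual_norm Y n F = cb_norm Y n (\<lambda>y. map_mat (\<lambda>\<phi>. \<phi> y) F)"


section \<open>Lipschitz embeddings\<close>

text \<open>Metric spaces are given by a carrier and a distance function.\<close>

definition lipschitz_map ::
    "'a set \<Rightarrow> ('a \<Rightarrow> 'a \<Rightarrow> real) \<Rightarrow> ('b \<Rightarrow> 'b \<Rightarrow> real) \<Rightarrow> ('a \<Rightarrow> 'b) \<Rightarrow> bool"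
  where "lipschitz_map A d e g \<longleftrightarrow> (\<exists>L\<ge>0. \<forall>x\<in>A. \<forall>y\<in>A. e (g x) (g y) \<le> L * d x y)"

definition lipschitz_embedding ::
    "'a set \<Rightarrow> ('a \<Rightarrow> 'a \<Rightarrow> real) \<Rightarrow> 'b set \<Rightarrow> ('b \<Rightarrow> 'b \<Rightarrow> real) \<Rightarrow> ('a \<Rightarrow> 'b) \<Rightarrow> bool"
  where "lipschitz_embedding A d B e g \<longleftrightarrow>
    g \<in> A \<rightarrow> B \<and> inj_on g A \<and> lipschitz_map A d e g \<and> lipschitz_map (g ` A) e d (inv_into A g)"

text \<open>A real infimum; the set is nonempty for every Lipschitz embedding, and the distortion is
  only used for those.\<close>

definition lipschitz_distortion ::
    "'a set \<Rightarrow> ('a \<Rightarrow> 'a \<Rightarrow> real) \<Rightarrow> ('b \<Rightarrow> 'b \<Rightarrow> real) \<Rightarrow> ('a \<Rightarrow> 'b) \<Rightarrow> real"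
  where "lipschitz_distortion A d e g =
    Inf {D. D > 0 \<and> (\<exists>r>0. \<forall>x\<in>A. \<forall>y\<in>A.
      r * d x y \<le> e (g x) (g y) \<and> e (g x) (g y) \<le> D * r * d x y)}"

text \<open>In what follows \<open>(X, N)\<close> and \<open>(Z, M)\<close> are a vector space together with its matrix norms;
  the distance on $\mathrm{M}_n(X)$ is \<open>N n (A - B)\<close>.\<close>

definition amplification_embeds ::
    "'a::real_vector set \<Rightarrow> (nat \<Rightarrow> 'a mat \<Rightarrow> real) \<Rightarrow> 'b::real_vector set \<Rightarrow> (nat \<Rightarrow> 'b mat \<Rightarrow> real)
      \<Rightarrow> real \<Rightarrow> nat \<Rightarrow> ('a \<Rightarrow> 'b) \<Rightarrow> bool"
  where "amplification_embeds X N Z M D n f \<longleftrightarrow>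
    lipschitz_embedding (matrices n X) (\<lambda>A B. N n (A - B)) (matrices n Z) (\<lambda>A B. M n (A - B))
      (map_mat f) \<and>
    lipschitz_distortion (matrices n X) (\<lambda>A B. N n (A - B)) (\<lambda>A B. M n (A - B)) (map_mat f) \<le> D"

definition almost_completely_lipschitz_embeds ::
    "'a::real_vector set \<Rightarrow> (nat \<Rightarrow> 'a mat \<Rightarrow> real) \<Rightarrow> 'b::real_vector set \<Rightarrow> (nat \<Rightarrow> 'b mat \<Rightarrow> real)
      \<Rightarrow> bool"
  where "almost_completely_lipschitz_embeds X N Z M \<longleftrightarrow>
    (\<exists>D>0. \<exists>f :: nat \<Rightarrow> 'a \<Rightarrow> 'b. \<forall>n\<ge>1. f n \<in> X \<rightarrow> Z \<and> amplification_embeds X N Z M D n (f n))"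

definition real_linear_on :: "'a::real_vector set \<Rightarrow> ('a \<Rightarrow> 'b::real_vector) \<Rightarrow> bool"
  where "real_linear_on X f \<longleftrightarrow>
    (\<forall>x\<in>X. \<forall>y\<in>X. f (x + y) = f x + f y) \<and> (\<forall>r. \<forall>x\<in>X. f (r *\<^sub>R x) = r *\<^sub>R f x)"

definition almost_completely_real_linearly_embeds ::
    "'a::real_vector set \<Rightarrow> (nat \<Rightarrow> 'a mat \<Rightarrow> real) \<Rightarrow> 'b::real_vector set \<Rightarrow> (nat \<Rightarrow> 'b mat \<Rightarrow> real)
      \<Rightarrow> bool"
  where "almost_completely_real_linearly_embeds X N Z M \<longleftrightarrow>
    (\<exists>D>0. \<exists>f :: nat \<Rightarrow> 'a \<Rightarrow> 'b. \<forall>n\<ge>1.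
      f n \<in> X \<rightarrow> Z \<and> real_linear_on X (f n) \<and> amplification_embeds X N Z M D n (f n))"

end

theory Submission
  imports Defs
begin

text \<open>
  Let $f : X \to Y^*$ be a map whose $N$-th amplification satisfies
  $\|A - B\| \le \|f_N(A) - f_N(B)\| \le L \|A - B\|$. A linear map with such bounds at a lower level $n$
  is sought among the \<^emph>\<open>tangent maps\<close> of $f$: the additive maps in the weak-star closed convex hull of
  the difference quotients $v \mapsto (f(x + tv) - f(x)) / t$. They inherit the upper bound. The lower
  bound is the difficulty: dual norms are only lower semicontinuous in the weak-star topology, and
  averages may cancel. Moreover, differentiating $f$ at a point does not help at the level of matrices:
  almost everywhere differentiability controls matrices of difference quotients with generic and
  mutually different base points, while the amplification of a linear map corresponds to a single base
  point for all entries.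

  Cancellation is excluded by the bounds at high levels. If $N$ is a large multiple of $n$, one may fill
  the blocks of a matrix with two translates of each entry, following the signs of a Hadamard matrix.
  The lower bound for this matrix says that already the mean of the two translates of $f$ satisfies the
  lower bound at level $n$, up to a small loss (\<open>amp_lower_two_point_average\<close>). By iteration, averages of
  $f$ over cubes with a fixed number of points keep the lower bound
  (\<open>amp_bounds_dyadic_average\<close>), provided that $N$ was chosen large enough. This is where the sequence
  of embeddings is used: for each $n$, the linear map is built from $f^N$ with $N$ much larger than $n$.

  Averages of difference quotients over long boxes are nearly additive, because differences of
  translates telescope. Hence such an average is close to a tangent map, in any finite number of
  directions (\<open>box_avg_refine_error\<close>). Both facts together allow one to replace a tangent map $T$ by a
  tangent map $T'$ such that a given weak-star continuous functional decreases by at most $\eta$, while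
  $\|T'_n(V)\|$ is bounded below by a multiple of $\|V\|$ for a given matrix $V$
  (\<open>tangent_improve\<close>).

  It remains to treat all matrices $V$ at once, and this is the place of separability. Run through a
  dense sequence of matrices, at each step almost maximise the functional obtained so far, and add to it,
  with a rapidly decreasing weight, a functional that witnesses the norm of $T'_n(V)$. Later maps cannot
  afford to lose much in any of these functionals (\<open>variational_selection\<close>), so that the witnesses
  persist in a weak-star limit, which is the required map (\<open>embedding_tangent\<close>).
\<close>

section \<open>Norms of operator matrices\<close>

text \<open>Matrices are handled as functions of two indices, of which only the values below \<open>n\<close> matter;
  this avoids dimension side conditions in the entrywise constructions below.\<close>

definition op_mnorm :: "nat \<Rightarrow> (nat \<Rightarrow> nat \<Rightarrow> 'h::complex_hilbert \<Rightarrow>\<^sub>L 'h) \<Rightarrow> real"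
  where "op_mnorm n u = op_norm n (mat n n (\<lambda>(i, j). u i j))"

lemma L2_set_zero [simp]: "L2_set (\<lambda>_. 0) A = 0"
  by (simp add: L2_set_def)

lemma op_mnorm_eq_SUP:
  "op_mnorm n u = (SUP h \<in> {h. L2_set (\<lambda>j. norm (h j)) {..<n} \<le> 1}.
      L2_set (\<lambda>i. norm (\<Sum>j<n. blinfun_apply (u i j) (h j))) {..<n})"
  unfolding op_mnorm_def op_norm_def
  by (intro SUP_cong refl L2_set_cong arg_cong[of _ _ norm] sum.cong) auto

lemma L2_set_apply_le_sum_norms:
  fixes n :: nat and u :: "nat \<Rightarrow> nat \<Rightarrow> 'h::complex_hilbert \<Rightarrow>\<^sub>L 'h"
  shows "L2_set (\<lambda>i. norm (\<Sum>j<n. blinfun_apply (u i j) (h j))) {..<n}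
    \<le> (\<Sum>i<n. \<Sum>j<n. norm (u i j)) * L2_set (\<lambda>j. norm (h j)) {..<n}"
proof -
  have "L2_set (\<lambda>i. norm (\<Sum>j<n. blinfun_apply (u i j) (h j))) {..<n}
      \<le> (\<Sum>i<n. norm (\<Sum>j<n. blinfun_apply (u i j) (h j)))"
    by (rule L2_set_le_sum) simp
  also have "\<dots> \<le> (\<Sum>i<n. \<Sum>j<n. norm (u i j) * L2_set (\<lambda>j. norm (h j)) {..<n})"
  proof (intro sum_mono order_trans[OF norm_sum])
    fix i j assume "j \<in> {..<n}"
    then have "norm (h j) \<le> L2_set (\<lambda>j. norm (h j)) {..<n}"
      by (intro member_le_L2_set) auto
    then show "norm (blinfun_apply (u i j) (h j)) \<le> norm (u i j) * L2_set (\<lambda>j. norm (h j)) {..<n}"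
      by (meson mult_left_mono norm_blinfun norm_ge_zero order_trans)
  qed
  finally show ?thesis by (simp add: sum_distrib_right)
qed

lemma bdd_above_op_mnorm:
  fixes n :: nat and u :: "nat \<Rightarrow> nat \<Rightarrow> 'h::complex_hilbert \<Rightarrow>\<^sub>L 'h"
  shows "bdd_above ((\<lambda>h. L2_set (\<lambda>i. norm (\<Sum>j<n. blinfun_apply (u i j) (h j))) {..<n})
     ` {h. L2_set (\<lambda>j. norm (h j)) {..<n} \<le> 1})"
proof (intro bdd_aboveI2)
  fix h :: "nat \<Rightarrow> 'h" assume "h \<in> {h. L2_set (\<lambda>j. norm (h j)) {..<n} \<le> 1}"
  then have "(\<Sum>i<n. \<Sum>j<n. norm (u i j)) * L2_set (\<lambda>j. norm (h j)) {..<n} \<le> (\<Sum>i<n. \<Sum>j<n. norm (u i j)) * 1"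
    by (intro mult_left_mono) (auto intro!: sum_nonneg)
  with L2_set_apply_le_sum_norms[of u h n]
  show "L2_set (\<lambda>i. norm (\<Sum>j<n. blinfun_apply (u i j) (h j))) {..<n} \<le> (\<Sum>i<n. \<Sum>j<n. norm (u i j))"
    by simp
qed

lemma op_mnorm_nonneg: "0 \<le> op_mnorm n u"
proof -
  have "L2_set (\<lambda>i. norm (\<Sum>j<n. blinfun_apply (u i j) ((\<lambda>_. 0) j))) {..<n} \<le> op_mnorm n u"
    unfolding op_mnorm_eq_SUP by (rule cSUP_upper[OF _ bdd_above_op_mnorm]) simp
  then show ?thesis by simp
qed

lemma L2_set_apply_le_op_mnorm:
  fixes u :: "nat \<Rightarrow> nat \<Rightarrow> 'h::complex_hilbert \<Rightarrow>\<^sub>L 'h"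
  shows "L2_set (\<lambda>i. norm (\<Sum>j<n. blinfun_apply (u i j) (h j))) {..<n}
    \<le> op_mnorm n u * L2_set (\<lambda>j. norm (h j)) {..<n}"
proof (cases "L2_set (\<lambda>j. norm (h j)) {..<n} = 0")
  case True
  then show ?thesis using L2_set_apply_le_sum_norms[of u h n] by simp
next
  case False
  define r where "r = L2_set (\<lambda>j. norm (h j)) {..<n}"
  have r: "r > 0" using False L2_set_nonneg[of "\<lambda>j. norm (h j)" "{..<n}"] unfolding r_def by linarith
  define h' where "h' j = (1/r) *\<^sub>R h j" for j
  have n': "L2_set (\<lambda>j. norm (h' j)) {..<n} = (1/r) * L2_set (\<lambda>j. norm (h j)) {..<n}"
    using r by (subst L2_set_right_distrib) (auto simp: h'_def)
  have "L2_set (\<lambda>i. norm (\<Sum>j<n. blinfun_apply (u i j) (h' j))) {..<n} \<le> op_mnorm n u"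
    unfolding op_mnorm_eq_SUP using r
    by (intro cSUP_upper[OF _ bdd_above_op_mnorm]) (use n' r in \<open>simp add: r_def\<close>)
  moreover have "L2_set (\<lambda>i. norm (\<Sum>j<n. blinfun_apply (u i j) (h' j))) {..<n}
      = (1/r) * L2_set (\<lambda>i. norm (\<Sum>j<n. blinfun_apply (u i j) (h j))) {..<n}"
    using r by (subst L2_set_right_distrib)
      (auto simp: h'_def blinfun.scaleR_right scaleR_sum_right[symmetric])
  ultimately show ?thesis using r by (simp add: field_simps flip: r_def)
qed

lemma op_mnorm_le:
  fixes u :: "nat \<Rightarrow> nat \<Rightarrow> 'h::complex_hilbert \<Rightarrow>\<^sub>L 'h"
  assumes "\<And>h. L2_set (\<lambda>j. norm (h j)) {..<n} \<le> 1 \<Longrightarrow>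
      L2_set (\<lambda>i. norm (\<Sum>j<n. blinfun_apply (u i j) (h j))) {..<n} \<le> C"
  shows "op_mnorm n u \<le> C"
  unfolding op_mnorm_eq_SUP
proof (rule cSUP_least)
  show "{h :: nat \<Rightarrow> 'h. L2_set (\<lambda>j. norm (h j)) {..<n} \<le> 1} \<noteq> {}"
    by (auto intro!: exI[of _ "\<lambda>_. 0"])
qed (use assms in auto)

lemma op_mnorm_cong:
  fixes u :: "nat \<Rightarrow> nat \<Rightarrow> 'h::complex_hilbert \<Rightarrow>\<^sub>L 'h"
  assumes "\<And>i j. i < n \<Longrightarrow> j < n \<Longrightarrow> u i j = v i j"
  shows "op_mnorm n u = op_mnorm n v"
  unfolding op_mnorm_eq_SUP
  by (intro SUP_cong refl L2_set_cong arg_cong[of _ _ norm] sum.cong) (use assms in auto)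

lemma op_mnorm_le_sum_norms:
  fixes u :: "nat \<Rightarrow> nat \<Rightarrow> 'h::complex_hilbert \<Rightarrow>\<^sub>L 'h"
  shows "op_mnorm n u \<le> (\<Sum>i<n. \<Sum>j<n. norm (u i j))"
proof (rule op_mnorm_le)
  fix h :: "nat \<Rightarrow> 'h" assume "L2_set (\<lambda>j. norm (h j)) {..<n} \<le> 1"
  then have "(\<Sum>i<n. \<Sum>j<n. norm (u i j)) * L2_set (\<lambda>j. norm (h j)) {..<n} \<le> (\<Sum>i<n. \<Sum>j<n. norm (u i j)) * 1"
    by (intro mult_left_mono) (auto intro!: sum_nonneg)
  with L2_set_apply_le_sum_norms[of u h n]
  show "L2_set (\<lambda>i. norm (\<Sum>j<n. blinfun_apply (u i j) (h j))) {..<n} \<le> (\<Sum>i<n. \<Sum>j<n. norm (u i j))"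
    by simp
qed

lemma op_mnorm_scaleR_le:
  fixes u :: "nat \<Rightarrow> nat \<Rightarrow> 'h::complex_hilbert \<Rightarrow>\<^sub>L 'h"
  shows "op_mnorm n (\<lambda>i j. r *\<^sub>R u i j) \<le> \<bar>r\<bar> * op_mnorm n u"
proof (rule op_mnorm_le)
  fix h :: "nat \<Rightarrow> 'h" assume h: "L2_set (\<lambda>j. norm (h j)) {..<n} \<le> 1"
  have "L2_set (\<lambda>i. norm (\<Sum>j<n. blinfun_apply (r *\<^sub>R u i j) (h j))) {..<n}
    = \<bar>r\<bar> * L2_set (\<lambda>i. norm (\<Sum>j<n. blinfun_apply (u i j) (h j))) {..<n}"
    by (subst L2_set_right_distrib) (auto simp: blinfun.scaleR_left scaleR_sum_right[symmetric])
  also have "\<dots> \<le> \<bar>r\<bar> * (op_mnorm n u * 1)"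
    by (intro mult_left_mono order_trans[OF L2_set_apply_le_op_mnorm] h op_mnorm_nonneg) auto
  finally show "L2_set (\<lambda>i. norm (\<Sum>j<n. blinfun_apply (r *\<^sub>R u i j) (h j))) {..<n} \<le> \<bar>r\<bar> * op_mnorm n u"
    by simp
qed

lemma op_mnorm_scaleR:
  fixes u :: "nat \<Rightarrow> nat \<Rightarrow> 'h::complex_hilbert \<Rightarrow>\<^sub>L 'h"
  shows "op_mnorm n (\<lambda>i j. r *\<^sub>R u i j) = \<bar>r\<bar> * op_mnorm n u"
proof (cases "r = 0")
  case True
  then show ?thesis using op_mnorm_scaleR_le[of n r u] op_mnorm_nonneg[of n "\<lambda>i j. r *\<^sub>R u i j"] by simp
next
  case False
  have "op_mnorm n u = op_mnorm n (\<lambda>i j. inverse r *\<^sub>R (r *\<^sub>R u i j))"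
    using False by simp
  also have "\<dots> \<le> \<bar>inverse r\<bar> * op_mnorm n (\<lambda>i j. r *\<^sub>R u i j)"
    by (rule op_mnorm_scaleR_le)
  finally show ?thesis using False op_mnorm_scaleR_le[of n r u]
    by (simp add: field_simps)
qed

lemma op_mnorm_triangle:
  fixes u :: "nat \<Rightarrow> nat \<Rightarrow> 'h::complex_hilbert \<Rightarrow>\<^sub>L 'h"
  shows "op_mnorm n (\<lambda>i j. u i j + v i j) \<le> op_mnorm n u + op_mnorm n v"
proof (rule op_mnorm_le)
  fix h :: "nat \<Rightarrow> 'h" assume h: "L2_set (\<lambda>j. norm (h j)) {..<n} \<le> 1"
  let ?a = "\<lambda>u i. (\<Sum>j<n. blinfun_apply (u i j) (h j))"
  have b: "L2_set (\<lambda>i. norm (?a u i)) {..<n} \<le> op_mnorm n u" for u :: "nat \<Rightarrow> nat \<Rightarrow> 'h \<Rightarrow>\<^sub>L 'h"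
    using mult_left_mono[OF h op_mnorm_nonneg[of n u]] L2_set_apply_le_op_mnorm[of u h n] by simp
  have "L2_set (\<lambda>i. norm (?a (\<lambda>i j. u i j + v i j) i)) {..<n}
      \<le> L2_set (\<lambda>i. norm (?a u i) + norm (?a v i)) {..<n}"
    by (intro L2_set_mono) (auto simp: blinfun.add_left sum.distrib norm_triangle_ineq)
  also have "\<dots> \<le> L2_set (\<lambda>i. norm (?a u i)) {..<n} + L2_set (\<lambda>i. norm (?a v i)) {..<n}"
    by (rule L2_set_triangle_ineq)
  finally show "L2_set (\<lambda>i. norm (?a (\<lambda>i j. u i j + v i j) i)) {..<n} \<le> op_mnorm n u + op_mnorm n v"
    using b[of u] b[of v] by linarith
qed

lemma norm_entry_le_op_mnorm:
  fixes u :: "nat \<Rightarrow> nat \<Rightarrow> 'h::complex_hilbert \<Rightarrow>\<^sub>L 'h"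
  assumes "i < n" "j < n"
  shows "norm (u i j) \<le> op_mnorm n u"
proof (rule norm_blinfun_bound[OF op_mnorm_nonneg])
  fix x :: 'h
  define h where "h k = (if k = j then x else 0)" for k
  have L: "L2_set (\<lambda>k. norm (h k)) {..<n} = norm x"
    using assms by (simp add: L2_set_def h_def if_distrib[of norm] if_distrib[of "\<lambda>x. x\<^sup>2"] cong: if_cong)
  have "blinfun_apply (u i j) x = (\<Sum>k<n. blinfun_apply (u i k) (h k))"
    using assms by (simp add: h_def if_distrib[of "blinfun_apply _"] cong: if_cong)
  then have "norm (blinfun_apply (u i j) x) \<le> L2_set (\<lambda>i. norm (\<Sum>k<n. blinfun_apply (u i k) (h k))) {..<n}"
    using assms member_le_L2_set[of "{..<n}" i "\<lambda>i. norm (\<Sum>k<n. blinfun_apply (u i k) (h k))"] by simp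
  also have "\<dots> \<le> op_mnorm n u * norm x"
    using L2_set_apply_le_op_mnorm[of u h n] unfolding L .
  finally show "norm (blinfun_apply (u i j) x) \<le> op_mnorm n u * norm x" .
qed

text \<open>Compressing an operator matrix by scalar vectors of norm one does not increase its norm. Hence every
  bounded functional on an operator space is completely bounded, which is what keeps the suprema in
  the norms of functional matrices finite.\<close>

lemma norm_scaleC_sum_le:
  fixes A :: "nat \<Rightarrow> nat \<Rightarrow> 'h::complex_hilbert \<Rightarrow>\<^sub>L 'h"
  assumes "\<And>k l. k < n \<Longrightarrow> l < n \<Longrightarrow> A k l \<in> bounded_operators"
  shows "norm (\<Sum>k<n. \<Sum>l<n. (cnj (\<eta> k) * \<xi> l) *\<^sub>C A k l)
    \<le> L2_set (\<lambda>k. cmod (\<eta> k)) {..<n} * L2_set (\<lambda>l. cmod (\<xi> l)) {..<n} * op_mnorm n A"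
proof (rule norm_blinfun_bound)
  fix x :: 'h
  let ?g = "\<lambda>k. \<Sum>l<n. blinfun_apply (A k l) (\<xi> l *\<^sub>C x)"
  have lin: "blinfun_apply (A k l) (c *\<^sub>C z) = c *\<^sub>C blinfun_apply (A k l) z" if "k < n" "l < n" for k l c z
    using assms[OF that] by (simp add: bounded_operators_def)
  have scsum: "c *\<^sub>C sum f S = (\<Sum>s\<in>S. c *\<^sub>C f s)" for c and f :: "nat \<Rightarrow> 'h" and S
  proof -
    have z: "c *\<^sub>C (0::'h) = 0" using scaleC_add_right[of c "0::'h" 0] by simp
    show ?thesis by (induction S rule: infinite_finite_induct) (auto simp: z scaleC_add_right)
  qed
  have sumapp: "blinfun_apply (sum f S) z = (\<Sum>s\<in>S. blinfun_apply (f s) z)"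
    for f :: "nat \<Rightarrow> 'h \<Rightarrow>\<^sub>L 'h" and S z
    by (induction S rule: infinite_finite_induct) (auto simp: blinfun.add_left)
  have "blinfun_apply (\<Sum>k<n. \<Sum>l<n. (cnj (\<eta> k) * \<xi> l) *\<^sub>C A k l) x = (\<Sum>k<n. cnj (\<eta> k) *\<^sub>C ?g k)"
    by (auto simp: sumapp scsum scaleC_blinfun.rep_eq lin scaleC_scaleC intro!: sum.cong)
  also have "norm \<dots> \<le> (\<Sum>k<n. \<bar>cmod (\<eta> k)\<bar> * \<bar>norm (?g k)\<bar>)"
    by (rule order_trans[OF norm_sum]) (simp add: norm_scaleC)
  also have "\<dots> \<le> L2_set (\<lambda>k. cmod (\<eta> k)) {..<n} * L2_set (\<lambda>k. norm (?g k)) {..<n}"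
    by (rule L2_set_mult_ineq)
  also have "\<dots> \<le> L2_set (\<lambda>k. cmod (\<eta> k)) {..<n} * (op_mnorm n A * L2_set (\<lambda>l. norm (\<xi> l *\<^sub>C x)) {..<n})"
    by (intro mult_left_mono L2_set_apply_le_op_mnorm) simp
  also have "L2_set (\<lambda>l. norm (\<xi> l *\<^sub>C x)) {..<n} = L2_set (\<lambda>l. cmod (\<xi> l)) {..<n} * norm x"
    by (subst L2_set_left_distrib) (auto simp: norm_scaleC)
  finally show "norm (blinfun_apply (\<Sum>k<n. \<Sum>l<n. (cnj (\<eta> k) * \<xi> l) *\<^sub>C A k l) x)
     \<le> L2_set (\<lambda>k. cmod (\<eta> k)) {..<n} * L2_set (\<lambda>l. cmod (\<xi> l)) {..<n} * op_mnorm n A * norm x"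
    by (simp add: mult_ac)
qed (intro mult_nonneg_nonneg op_mnorm_nonneg L2_set_nonneg)

text \<open>Index pairs \<open>(i, a)\<close> with \<open>i < n\<close> and \<open>a < m\<close> are coded as \<open>a * n + i < n * m\<close>.\<close>

lemma sum_mod_div:
  fixes g :: "nat \<Rightarrow> nat \<Rightarrow> 'c::comm_monoid_add"
  shows "(\<Sum>p<n * m. g (p mod n) (p div n)) = (\<Sum>i<n. \<Sum>a<m. g i a)"
proof (cases "n = 0")
  case False
  have "(\<Sum>p<n * m. g (p mod n) (p div n)) = (\<Sum>(i, a)\<in>{..<n} \<times> {..<m}. g i a)"
  proof (rule sum.reindex_bij_witness[where i = "\<lambda>(i, a). a * n + i" and j = "\<lambda>p. (p mod n, p div n)"])
    show "(case b of (i, a) \<Rightarrow> a * n + i) \<in> {..<n * m}" if b: "b \<in> {..<n} \<times> {..<m}" for b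
    proof -
      obtain i a where [simp]: "b = (i, a)" by (cases b)
      have "i < n" "Suc a \<le> m" using b by auto
      then have "a * n + i < Suc a * n" by simp
      also have "\<dots> \<le> m * n" using \<open>Suc a \<le> m\<close> by (rule mult_le_mono1)
      finally show ?thesis by (simp add: mult.commute)
    qed
    show "(p mod n, p div n) \<in> {..<n} \<times> {..<m}" if "p \<in> {..<n * m}" for p
      using that False by (auto simp: less_mult_imp_div_less mult.commute)
  qed (use False in auto)
  then show ?thesis by (simp add: sum.cartesian_product)
qed simp

text \<open>The matrix here is \<open>u\<close> tensored with the all-ones matrix of size \<open>m\<close>, which is \<open>m\<close> times
  a projection.\<close>

lemma op_mnorm_block_constant:
  fixes u :: "nat \<Rightarrow> nat \<Rightarrow> 'h::complex_hilbert \<Rightarrow>\<^sub>L 'h"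
  assumes "m \<ge> 1"
  shows "op_mnorm (n * m) (\<lambda>p q. u (p mod n) (q mod n)) = m * op_mnorm n u"
proof (rule antisym)
  show "op_mnorm (n * m) (\<lambda>p q. u (p mod n) (q mod n)) \<le> m * op_mnorm n u"
  proof (rule op_mnorm_le)
    fix h :: "nat \<Rightarrow> 'h" assume h: "L2_set (\<lambda>j. norm (h j)) {..<n * m} \<le> 1"
    define g where "g j = (\<Sum>b<m. h (b * n + j))" for j
    have eq: "(\<Sum>q<n * m. blinfun_apply (u i (q mod n)) (h q)) = (\<Sum>j<n. blinfun_apply (u i j) (g j))" for i
    proof -
      have "(\<Sum>q<n * m. blinfun_apply (u i (q mod n)) (h q))
        = (\<Sum>q<n * m. blinfun_apply (u i (q mod n)) (h ((q div n) * n + q mod n)))" by simp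
      also have "\<dots> = (\<Sum>j<n. \<Sum>b<m. blinfun_apply (u i j) (h (b * n + j)))"
        by (rule sum_mod_div)
      finally show ?thesis by (simp add: g_def blinfun.sum_right)
    qed
    have gle: "(norm (g j))\<^sup>2 \<le> m * (\<Sum>b<m. (norm (h (b * n + j)))\<^sup>2)" for j
    proof -
      have "norm (g j) \<le> (\<Sum>b<m. \<bar>1\<bar> * \<bar>norm (h (b * n + j))\<bar>)"
        unfolding g_def by (rule order_trans[OF norm_sum]) simp
      also have "\<dots> \<le> L2_set (\<lambda>_. 1) {..<m} * L2_set (\<lambda>b. norm (h (b * n + j))) {..<m}"
        by (rule L2_set_mult_ineq)
      finally have "(norm (g j))\<^sup>2 \<le> (L2_set (\<lambda>_. 1) {..<m} * L2_set (\<lambda>b. norm (h (b * n + j))) {..<m})\<^sup>2"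
        by (intro power_mono) auto
      then show ?thesis by (simp add: L2_set_def power_mult_distrib sum_nonneg)
    qed
    have "L2_set (\<lambda>j. norm (g j)) {..<n} \<le> sqrt (\<Sum>j<n. m * (\<Sum>b<m. (norm (h (b * n + j)))\<^sup>2))"
      unfolding L2_set_def by (intro real_sqrt_le_mono sum_mono gle)
    also have "(\<Sum>j<n. m * (\<Sum>b<m. (norm (h (b * n + j)))\<^sup>2)) = m * (\<Sum>q<n * m. (norm (h ((q div n) * n + q mod n)))\<^sup>2)"
      unfolding sum_mod_div[of "\<lambda>j b. (norm (h (b * n + j)))\<^sup>2" n m] by (simp add: sum_distrib_left)
    also have "sqrt \<dots> = sqrt m * L2_set (\<lambda>j. norm (h j)) {..<n * m}"
      by (simp add: L2_set_def real_sqrt_mult)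
    also have "\<dots> \<le> sqrt m" using h by (simp add: mult_left_le)
    finally have g: "L2_set (\<lambda>j. norm (g j)) {..<n} \<le> sqrt m" .
    have "L2_set (\<lambda>p. norm (\<Sum>q<n * m. blinfun_apply (u (p mod n) (q mod n)) (h q))) {..<n * m}
      = sqrt (\<Sum>p<n * m. (norm (\<Sum>j<n. blinfun_apply (u (p mod n) j) (g j)))\<^sup>2)"
      by (simp add: L2_set_def eq)
    also have "(\<Sum>p<n * m. (norm (\<Sum>j<n. blinfun_apply (u (p mod n) j) (g j)))\<^sup>2)
      = m * (\<Sum>i<n. (norm (\<Sum>j<n. blinfun_apply (u i j) (g j)))\<^sup>2)"
      unfolding sum_mod_div[of "\<lambda>i b. (norm (\<Sum>j<n. blinfun_apply (u i j) (g j)))\<^sup>2" n m]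
      by (simp add: sum_distrib_left)
    also have "sqrt \<dots> = sqrt m * L2_set (\<lambda>i. norm (\<Sum>j<n. blinfun_apply (u i j) (g j))) {..<n}"
      by (simp add: L2_set_def real_sqrt_mult)
    also have "\<dots> \<le> sqrt m * (op_mnorm n u * sqrt m)"
      by (intro mult_left_mono order_trans[OF L2_set_apply_le_op_mnorm] g op_mnorm_nonneg) auto
    also have "\<dots> = (sqrt m * sqrt m) * op_mnorm n u" by (simp only: mult_ac)
    also have "\<dots> = m * op_mnorm n u" by simp
    finally show "L2_set (\<lambda>p. norm (\<Sum>q<n * m. blinfun_apply (u (p mod n) (q mod n)) (h q))) {..<n * m}
        \<le> m * op_mnorm n u" .
  qed
next
  have "op_mnorm n u \<le> op_mnorm (n * m) (\<lambda>p q. u (p mod n) (q mod n)) / m"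
  proof (rule op_mnorm_le)
    fix h :: "nat \<Rightarrow> 'h" assume h: "L2_set (\<lambda>j. norm (h j)) {..<n} \<le> 1"
    have L: "L2_set (\<lambda>q. norm (h (q mod n))) {..<n * m} = sqrt m * L2_set (\<lambda>j. norm (h j)) {..<n}"
      unfolding L2_set_def sum_mod_div[of "\<lambda>j b. (norm (h j))\<^sup>2" n m]
      by (simp add: sum_distrib_left[symmetric] real_sqrt_mult)
    have eq: "(\<Sum>q<n * m. blinfun_apply (u i (q mod n)) (h (q mod n))) = real m *\<^sub>R (\<Sum>j<n. blinfun_apply (u i j) (h j))" for i
      unfolding sum_mod_div[of "\<lambda>j b. blinfun_apply (u i j) (h j)" n m]
      by (simp only: sum_constant_scaleR scaleR_sum_right card_lessThan)
    have "L2_set (\<lambda>p. norm (\<Sum>q<n * m. blinfun_apply (u (p mod n) (q mod n)) (h (q mod n)))) {..<n * m}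
      = sqrt (\<Sum>p<n * m. (norm (real m *\<^sub>R (\<Sum>j<n. blinfun_apply (u (p mod n) j) (h j))))\<^sup>2)"
      by (simp add: L2_set_def eq)
    also have "(\<Sum>p<n * m. (norm (real m *\<^sub>R (\<Sum>j<n. blinfun_apply (u (p mod n) j) (h j))))\<^sup>2)
      = m * (m\<^sup>2 * (\<Sum>i<n. (norm (\<Sum>j<n. blinfun_apply (u i j) (h j)))\<^sup>2))"
      unfolding sum_mod_div[of "\<lambda>i b. (norm (real m *\<^sub>R (\<Sum>j<n. blinfun_apply (u i j) (h j))))\<^sup>2" n m]
      by (simp add: sum_distrib_left power_mult_distrib)
    also have "sqrt \<dots> = sqrt m * (m * L2_set (\<lambda>i. norm (\<Sum>j<n. blinfun_apply (u i j) (h j))) {..<n})"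
      by (simp add: L2_set_def real_sqrt_mult)
    finally have "sqrt m * (m * L2_set (\<lambda>i. norm (\<Sum>j<n. blinfun_apply (u i j) (h j))) {..<n})
      \<le> op_mnorm (n * m) (\<lambda>p q. u (p mod n) (q mod n)) * (sqrt m * L2_set (\<lambda>j. norm (h j)) {..<n})"
      using L2_set_apply_le_op_mnorm[of "\<lambda>p q. u (p mod n) (q mod n)" "\<lambda>q. h (q mod n)" "n * m"]
      unfolding L by simp
    also have "\<dots> \<le> op_mnorm (n * m) (\<lambda>p q. u (p mod n) (q mod n)) * (sqrt m * 1)"
      by (intro mult_left_mono h op_mnorm_nonneg) auto
    finally have "sqrt m * (m * L2_set (\<lambda>i. norm (\<Sum>j<n. blinfun_apply (u i j) (h j))) {..<n})
      \<le> sqrt m * op_mnorm (n * m) (\<lambda>p q. u (p mod n) (q mod n))" by (simp add: mult.commute)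
    then show "L2_set (\<lambda>i. norm (\<Sum>j<n. blinfun_apply (u i j) (h j))) {..<n}
      \<le> op_mnorm (n * m) (\<lambda>p q. u (p mod n) (q mod n)) / m"
      using assms by (simp add: field_simps)
  qed
  then show "m * op_mnorm n u \<le> op_mnorm (n * m) (\<lambda>p q. u (p mod n) (q mod n))"
    using assms by (simp add: field_simps)
qed

lemma op_mnorm_1_le: "op_mnorm 1 (\<lambda>_ _. x) \<le> norm x"
  using op_mnorm_le_sum_norms[of 1 "\<lambda>_ _. x"] by simp

section \<open>Norms of matrices of functionals\<close>

lemma csubspace_sum:
  assumes "csubspace Y" "\<And>s. s \<in> S \<Longrightarrow> g s \<in> Y"
  shows "sum g S \<in> Y"
  using assms(2)
  by (induction S rule: infinite_finite_induct) (use assms(1) in \<open>auto simp: csubspace_def\<close>)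

lemma dual_space_sum:
  assumes "csubspace Y" "\<phi> \<in> dual_space Y" "\<And>s. s \<in> S \<Longrightarrow> g s \<in> Y"
  shows "\<phi> (sum g S) = (\<Sum>s\<in>S. \<phi> (g s))"
  using assms(3)
proof (induction S rule: infinite_finite_induct)
  case empty
  have "\<phi> (0 + 0) = \<phi> 0 + \<phi> 0" using assms(1,2) by (simp only: dual_space_def csubspace_def mem_Collect_eq)
  then show ?case by simp
next
  case (infinite S)
  have "\<phi> (0 + 0) = \<phi> 0 + \<phi> 0" using assms(1,2) by (simp only: dual_space_def csubspace_def mem_Collect_eq)
  then show ?case using infinite by simp
next
  case (insert s S)
  have "sum g S \<in> Y" by (rule csubspace_sum[OF assms(1)]) (use insert in auto)
  then have "\<phi> (g s + sum g S) = \<phi> (g s) + \<phi> (sum g S)"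
    using assms(2) insert.prems by (simp add: dual_space_def)
  with insert show ?case by simp
qed

lemma dual_space_scaleC: "\<phi> \<in> dual_space Y \<Longrightarrow> y \<in> Y \<Longrightarrow> \<phi> (c *\<^sub>C y) = c * \<phi> y"
  by (simp add: dual_space_def)

definition dual_mnorm ::
    "('k::complex_hilbert \<Rightarrow>\<^sub>L 'k) set \<Rightarrow> nat \<Rightarrow> (nat \<Rightarrow> nat \<Rightarrow> ('k \<Rightarrow>\<^sub>L 'k) \<Rightarrow> complex) \<Rightarrow> real"
  where "dual_mnorm Y n \<phi> = dual_norm Y n (mat n n (\<lambda>(i, j). \<phi> i j))"

definition hs_norm :: "nat \<Rightarrow> nat \<Rightarrow> (nat \<Rightarrow> nat \<Rightarrow> complex) \<Rightarrow> real"
  where "hs_norm m n \<eta> = sqrt (\<Sum>k<m. \<Sum>i<n. (cmod (\<eta> k i))\<^sup>2)"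

text \<open>Unfolding the norm of $CB(Y, M_n)$ and testing the resulting operators against a pair of unit
  vectors, the norm of a matrix \<open>\<phi>\<close> of functionals becomes the supremum of the real parts of
  $\sum_{ij} \phi_{ij}(a_{ij})$ over the matrices \<open>a\<close> in this set (\<open>dual_mnorm_le\<close> and
  \<open>Re_pairing_le_dual_mnorm\<close>): it plays the part of the unit ball of a predual of $M_n(Y^*)$.\<close>

definition predual_ball ::
    "('k::complex_hilbert \<Rightarrow>\<^sub>L 'k) set \<Rightarrow> nat \<Rightarrow> (nat \<Rightarrow> nat \<Rightarrow> 'k \<Rightarrow>\<^sub>L 'k) set"
  where "predual_ball Y n = {a. \<exists>m\<ge>1. \<exists>A \<eta> \<xi>.
    (\<forall>k<m. \<forall>l<m. A k l \<in> Y) \<and> op_mnorm m A \<le> 1 \<and> hs_norm m n \<eta> \<le> 1 \<and> hs_norm m n \<xi> \<le> 1 \<and>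
    a = (\<lambda>i j. \<Sum>k<m. \<Sum>l<m. (cnj (\<eta> k i) * \<xi> l j) *\<^sub>C A k l)}"

lemma predual_ballI:
  assumes "m \<ge> 1" "\<And>k l. k < m \<Longrightarrow> l < m \<Longrightarrow> A k l \<in> Y" "op_mnorm m A \<le> 1"
    "hs_norm m n \<eta> \<le> 1" "hs_norm m n \<xi> \<le> 1"
  shows "(\<lambda>i j. \<Sum>k<m. \<Sum>l<m. (cnj (\<eta> k i) * \<xi> l j) *\<^sub>C A k l) \<in> predual_ball Y n"
  unfolding predual_ball_def using assms by blast

lemma hs_norm_nonneg [simp]: "0 \<le> hs_norm m n \<eta>"
  by (simp add: hs_norm_def sum_nonneg)

lemma hs_norm_eq_L2_set: "hs_norm m n \<eta> = L2_set (\<lambda>(k, i). cmod (\<eta> k i)) ({..<m} \<times> {..<n})"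
  by (simp add: hs_norm_def L2_set_def sum.cartesian_product case_prod_unfold)

lemma hs_norm_scale: "hs_norm m n (\<lambda>k i. c * \<eta> k i) = cmod c * hs_norm m n \<eta>"
  by (simp add: hs_norm_def norm_mult power_mult_distrib sum_distrib_left[symmetric] real_sqrt_mult)

lemma hs_norm_column_le:
  assumes "i < n"
  shows "L2_set (\<lambda>k. cmod (\<eta> k i)) {..<m} \<le> hs_norm m n \<eta>"
  unfolding L2_set_def hs_norm_def
  by (intro real_sqrt_le_mono sum_mono member_le_sum[where f = "\<lambda>i. (cmod (\<eta> k i))\<^sup>2" for k]) (use assms in auto)

lemma dual_mnorm_eq_SUP:
  "dual_mnorm Y n \<phi> = (SUP (m, A) \<in> {(m, A). 1 \<le> m \<and> A \<in> matrices m Y \<and> op_norm m A \<le> 1}.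
     SUP v \<in> {v. L2_set (\<lambda>p. cmod (v p)) ({..<m} \<times> {..<n}) \<le> 1}.
      L2_set (\<lambda>(k, i). cmod (\<Sum>l<m. \<Sum>j<n. \<phi> i j (A $$ (k, l)) * v (l, j))) ({..<m} \<times> {..<n}))"
  unfolding dual_mnorm_def dual_norm_def cb_norm_def scalar_norm_def
proof (intro SUP_cong refl, clarify)
  fix m :: nat and A :: "('a \<Rightarrow>\<^sub>L 'a) mat"
  assume "A \<in> matrices m Y"
  then have A: "dim_row A = m" "dim_col A = m" by (auto simp: matrices_def)
  show "(SUP v \<in> {v. L2_set (\<lambda>p. cmod (v p)) ({..<m} \<times> {..<n}) \<le> 1}.
      L2_set (\<lambda>(k, i). cmod (\<Sum>l<m. \<Sum>j<n. map_mat (\<lambda>y. map_mat (\<lambda>\<phi>. \<phi> y) (mat n n (\<lambda>(i, j). \<phi> i j))) A $$ (k, l) $$ (i, j) * v (l, j)))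
        ({..<m} \<times> {..<n})) =
     (SUP v \<in> {v. L2_set (\<lambda>p. cmod (v p)) ({..<m} \<times> {..<n}) \<le> 1}.
      L2_set (\<lambda>(k, i). cmod (\<Sum>l<m. \<Sum>j<n. \<phi> i j (A $$ (k, l)) * v (l, j))) ({..<m} \<times> {..<n}))"
    by (intro SUP_cong refl L2_set_cong) (auto simp: A intro!: arg_cong[of _ _ cmod] sum.cong)
qed

lemma L2_set_le_by_duality:
  fixes w :: "'a \<Rightarrow> complex"
  assumes "finite S" and "\<And>\<eta>. L2_set (\<lambda>p. cmod (\<eta> p)) S \<le> 1 \<Longrightarrow> Re (\<Sum>p\<in>S. cnj (\<eta> p) * w p) \<le> C"
  shows "L2_set (\<lambda>p. cmod (w p)) S \<le> C"
proof (cases "L2_set (\<lambda>p. cmod (w p)) S = 0")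
  case True
  then show ?thesis using assms(2)[of "\<lambda>_. 0"] by simp
next
  case False
  define W where "W = L2_set (\<lambda>p. cmod (w p)) S"
  have W: "W > 0" using False L2_set_nonneg[of "\<lambda>p. cmod (w p)" S] unfolding W_def by linarith
  have W2: "(\<Sum>p\<in>S. (cmod (w p))\<^sup>2) = W\<^sup>2" by (simp add: W_def L2_set_def sum_nonneg)
  define \<eta> where "\<eta> p = complex_of_real (1 / W) * w p" for p
  have "L2_set (\<lambda>p. cmod (\<eta> p)) S = L2_set (\<lambda>p. (1 / W) * cmod (w p)) S"
    using W by (simp add: \<eta>_def norm_mult norm_divide)
  also have "\<dots> = (1 / W) * L2_set (\<lambda>p. cmod (w p)) S"
    using W by (intro L2_set_right_distrib[symmetric]) simp
  also have "\<dots> = 1" using W by (simp flip: W_def)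
  finally have "L2_set (\<lambda>p. cmod (\<eta> p)) S \<le> 1" by simp
  from assms(2)[OF this] have "Re (\<Sum>p\<in>S. cnj (\<eta> p) * w p) \<le> C" .
  also have "(\<Sum>p\<in>S. cnj (\<eta> p) * w p) = complex_of_real ((1 / W) * (\<Sum>p\<in>S. (cmod (w p))\<^sup>2))"
    by (simp add: \<eta>_def sum_distrib_left complex_norm_square mult_ac del: of_real_power)
  also have "Re \<dots> = W" unfolding W2 using W by (simp add: power2_eq_square)
  finally show ?thesis by (simp add: W_def)
qed

lemma pairing_eq:
  assumes Y: "csubspace Y" and \<phi>: "\<And>i j. i < n \<Longrightarrow> j < n \<Longrightarrow> \<phi> i j \<in> dual_space Y"
    and A: "\<And>k l. k < m \<Longrightarrow> l < m \<Longrightarrow> A k l \<in> Y"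
  shows "(\<Sum>i<n. \<Sum>j<n. \<phi> i j (\<Sum>k<m. \<Sum>l<m. (cnj (\<eta> k i) * \<xi> l j) *\<^sub>C A k l))
    = (\<Sum>k<m. \<Sum>i<n. cnj (\<eta> k i) * (\<Sum>l<m. \<Sum>j<n. \<phi> i j (A k l) * \<xi> l j))"
proof -
  have sc: "c *\<^sub>C y \<in> Y" if "y \<in> Y" for c y using Y that by (simp add: csubspace_def)
  have "\<phi> i j (\<Sum>k<m. \<Sum>l<m. (cnj (\<eta> k i) * \<xi> l j) *\<^sub>C A k l)
      = (\<Sum>k<m. \<Sum>l<m. cnj (\<eta> k i) * \<xi> l j * \<phi> i j (A k l))" if "i < n" "j < n" for i j
  proof -
    have "\<phi> i j (\<Sum>k<m. \<Sum>l<m. (cnj (\<eta> k i) * \<xi> l j) *\<^sub>C A k l)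
      = (\<Sum>k<m. \<phi> i j (\<Sum>l<m. (cnj (\<eta> k i) * \<xi> l j) *\<^sub>C A k l))"
      by (intro dual_space_sum[OF Y \<phi>[OF that]] csubspace_sum[OF Y] sc) (use A in auto)
    also have "\<dots> = (\<Sum>k<m. \<Sum>l<m. \<phi> i j ((cnj (\<eta> k i) * \<xi> l j) *\<^sub>C A k l))"
      by (intro sum.cong refl dual_space_sum[OF Y \<phi>[OF that]] sc) (use A in auto)
    also have "\<dots> = (\<Sum>k<m. \<Sum>l<m. cnj (\<eta> k i) * \<xi> l j * \<phi> i j (A k l))"
      by (intro sum.cong refl dual_space_scaleC[OF \<phi>[OF that]]) (use A in auto)
    finally show ?thesis .
  qed
  then have "(\<Sum>i<n. \<Sum>j<n. \<phi> i j (\<Sum>k<m. \<Sum>l<m. (cnj (\<eta> k i) * \<xi> l j) *\<^sub>C A k l))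
    = (\<Sum>i<n. \<Sum>j<n. \<Sum>k<m. \<Sum>l<m. cnj (\<eta> k i) * \<xi> l j * \<phi> i j (A k l))"
    by simp
  also have "\<dots> = (\<Sum>i<n. \<Sum>k<m. \<Sum>j<n. \<Sum>l<m. cnj (\<eta> k i) * \<xi> l j * \<phi> i j (A k l))"
    by (intro sum.cong refl sum.swap)
  also have "\<dots> = (\<Sum>k<m. \<Sum>i<n. \<Sum>j<n. \<Sum>l<m. cnj (\<eta> k i) * \<xi> l j * \<phi> i j (A k l))"
    by (rule sum.swap)
  also have "\<dots> = (\<Sum>k<m. \<Sum>i<n. \<Sum>l<m. \<Sum>j<n. cnj (\<eta> k i) * \<xi> l j * \<phi> i j (A k l))"
    by (intro sum.cong refl sum.swap)
  finally show ?thesis by (simp add: sum_distrib_left mult_ac)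
qed

lemma predual_ball_entry:
  assumes "operator_space Y" "a \<in> predual_ball Y n" "i < n" "j < n"
  shows "a i j \<in> Y" "norm (a i j) \<le> 1"
proof -
  obtain m A \<eta> \<xi> where A: "\<And>k l. k < m \<Longrightarrow> l < m \<Longrightarrow> A k l \<in> Y" "op_mnorm m A \<le> 1"
    and h: "hs_norm m n \<eta> \<le> 1" "hs_norm m n \<xi> \<le> 1"
    and a: "a = (\<lambda>i j. \<Sum>k<m. \<Sum>l<m. (cnj (\<eta> k i) * \<xi> l j) *\<^sub>C A k l)"
    using assms(2) unfolding predual_ball_def by blast
  have Y: "csubspace Y" "Y \<subseteq> bounded_operators" using assms(1) by (auto simp: operator_space_def)
  have sc: "c *\<^sub>C y \<in> Y" if "y \<in> Y" for c y using Y that by (simp add: csubspace_def)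
  show "a i j \<in> Y" unfolding a by (intro csubspace_sum[OF Y(1)] sc) (use A in auto)
  have "norm (a i j) \<le> L2_set (\<lambda>k. cmod (\<eta> k i)) {..<m} * L2_set (\<lambda>k. cmod (\<xi> k j)) {..<m} * op_mnorm m A"
    unfolding a by (rule norm_scaleC_sum_le) (use A Y in auto)
  also have "\<dots> \<le> 1 * 1 * 1"
    using hs_norm_column_le[OF assms(3), of \<eta> m] hs_norm_column_le[OF assms(4), of \<xi> m] h A(2)
    by (intro mult_mono mult_nonneg_nonneg op_mnorm_nonneg) auto
  finally show "norm (a i j) \<le> 1" by simp
qed

lemma zero_in_predual_ball:
  assumes "csubspace Y"
  shows "(\<lambda>_ _. 0) \<in> predual_ball Y n"
proof -
  have "op_mnorm 1 (\<lambda>_ _. 0 :: 'a \<Rightarrow>\<^sub>L 'a) \<le> 1" using op_mnorm_1_le[of "0 :: 'a \<Rightarrow>\<^sub>L 'a"] by simp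
  moreover have "hs_norm 1 n (\<lambda>_ _. 0) \<le> 1" by (simp add: hs_norm_def)
  moreover have "0 \<in> Y" using assms by (simp add: csubspace_def)
  moreover have "(0::complex) *\<^sub>C (0 :: 'a \<Rightarrow>\<^sub>L 'a) = 0"
    using scaleR_scaleC[of 0 "0 :: 'a \<Rightarrow>\<^sub>L 'a"] by simp
  ultimately show ?thesis
    unfolding predual_ball_def
    by (intro CollectI exI[of _ "1::nat"] conjI exI[of _ "\<lambda>_ _. 0"]) auto
qed

lemma dual_space_bound:
  assumes "\<phi> \<in> dual_space Y"
  obtains K where "K \<ge> 0" "\<And>y. y \<in> Y \<Longrightarrow> cmod (\<phi> y) \<le> K * norm y"
proof -
  obtain K where K: "\<And>y. y \<in> Y \<Longrightarrow> cmod (\<phi> y) \<le> K * norm y" using assms unfolding dual_space_def by blast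
  have "cmod (\<phi> y) \<le> max K 0 * norm y" if "y \<in> Y" for y
    using K[OF that] mult_right_mono[of K "max K 0" "norm y"] by simp
  then show thesis using that[of "max K 0"] by simp
qed

lemma Re_pairing_le_sum:
  assumes Y: "operator_space Y" and a: "a \<in> predual_ball Y n"
    and b: "\<And>i j y. i < n \<Longrightarrow> j < n \<Longrightarrow> y \<in> Y \<Longrightarrow> cmod (\<phi> i j y) \<le> e i j * norm y"
    and e: "\<And>i j. i < n \<Longrightarrow> j < n \<Longrightarrow> e i j \<ge> 0"
  shows "Re (\<Sum>i<n. \<Sum>j<n. \<phi> i j (a i j)) \<le> (\<Sum>i<n. \<Sum>j<n. e i j)"
proof -
  have "Re (\<Sum>i<n. \<Sum>j<n. \<phi> i j (a i j)) \<le> (\<Sum>i<n. \<Sum>j<n. cmod (\<phi> i j (a i j)))"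
    by (rule order_trans[OF complex_Re_le_cmod], rule order_trans[OF norm_sum], intro sum_mono norm_sum)
  also have "\<dots> \<le> (\<Sum>i<n. \<Sum>j<n. e i j)"
  proof (intro sum_mono)
    fix i j assume "i \<in> {..<n}" "j \<in> {..<n}"
    then have ij: "i < n" "j < n" by auto
    have "cmod (\<phi> i j (a i j)) \<le> e i j * norm (a i j)" using predual_ball_entry[OF Y a ij] b[OF ij] by blast
    also have "\<dots> \<le> e i j * 1" using predual_ball_entry[OF Y a ij] e[OF ij] by (intro mult_left_mono) auto
    finally show "cmod (\<phi> i j (a i j)) \<le> e i j" by simp
  qed
  finally show ?thesis .
qed

lemma op_norm_eq_op_mnorm:
  "A \<in> carrier_mat m m \<Longrightarrow> op_norm m A = op_mnorm m (\<lambda>k l. A $$ (k, l))"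
  unfolding op_mnorm_def by (rule arg_cong[of _ _ "op_norm m"]) (auto intro!: eq_matI)

lemma amplified_apply_le:
  assumes Y: "csubspace Y" and \<phi>: "\<And>i j. i < n \<Longrightarrow> j < n \<Longrightarrow> \<phi> i j \<in> dual_space Y"
    and C: "\<And>a. a \<in> predual_ball Y n \<Longrightarrow> Re (\<Sum>i<n. \<Sum>j<n. \<phi> i j (a i j)) \<le> C"
    and m: "1 \<le> m" and A: "A \<in> matrices m Y" "op_norm m A \<le> 1"
    and v: "L2_set (\<lambda>p. cmod (v p)) ({..<m} \<times> {..<n}) \<le> 1"
  shows "L2_set (\<lambda>(k, i). cmod (\<Sum>l<m. \<Sum>j<n. \<phi> i j (A $$ (k, l)) * v (l, j))) ({..<m} \<times> {..<n}) \<le> C"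
proof -
  have AY: "A $$ (k, l) \<in> Y" if "k < m" "l < m" for k l
    using A that elements_matI[of A m m k l] by (auto simp: matrices_def)
  have An: "op_mnorm m (\<lambda>k l. A $$ (k, l)) \<le> 1"
    using A by (simp add: op_norm_eq_op_mnorm matrices_def)
  define w where "w p = (\<Sum>l<m. \<Sum>j<n. \<phi> (snd p) j (A $$ (fst p, l)) * v (l, j))" for p
  have "L2_set (\<lambda>p. cmod (w p)) ({..<m} \<times> {..<n}) \<le> C"
  proof (rule L2_set_le_by_duality)
    fix \<eta> assume \<eta>: "L2_set (\<lambda>p. cmod (\<eta> p)) ({..<m} \<times> {..<n}) \<le> 1"
    let ?a = "\<lambda>i j. \<Sum>k<m. \<Sum>l<m. (cnj (\<eta> (k, i)) * v (l, j)) *\<^sub>C A $$ (k, l)"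
    have "?a \<in> predual_ball Y n"
      using predual_ballI[where A = "\<lambda>k l. A $$ (k, l)" and \<eta> = "\<lambda>k i. \<eta> (k, i)" and \<xi> = "\<lambda>k i. v (k, i)" and m = m and n = n and Y = Y]
        m AY An \<eta> v by (simp add: hs_norm_eq_L2_set case_prod_unfold)
    from C[OF this]
    have "Re (\<Sum>k<m. \<Sum>i<n. cnj (\<eta> (k, i)) * (\<Sum>l<m. \<Sum>j<n. \<phi> i j (A $$ (k, l)) * v (l, j))) \<le> C"
      using pairing_eq[OF Y \<phi>, where m = m and A = "\<lambda>k l. A $$ (k, l)" and \<eta> = "\<lambda>k i. \<eta> (k, i)" and \<xi> = "\<lambda>k i. v (k, i)"] AY
      by (simp only:)
    then show "Re (\<Sum>p\<in>{..<m} \<times> {..<n}. cnj (\<eta> p) * w p) \<le> C"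
      by (simp only: w_def sum.cartesian_product case_prod_unfold fst_conv snd_conv prod.collapse)
  qed simp
  then show ?thesis by (simp add: w_def case_prod_unfold)
qed

lemma dual_mnorm_le:
  assumes Y: "csubspace Y" and \<phi>: "\<And>i j. i < n \<Longrightarrow> j < n \<Longrightarrow> \<phi> i j \<in> dual_space Y"
    and C: "\<And>a. a \<in> predual_ball Y n \<Longrightarrow> Re (\<Sum>i<n. \<Sum>j<n. \<phi> i j (a i j)) \<le> C"
  shows "dual_mnorm Y n \<phi> \<le> C"
  unfolding dual_mnorm_eq_SUP
proof (rule cSUP_least)
  have "mat 1 1 (\<lambda>(i, j). 0) \<in> matrices 1 Y" using Y by (auto simp: matrices_def csubspace_def elements_mat_def)
  moreover have "op_norm 1 (mat 1 1 (\<lambda>(i, j). 0) :: ('a \<Rightarrow>\<^sub>L 'a) mat) \<le> 1"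
    using op_mnorm_1_le[of "0 :: 'a \<Rightarrow>\<^sub>L 'a"] by (simp add: op_mnorm_def)
  ultimately show "{(m, A). 1 \<le> m \<and> A \<in> matrices m Y \<and> op_norm m A \<le> 1} \<noteq> {}" by blast
  fix x assume x: "x \<in> {(m, A). 1 \<le> m \<and> A \<in> matrices m Y \<and> op_norm m A \<le> 1}"
  then obtain m A where mA: "x = (m, A)" "1 \<le> m" "A \<in> matrices m Y" "op_norm m A \<le> 1" by (cases x) auto
  have "(SUP v\<in>{v. L2_set (\<lambda>p. cmod (v p)) ({..<m} \<times> {..<n}) \<le> 1}.
      L2_set (\<lambda>(k, i). cmod (\<Sum>l<m. \<Sum>j<n. \<phi> i j (A $$ (k, l)) * v (l, j))) ({..<m} \<times> {..<n})) \<le> C"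
  proof (rule cSUP_least)
    show "{v :: nat \<times> nat \<Rightarrow> complex. L2_set (\<lambda>p. cmod (v p)) ({..<m} \<times> {..<n}) \<le> 1} \<noteq> {}"
      by (auto intro!: exI[of _ "\<lambda>_. 0"])
  qed (use amplified_apply_le[OF Y \<phi> C mA(2-4)] in auto)
  then show "(case x of (m, A) \<Rightarrow> SUP v\<in>{v. L2_set (\<lambda>p. cmod (v p)) ({..<m} \<times> {..<n}) \<le> 1}.
      L2_set (\<lambda>(k, i). cmod (\<Sum>l<m. \<Sum>j<n. \<phi> i j (A $$ (k, l)) * v (l, j))) ({..<m} \<times> {..<n})) \<le> C"
    by (simp add: mA)
qed

lemma Re_pairing_le_dual_mnorm:
  assumes Y: "operator_space Y" and \<phi>: "\<And>i j. i < n \<Longrightarrow> j < n \<Longrightarrow> \<phi> i j \<in> dual_space Y"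
    and a: "a \<in> predual_ball Y n"
  shows "Re (\<Sum>i<n. \<Sum>j<n. \<phi> i j (a i j)) \<le> dual_mnorm Y n \<phi>"
proof -
  have sub: "csubspace Y" using Y by (simp add: operator_space_def)
  have "\<exists>K. i < n \<longrightarrow> j < n \<longrightarrow> K \<ge> 0 \<and> (\<forall>y\<in>Y. cmod (\<phi> i j y) \<le> K * norm y)" for i j
    using dual_space_bound[of "\<phi> i j" Y] \<phi>[of i j] by metis
  then obtain K where K: "\<And>i j. i < n \<Longrightarrow> j < n \<Longrightarrow> K i j \<ge> 0"
      "\<And>i j y. i < n \<Longrightarrow> j < n \<Longrightarrow> y \<in> Y \<Longrightarrow> cmod (\<phi> i j y) \<le> K i j * norm y" by metis
  define C where "C = (\<Sum>i<n. \<Sum>j<n. K i j)"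
  have C: "Re (\<Sum>i<n. \<Sum>j<n. \<phi> i j (a i j)) \<le> C" if "a \<in> predual_ball Y n" for a
    unfolding C_def using Re_pairing_le_sum[OF Y that] K by blast
  obtain m A \<eta> \<xi> where m: "m \<ge> 1" and A: "\<And>k l. k < m \<Longrightarrow> l < m \<Longrightarrow> A k l \<in> Y" "op_mnorm m A \<le> 1"
    and h: "hs_norm m n \<eta> \<le> 1" "hs_norm m n \<xi> \<le> 1"
    and a: "a = (\<lambda>i j. \<Sum>k<m. \<Sum>l<m. (cnj (\<eta> k i) * \<xi> l j) *\<^sub>C A k l)"
    using a unfolding predual_ball_def by blast
  define A' where "A' = mat m m (\<lambda>(k, l). A k l)"
  have A': "A' \<in> matrices m Y" "op_norm m A' \<le> 1"
    using A by (auto simp: A'_def matrices_def elements_mat_def op_mnorm_def)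
  define g where "g m A v = L2_set (\<lambda>(k, i). cmod (\<Sum>l<m. \<Sum>j<n. \<phi> i j (A $$ (k, l)) * v (l, j))) ({..<m} \<times> {..<n})"
    for m A and v :: "nat \<times> nat \<Rightarrow> complex"
  have gle: "g m A v \<le> C" if "1 \<le> m" "A \<in> matrices m Y" "op_norm m A \<le> 1" "L2_set (\<lambda>p. cmod (v p)) ({..<m} \<times> {..<n}) \<le> 1"
    for m A v unfolding g_def by (rule amplified_apply_le[OF sub \<phi> C that])
  let ?V = "\<lambda>m. {v. L2_set (\<lambda>p. cmod (v p)) ({..<m} \<times> {..<n}) \<le> 1}"
  let ?T = "{(m, A). 1 \<le> m \<and> A \<in> matrices m Y \<and> op_norm m A \<le> 1}"
  define G where "G = (\<lambda>(m, A). SUP v \<in> ?V m. g m A v)"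
  have Gle: "G x \<le> C" if "x \<in> ?T" for x
  proof -
    obtain m' B where mB: "x = (m', B)" "1 \<le> m'" "B \<in> matrices m' Y" "op_norm m' B \<le> 1"
      using \<open>x \<in> ?T\<close> by (cases x) auto
    have "(SUP v \<in> ?V m'. g m' B v) \<le> C"
    proof (rule cSUP_least)
      show "?V m' \<noteq> {}" by (auto intro!: exI[of _ "\<lambda>_. 0"])
    qed (use gle[OF mB(2-4)] in auto)
    then show ?thesis by (simp add: G_def mB)
  qed
  have nrm: "dual_mnorm Y n \<phi> = (SUP x \<in> ?T. G x)"
    unfolding dual_mnorm_eq_SUP G_def g_def ..
  define v where "v = (\<lambda>(l, j). \<xi> l j)"
  define w where "w = (\<lambda>p. \<Sum>l<m. \<Sum>j<n. \<phi> (snd p) j (A (fst p) l) * \<xi> l j)"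
  have "Re (\<Sum>i<n. \<Sum>j<n. \<phi> i j (a i j)) = Re (\<Sum>p\<in>{..<m} \<times> {..<n}. cnj (\<eta> (fst p) (snd p)) * w p)"
    unfolding a using pairing_eq[where \<phi> = \<phi> and A = A and n = n and m = m and \<eta> = \<eta> and \<xi> = \<xi>, OF sub \<phi> A(1)]
    by (simp only: w_def sum.cartesian_product case_prod_unfold fst_conv snd_conv prod.collapse)
  also have "\<dots> \<le> (\<Sum>p\<in>{..<m} \<times> {..<n}. \<bar>cmod (\<eta> (fst p) (snd p))\<bar> * \<bar>cmod (w p)\<bar>)"
    by (rule order_trans[OF complex_Re_le_cmod], rule order_trans[OF norm_sum]) (simp add: norm_mult)
  also have "\<dots> \<le> L2_set (\<lambda>p. cmod (\<eta> (fst p) (snd p))) ({..<m} \<times> {..<n}) * L2_set (\<lambda>p. cmod (w p)) ({..<m} \<times> {..<n})"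
    by (rule L2_set_mult_ineq)
  also have "\<dots> \<le> 1 * L2_set (\<lambda>p. cmod (w p)) ({..<m} \<times> {..<n})"
    using h by (intro mult_right_mono) (auto simp: hs_norm_eq_L2_set case_prod_unfold)
  also have "L2_set (\<lambda>p. cmod (w p)) ({..<m} \<times> {..<n}) = g m A' v"
    unfolding g_def by (rule L2_set_cong) (auto simp: w_def A'_def v_def intro!: arg_cong[of _ _ cmod] sum.cong)
  also have "1 * \<dots> = g m A' v" by simp
  also have "g m A' v \<le> G (m, A')"
    unfolding G_def using h gle[OF m A']
    by (auto simp: v_def hs_norm_eq_L2_set case_prod_unfold intro!: cSUP_upper2[where x = v] bdd_aboveI2[where M = C])
  also have "\<dots> \<le> (SUP x \<in> ?T. G x)"
    using m A' Gle by (intro cSUP_upper bdd_aboveI2[where M = C]) auto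
  finally show ?thesis unfolding nrm .
qed

section \<open>Block matrices of functionals\<close>

lemma dual_mnorm_cong:
  assumes "\<And>i j. i < n \<Longrightarrow> j < n \<Longrightarrow> \<phi> i j = \<psi> i j"
  shows "dual_mnorm Y n \<phi> = dual_mnorm Y n \<psi>"
  unfolding dual_mnorm_def using assms by (intro arg_cong[of _ _ "dual_norm Y n"]) (auto intro!: eq_matI)

lemma dual_space_add: "csubspace Y \<Longrightarrow> \<phi> \<in> dual_space Y \<Longrightarrow> \<psi> \<in> dual_space Y \<Longrightarrow> \<phi> + \<psi> \<in> dual_space Y"
proof -
  assume Y: "csubspace Y" and h: "\<phi> \<in> dual_space Y" "\<psi> \<in> dual_space Y"
  obtain K1 where K1: "\<And>y. y \<in> Y \<Longrightarrow> cmod (\<phi> y) \<le> K1 * norm y" using h(1) unfolding dual_space_def by blast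
  obtain K2 where K2: "\<And>y. y \<in> Y \<Longrightarrow> cmod (\<psi> y) \<le> K2 * norm y" using h(2) unfolding dual_space_def by blast
  have "cmod (\<phi> y + \<psi> y) \<le> (K1 + K2) * norm y" if "y \<in> Y" for y
    using norm_triangle_ineq[of "\<phi> y" "\<psi> y"] K1[OF that] K2[OF that] by (simp add: algebra_simps)
  then have "\<exists>K. \<forall>y\<in>Y. cmod ((\<phi> + \<psi>) y) \<le> K * norm y" by auto
  then show ?thesis using h unfolding dual_space_def mem_Collect_eq by (simp add: algebra_simps)
qed

lemma dual_space_scaleR: "\<phi> \<in> dual_space Y \<Longrightarrow> r *\<^sub>R \<phi> \<in> dual_space Y"
proof -
  assume h: "\<phi> \<in> dual_space Y"
  obtain K where K: "\<And>y. y \<in> Y \<Longrightarrow> cmod (\<phi> y) \<le> K * norm y" using h unfolding dual_space_def by blast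
  have "cmod (r *\<^sub>R \<phi> y) \<le> (\<bar>r\<bar> * K) * norm y" if "y \<in> Y" for y
    using mult_left_mono[OF K[OF that], of "\<bar>r\<bar>"] by (simp add: mult.assoc)
  then show ?thesis using h unfolding dual_space_def
    by (auto simp: scaleR_fun_def scaleR_add_right)
qed

lemma dual_space_diff:
  assumes "csubspace Y" "\<phi> \<in> dual_space Y" "\<psi> \<in> dual_space Y"
  shows "\<phi> - \<psi> \<in> dual_space Y"
  using assms dual_space_add[of Y \<phi> "(-1) *\<^sub>R \<psi>"] dual_space_scaleR[of \<psi> Y "-1"]
  by simp

lemma dual_mnorm_nonneg:
  assumes Y: "operator_space Y" and \<phi>: "\<And>i j. i < n \<Longrightarrow> j < n \<Longrightarrow> \<phi> i j \<in> dual_space Y"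
  shows "0 \<le> dual_mnorm Y n \<phi>"
proof -
  have sub: "csubspace Y" using Y by (simp add: operator_space_def)
  have "\<phi> i j 0 = 0" if "i < n" "j < n" for i j
    using dual_space_sum[OF sub \<phi>[OF that], of "{}" "\<lambda>_. 0"] by simp
  then have "(\<Sum>i<n. \<Sum>j<n. \<phi> i j 0) = 0" by simp
  moreover have "Re (\<Sum>i<n. \<Sum>j<n. \<phi> i j 0) \<le> dual_mnorm Y n \<phi>"
    by (rule Re_pairing_le_dual_mnorm[OF Y \<phi> zero_in_predual_ball[OF sub]])
  ultimately show ?thesis by (simp only: zero_complex.sel)
qed

lemma Re_of_real_mult: "Re (complex_of_real c * z) = c * Re z"
  by simp

text \<open>The pairing in homogeneous form, ready to be summed over blocks.\<close>

lemma Re_form_le_scaled: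
  fixes A :: "nat \<Rightarrow> nat \<Rightarrow> 'k::complex_hilbert \<Rightarrow>\<^sub>L 'k"
  assumes Y: "operator_space Y" and \<phi>: "\<And>i j. i < n \<Longrightarrow> j < n \<Longrightarrow> \<phi> i j \<in> dual_space Y"
    and m: "m \<ge> 1" and A: "\<And>k l. k < m \<Longrightarrow> l < m \<Longrightarrow> A k l \<in> Y" "op_mnorm m A \<le> 1"
  shows "Re (\<Sum>k<m. \<Sum>i<n. cnj (\<eta> k i) * (\<Sum>l<m. \<Sum>j<n. \<phi> i j (A k l) * \<xi> l j))
    \<le> dual_mnorm Y n \<phi> * (hs_norm m n \<eta> * hs_norm m n \<xi>)" (is "Re (?P \<eta> \<xi>) \<le> _")
proof -
  have sub: "csubspace Y" using Y by (simp add: operator_space_def)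
  have z: "hs_norm m n \<zeta> = 0 \<Longrightarrow> k < m \<Longrightarrow> i < n \<Longrightarrow> \<zeta> k i = 0" for \<zeta> k i
  proof -
    assume h: "hs_norm m n \<zeta> = 0" "k < m" "i < n"
    have "cmod (\<zeta> k i) \<le> hs_norm m n \<zeta>"
      by (rule order_trans[OF _ hs_norm_column_le[OF h(3)]])
         (rule member_le_L2_set[of _ _ "\<lambda>k. cmod (\<zeta> k i)"], use h in auto)
    with h show ?thesis by simp
  qed
  consider "hs_norm m n \<eta> = 0" | "hs_norm m n \<xi> = 0" | "hs_norm m n \<eta> > 0" "hs_norm m n \<xi> > 0"
    using hs_norm_nonneg[of m n \<eta>] hs_norm_nonneg[of m n \<xi>] by linarith
  then show ?thesis
  proof cases
    case 1
    then have "?P \<eta> \<xi> = 0" by (intro sum.neutral ballI) (simp add: z)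
    with 1 show ?thesis by simp
  next
    case 2
    then have "?P \<eta> \<xi> = 0" by (intro sum.neutral ballI) (simp add: z)
    with 2 show ?thesis by simp
  next
    case 3
    define r s where "r = hs_norm m n \<eta>" and "s = hs_norm m n \<xi>"
    have rs: "r > 0" "s > 0" using 3 by (auto simp: r_def s_def)
    define \<eta>' \<xi>' where "\<eta>' k i = complex_of_real (1 / r) * \<eta> k i" and "\<xi>' l j = complex_of_real (1 / s) * \<xi> l j" for k i l j
    have h: "hs_norm m n \<eta>' \<le> 1" "hs_norm m n \<xi>' \<le> 1"
      using rs unfolding \<eta>'_def \<xi>'_def hs_norm_scale by (auto simp: norm_divide simp flip: r_def s_def)
    let ?a = "\<lambda>i j. \<Sum>k<m. \<Sum>l<m. (cnj (\<eta>' k i) * \<xi>' l j) *\<^sub>C A k l"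
    have "(\<Sum>i<n. \<Sum>j<n. \<phi> i j (?a i j)) = ?P \<eta>' \<xi>'"
      by (rule pairing_eq[OF sub \<phi> A(1)])
    moreover have "Re (\<Sum>i<n. \<Sum>j<n. \<phi> i j (?a i j)) \<le> dual_mnorm Y n \<phi>"
      by (rule Re_pairing_le_dual_mnorm[OF Y \<phi> predual_ballI[OF m A h]])
    ultimately have "Re (?P \<eta>' \<xi>') \<le> dual_mnorm Y n \<phi>" by (simp only:)
    moreover have "?P \<eta>' \<xi>' = complex_of_real (1 / (r * s)) * ?P \<eta> \<xi>"
      by (simp add: \<eta>'_def \<xi>'_def sum_distrib_left mult_ac)
    then have "Re (?P \<eta>' \<xi>') = (1 / (r * s)) * Re (?P \<eta> \<xi>)"
      by (simp only: Re_of_real_mult)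
    ultimately have "(1 / (r * s)) * Re (?P \<eta> \<xi>) \<le> dual_mnorm Y n \<phi>" by (simp only:)
    then show ?thesis using rs by (simp add: field_simps flip: r_def s_def)
  qed
qed

lemma sum_rotate:
  fixes g :: "'a \<Rightarrow> 'b \<Rightarrow> 'c \<Rightarrow> 'd::comm_monoid_add"
  shows "(\<Sum>a\<in>S. \<Sum>b\<in>T. \<Sum>c\<in>U. g a b c) = (\<Sum>b\<in>T. \<Sum>c\<in>U. \<Sum>a\<in>S. g a b c)"
proof -
  have "(\<Sum>a\<in>S. \<Sum>b\<in>T. \<Sum>c\<in>U. g a b c) = (\<Sum>b\<in>T. \<Sum>a\<in>S. \<Sum>c\<in>U. g a b c)" by (rule sum.swap)
  also have "\<dots> = (\<Sum>b\<in>T. \<Sum>c\<in>U. \<Sum>a\<in>S. g a b c)" by (intro sum.cong refl sum.swap)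
  finally show ?thesis .
qed

lemma sum_block:
  fixes g :: "nat \<Rightarrow> 'c::comm_monoid_add"
  shows "(\<Sum>p<n * m. g p) = (\<Sum>\<alpha><m. \<Sum>i<n. g (\<alpha> * n + i))"
proof -
  have "(\<Sum>p<n * m. g p) = (\<Sum>p<n * m. g ((p div n) * n + p mod n))" by simp
  also have "\<dots> = (\<Sum>i<n. \<Sum>\<alpha><m. g (\<alpha> * n + i))"
    by (rule sum_mod_div)
  finally show ?thesis by (simp add: sum.swap[of _ "{..<m}"])
qed

text \<open>Tensoring with a scalar matrix \<open>B\<close> costs at most the operator norm of \<open>B\<close>: let \<open>B\<close> act on one
  of the two test vectors, estimate each of the \<open>m\<close> block rows separately, and sum up with the
  Cauchy-Schwarz inequality.\<close>

lemma dual_mnorm_block_le: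
  fixes B :: "nat \<Rightarrow> nat \<Rightarrow> real"
  assumes Y: "operator_space Y" and \<phi>: "\<And>i j. i < n \<Longrightarrow> j < n \<Longrightarrow> \<phi> i j \<in> dual_space Y"
    and \<beta>: "\<beta> \<ge> 0" and B: "\<And>\<zeta> :: nat \<Rightarrow> complex.
      (\<Sum>\<alpha><m. (cmod (\<Sum>b<m. complex_of_real (B \<alpha> b) * \<zeta> b))\<^sup>2) \<le> \<beta>\<^sup>2 * (\<Sum>b<m. (cmod (\<zeta> b))\<^sup>2)"
  shows "dual_mnorm Y (n * m) (\<lambda>p q. B (p div n) (q div n) *\<^sub>R \<phi> (p mod n) (q mod n)) \<le> \<beta> * dual_mnorm Y n \<phi>"
proof -
  have sub: "csubspace Y" using Y by (simp add: operator_space_def)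
  have D0: "0 \<le> dual_mnorm Y n \<phi>" by (rule dual_mnorm_nonneg[OF Y \<phi>])
  define \<Phi> where "\<Phi> p q = B (p div n) (q div n) *\<^sub>R \<phi> (p mod n) (q mod n)" for p q
  have \<Phi>: "\<Phi> p q \<in> dual_space Y" if "p < n * m" "q < n * m" for p q
  proof -
    have "n > 0" using that(1) by (metis gr0I mult_0 not_less_zero)
    then show ?thesis unfolding \<Phi>_def by (intro dual_space_scaleR \<phi>) auto
  qed
  have "dual_mnorm Y (n * m) \<Phi> \<le> \<beta> * dual_mnorm Y n \<phi>"
  proof (rule dual_mnorm_le[OF sub \<Phi>])
    fix a assume "a \<in> predual_ball Y (n * m)"
    then obtain M A \<eta> \<xi> where M: "M \<ge> 1" and A: "\<And>k l. k < M \<Longrightarrow> l < M \<Longrightarrow> A k l \<in> Y" "op_mnorm M A \<le> 1"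
      and h: "hs_norm M (n * m) \<eta> \<le> 1" "hs_norm M (n * m) \<xi> \<le> 1"
      and a: "a = (\<lambda>i j. \<Sum>k<M. \<Sum>l<M. (cnj (\<eta> k i) * \<xi> l j) *\<^sub>C A k l)"
      unfolding predual_ball_def by blast
    define \<eta>' where "\<eta>' \<alpha> k i = \<eta> k (\<alpha> * n + i)" for \<alpha> k i
    define \<xi>' where "\<xi>' \<alpha> l j = (\<Sum>b<m. complex_of_real (B \<alpha> b) * \<xi> l (b * n + j))" for \<alpha> l j
    have inner: "(\<Sum>b<m. \<Sum>j<n. \<Phi> (\<alpha> * n + i) (b * n + j) (A k l) * \<xi> l (b * n + j)) = (\<Sum>j<n. \<phi> i j (A k l) * \<xi>' \<alpha> l j)"
      if "i < n" for \<alpha> i k l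
    proof -
      have "(\<Sum>b<m. \<Sum>j<n. \<Phi> (\<alpha> * n + i) (b * n + j) (A k l) * \<xi> l (b * n + j))
        = (\<Sum>b<m. \<Sum>j<n. \<phi> i j (A k l) * (complex_of_real (B \<alpha> b) * \<xi> l (b * n + j)))"
        using that by (intro sum.cong refl) (simp add: \<Phi>_def scaleR_fun_def scaleR_conv_of_real)
      also have "\<dots> = (\<Sum>j<n. \<phi> i j (A k l) * \<xi>' \<alpha> l j)"
        by (subst sum.swap) (simp add: \<xi>'_def sum_distrib_left)
      finally show ?thesis .
    qed
    have "(\<Sum>p<n * m. \<Sum>q<n * m. \<Phi> p q (a p q))
      = (\<Sum>k<M. \<Sum>p<n * m. cnj (\<eta> k p) * (\<Sum>l<M. \<Sum>q<n * m. \<Phi> p q (A k l) * \<xi> l q))"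
      unfolding a by (rule pairing_eq[OF sub \<Phi> A(1)])
    also have "\<dots> = (\<Sum>k<M. \<Sum>\<alpha><m. \<Sum>i<n. cnj (\<eta>' \<alpha> k i) * (\<Sum>l<M. \<Sum>j<n. \<phi> i j (A k l) * \<xi>' \<alpha> l j))"
      unfolding sum_block by (intro sum.cong refl) (simp add: inner \<eta>'_def)
    also have "\<dots> = (\<Sum>\<alpha><m. \<Sum>k<M. \<Sum>i<n. cnj (\<eta>' \<alpha> k i) * (\<Sum>l<M. \<Sum>j<n. \<phi> i j (A k l) * \<xi>' \<alpha> l j))"
      by (rule sum.swap)
    finally have "Re (\<Sum>p<n * m. \<Sum>q<n * m. \<Phi> p q (a p q))
      = (\<Sum>\<alpha><m. Re (\<Sum>k<M. \<Sum>i<n. cnj (\<eta>' \<alpha> k i) * (\<Sum>l<M. \<Sum>j<n. \<phi> i j (A k l) * \<xi>' \<alpha> l j)))"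
      by (simp only: Re_sum)
    also have "\<dots> \<le> (\<Sum>\<alpha><m. dual_mnorm Y n \<phi> * (hs_norm M n (\<eta>' \<alpha>) * hs_norm M n (\<xi>' \<alpha>)))"
      by (intro sum_mono Re_form_le_scaled[OF Y \<phi> M A])
    also have "\<dots> = dual_mnorm Y n \<phi> * (\<Sum>\<alpha><m. \<bar>hs_norm M n (\<eta>' \<alpha>)\<bar> * \<bar>hs_norm M n (\<xi>' \<alpha>)\<bar>)"
      by (simp add: sum_distrib_left)
    also have "\<dots> \<le> dual_mnorm Y n \<phi> * (1 * \<beta>)"
    proof (intro mult_left_mono D0 order_trans[OF L2_set_mult_ineq] mult_mono)
      have sw: "(\<Sum>\<alpha><m. \<Sum>k<M. \<Sum>i<n. (cmod (\<zeta> k (\<alpha> * n + i)))\<^sup>2) = (hs_norm M (n * m) \<zeta>)\<^sup>2" for \<zeta>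
        by (subst sum.swap) (simp add: hs_norm_def sum_block sum_nonneg)
      show "L2_set (\<lambda>\<alpha>. hs_norm M n (\<eta>' \<alpha>)) {..<m} \<le> 1"
        using h(1) sw[of \<eta>] by (simp add: L2_set_def \<eta>'_def hs_norm_def[of M n] sum_nonneg abs_le_square_iff[symmetric])
      have "(\<Sum>\<alpha><m. (hs_norm M n (\<xi>' \<alpha>))\<^sup>2) = (\<Sum>\<alpha><m. \<Sum>l<M. \<Sum>j<n. (cmod (\<xi>' \<alpha> l j))\<^sup>2)"
        by (simp add: hs_norm_def sum_nonneg)
      also have "\<dots> = (\<Sum>l<M. \<Sum>j<n. \<Sum>\<alpha><m. (cmod (\<xi>' \<alpha> l j))\<^sup>2)"
        by (rule sum_rotate)
      also have "\<dots> \<le> (\<Sum>l<M. \<Sum>j<n. \<beta>\<^sup>2 * (\<Sum>b<m. (cmod (\<xi> l (b * n + j)))\<^sup>2))"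
        unfolding \<xi>'_def by (intro sum_mono B)
      also have "\<dots> = \<beta>\<^sup>2 * (\<Sum>b<m. \<Sum>l<M. \<Sum>j<n. (cmod (\<xi> l (b * n + j)))\<^sup>2)"
        unfolding sum_distrib_left by (rule sum_rotate[symmetric])
      also have "\<dots> = \<beta>\<^sup>2 * (hs_norm M (n * m) \<xi>)\<^sup>2" by (simp only: sw)
      also have "\<dots> \<le> \<beta>\<^sup>2 * 1" using h(2) by (intro mult_left_mono) (auto simp: abs_square_le_1)
      finally show "L2_set (\<lambda>\<alpha>. hs_norm M n (\<xi>' \<alpha>)) {..<m} \<le> \<beta>"
        unfolding L2_set_def using \<beta> by (intro real_le_lsqrt) (auto intro: sum_nonneg)
    qed (auto simp: \<beta>)
    finally show "Re (\<Sum>p<n * m. \<Sum>q<n * m. \<Phi> p q (a p q)) \<le> \<beta> * dual_mnorm Y n \<phi>" by (simp add: mult.commute)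
  qed
  then show ?thesis by (simp add: \<Phi>_def[abs_def])
qed

lemma dual_mnorm_scaleR_le:
  assumes Y: "operator_space Y" and \<phi>: "\<And>i j. i < n \<Longrightarrow> j < n \<Longrightarrow> \<phi> i j \<in> dual_space Y"
  shows "dual_mnorm Y n (\<lambda>i j. r *\<^sub>R \<phi> i j) \<le> \<bar>r\<bar> * dual_mnorm Y n \<phi>"
proof -
  have "dual_mnorm Y (n * 1) (\<lambda>p q. r *\<^sub>R \<phi> (p mod n) (q mod n)) \<le> \<bar>r\<bar> * dual_mnorm Y n \<phi>"
    by (rule dual_mnorm_block_le[where B = "\<lambda>_ _. r" and m = 1, OF Y \<phi>]) (auto simp: norm_mult power_mult_distrib)
  moreover have "dual_mnorm Y (n * 1) (\<lambda>p q. r *\<^sub>R \<phi> (p mod n) (q mod n)) = dual_mnorm Y n (\<lambda>i j. r *\<^sub>R \<phi> i j)"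
    unfolding mult_1_right by (rule dual_mnorm_cong) simp
  ultimately show ?thesis by simp
qed

lemma dual_mnorm_block_constant_le:
  assumes Y: "operator_space Y" and \<phi>: "\<And>i j. i < n \<Longrightarrow> j < n \<Longrightarrow> \<phi> i j \<in> dual_space Y"
  shows "dual_mnorm Y (n * m) (\<lambda>p q. \<phi> (p mod n) (q mod n)) \<le> real m * dual_mnorm Y n \<phi>"
proof -
  have "dual_mnorm Y (n * m) (\<lambda>p q. (\<lambda>_ _. 1::real) (p div n) (q div n) *\<^sub>R \<phi> (p mod n) (q mod n)) \<le> real m * dual_mnorm Y n \<phi>"
  proof (rule dual_mnorm_block_le[OF Y \<phi>])
    fix \<zeta> :: "nat \<Rightarrow> complex"
    have "cmod (\<Sum>b<m. \<zeta> b) \<le> (\<Sum>b<m. \<bar>1\<bar> * \<bar>cmod (\<zeta> b)\<bar>)" by (rule order_trans[OF norm_sum]) simp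
    also have "\<dots> \<le> L2_set (\<lambda>_. 1) {..<m} * L2_set (\<lambda>b. cmod (\<zeta> b)) {..<m}" by (rule L2_set_mult_ineq)
    finally have "(cmod (\<Sum>b<m. \<zeta> b))\<^sup>2 \<le> (L2_set (\<lambda>_. 1) {..<m} * L2_set (\<lambda>b. cmod (\<zeta> b)) {..<m})\<^sup>2"
      by (intro power_mono) auto
    also have "\<dots> = m * (\<Sum>b<m. (cmod (\<zeta> b))\<^sup>2)"
      by (simp add: L2_set_def power_mult_distrib sum_nonneg)
    finally have "m * (cmod (\<Sum>b<m. \<zeta> b))\<^sup>2 \<le> m * (m * (\<Sum>b<m. (cmod (\<zeta> b))\<^sup>2))"
      by (intro mult_left_mono) auto
    then show "(\<Sum>\<alpha><m. (cmod (\<Sum>b<m. complex_of_real 1 * \<zeta> b))\<^sup>2) \<le> (real m)\<^sup>2 * (\<Sum>b<m. (cmod (\<zeta> b))\<^sup>2)"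
      by (simp add: power2_eq_square mult.assoc)
  qed auto
  then show ?thesis by simp
qed

text \<open>Repeat the test vectors in every block and divide them by \<open>sqrt m\<close>.\<close>

lemma dual_mnorm_le_block_constant:
  assumes Y: "operator_space Y" and \<phi>: "\<And>i j. i < n \<Longrightarrow> j < n \<Longrightarrow> \<phi> i j \<in> dual_space Y" and m: "m \<ge> 1"
  shows "real m * dual_mnorm Y n \<phi> \<le> dual_mnorm Y (n * m) (\<lambda>p q. \<phi> (p mod n) (q mod n))"
proof -
  have sub: "csubspace Y" using Y by (simp add: operator_space_def)
  define \<Phi> where "\<Phi> p q = \<phi> (p mod n) (q mod n)" for p q
  have \<Phi>: "\<Phi> p q \<in> dual_space Y" if "p < n * m" "q < n * m" for p q
  proof -
    have "n > 0" using that(1) by (metis gr0I mult_0 not_less_zero)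
    then show ?thesis unfolding \<Phi>_def by (intro \<phi>) auto
  qed
  have "dual_mnorm Y n \<phi> \<le> dual_mnorm Y (n * m) \<Phi> / m"
  proof (rule dual_mnorm_le[OF sub \<phi>])
    fix a assume "a \<in> predual_ball Y n"
    then obtain M A \<eta> \<xi> where M: "M \<ge> 1" and A: "\<And>k l. k < M \<Longrightarrow> l < M \<Longrightarrow> A k l \<in> Y" "op_mnorm M A \<le> 1"
      and h: "hs_norm M n \<eta> \<le> 1" "hs_norm M n \<xi> \<le> 1"
      and a: "a = (\<lambda>i j. \<Sum>k<M. \<Sum>l<M. (cnj (\<eta> k i) * \<xi> l j) *\<^sub>C A k l)"
      unfolding predual_ball_def by blast
    have hs: "hs_norm M (n * m) (\<lambda>k p. \<zeta> k (p mod n)) = sqrt m * hs_norm M n \<zeta>" for \<zeta>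
      unfolding hs_norm_def sum_block by (simp add: sum_distrib_left[symmetric] real_sqrt_mult)
    have "Re (\<Sum>k<M. \<Sum>p<n * m. cnj (\<eta> k (p mod n)) * (\<Sum>l<M. \<Sum>q<n * m. \<Phi> p q (A k l) * \<xi> l (q mod n)))
      \<le> dual_mnorm Y (n * m) \<Phi> * (hs_norm M (n * m) (\<lambda>k p. \<eta> k (p mod n)) * hs_norm M (n * m) (\<lambda>k p. \<xi> k (p mod n)))"
      by (rule Re_form_le_scaled[OF Y \<Phi> M A])
    also have "hs_norm M (n * m) (\<lambda>k p. \<eta> k (p mod n)) * hs_norm M (n * m) (\<lambda>k p. \<xi> k (p mod n))
      = m * (hs_norm M n \<eta> * hs_norm M n \<xi>)"
      unfolding hs by simp
    also have "(\<Sum>k<M. \<Sum>p<n * m. cnj (\<eta> k (p mod n)) * (\<Sum>l<M. \<Sum>q<n * m. \<Phi> p q (A k l) * \<xi> l (q mod n)))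
      = complex_of_real (real (m * m)) * (\<Sum>k<M. \<Sum>i<n. cnj (\<eta> k i) * (\<Sum>l<M. \<Sum>j<n. \<phi> i j (A k l) * \<xi> l j))"
      unfolding sum_block by (simp add: \<Phi>_def sum_distrib_left mult_ac)
    also have "\<dots> = complex_of_real (real (m * m)) * (\<Sum>i<n. \<Sum>j<n. \<phi> i j (a i j))"
      unfolding a by (subst pairing_eq[OF sub \<phi> A(1)]) auto
    also have "Re \<dots> = real (m * m) * Re (\<Sum>i<n. \<Sum>j<n. \<phi> i j (a i j))"
      by (simp only: Re_of_real_mult)
    finally have 1: "real (m * m) * Re (\<Sum>i<n. \<Sum>j<n. \<phi> i j (a i j)) \<le> dual_mnorm Y (n * m) \<Phi> * (m * (hs_norm M n \<eta> * hs_norm M n \<xi>))" .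
    have D0: "0 \<le> dual_mnorm Y (n * m) \<Phi>" by (rule dual_mnorm_nonneg[OF Y \<Phi>])
    have hh: "hs_norm M n \<eta> * hs_norm M n \<xi> \<le> 1 * 1"
      by (rule mult_mono) (use h in auto)
    have "dual_mnorm Y (n * m) \<Phi> * (m * (hs_norm M n \<eta> * hs_norm M n \<xi>)) \<le> dual_mnorm Y (n * m) \<Phi> * (real m * (1 * 1))"
      by (rule mult_left_mono[OF mult_left_mono[OF hh] D0]) simp
    with 1 have "m * (m * Re (\<Sum>i<n. \<Sum>j<n. \<phi> i j (a i j))) \<le> m * dual_mnorm Y (n * m) \<Phi>" by (simp add: mult_ac)
    then show "Re (\<Sum>i<n. \<Sum>j<n. \<phi> i j (a i j)) \<le> dual_mnorm Y (n * m) \<Phi> / m"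
      using m by (simp add: field_simps)
  qed
  then show ?thesis using m by (simp add: field_simps \<Phi>_def[abs_def])
qed

lemma dual_mnorm_perturb:
  assumes Y: "operator_space Y" and \<phi>: "\<And>i j. i < n \<Longrightarrow> j < n \<Longrightarrow> \<phi> i j \<in> dual_space Y"
    and \<psi>: "\<And>i j. i < n \<Longrightarrow> j < n \<Longrightarrow> \<psi> i j \<in> dual_space Y"
    and b: "\<And>i j y. i < n \<Longrightarrow> j < n \<Longrightarrow> y \<in> Y \<Longrightarrow> cmod (\<phi> i j y - \<psi> i j y) \<le> e i j * norm y"
    and e: "\<And>i j. i < n \<Longrightarrow> j < n \<Longrightarrow> e i j \<ge> 0"
  shows "dual_mnorm Y n \<phi> \<le> dual_mnorm Y n \<psi> + (\<Sum>i<n. \<Sum>j<n. e i j)"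
proof (rule dual_mnorm_le[OF _ \<phi>])
  show "csubspace Y" using Y by (simp add: operator_space_def)
  fix a assume a: "a \<in> predual_ball Y n"
  have "Re (\<Sum>i<n. \<Sum>j<n. (\<lambda>i j y. \<phi> i j y - \<psi> i j y) i j (a i j)) \<le> (\<Sum>i<n. \<Sum>j<n. e i j)"
    by (rule Re_pairing_le_sum[OF Y a]) (use b e in auto)
  moreover have "Re (\<Sum>i<n. \<Sum>j<n. \<psi> i j (a i j)) \<le> dual_mnorm Y n \<psi>"
    by (rule Re_pairing_le_dual_mnorm[OF Y \<psi> a])
  ultimately show "Re (\<Sum>i<n. \<Sum>j<n. \<phi> i j (a i j)) \<le> dual_mnorm Y n \<psi> + (\<Sum>i<n. \<Sum>j<n. e i j)"
    by (simp add: sum_subtractf)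
qed

lemma dual_mnorm_triangle:
  assumes Y: "operator_space Y" and \<phi>: "\<And>i j. i < n \<Longrightarrow> j < n \<Longrightarrow> \<phi> i j \<in> dual_space Y"
    and \<psi>: "\<And>i j. i < n \<Longrightarrow> j < n \<Longrightarrow> \<psi> i j \<in> dual_space Y"
  shows "dual_mnorm Y n (\<lambda>i j. \<phi> i j + \<psi> i j) \<le> dual_mnorm Y n \<phi> + dual_mnorm Y n \<psi>"
proof (rule dual_mnorm_le)
  show sub: "csubspace Y" using Y by (simp add: operator_space_def)
  show "\<phi> i j + \<psi> i j \<in> dual_space Y" if "i < n" "j < n" for i j
    by (intro dual_space_add sub \<phi> \<psi> that)
  fix a assume a: "a \<in> predual_ball Y n"
  show "Re (\<Sum>i<n. \<Sum>j<n. (\<phi> i j + \<psi> i j) (a i j)) \<le> dual_mnorm Y n \<phi> + dual_mnorm Y n \<psi>"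
    using Re_pairing_le_dual_mnorm[where \<phi> = \<phi>, OF Y \<phi> a] Re_pairing_le_dual_mnorm[where \<phi> = \<psi>, OF Y \<psi> a]
    by (simp add: sum.distrib)
qed

lemma cmod_apply_le_dual_mnorm:
  assumes Y: "operator_space Y" and \<phi>: "\<phi> \<in> dual_space Y" and y: "y \<in> Y"
  shows "cmod (\<phi> y) \<le> dual_mnorm Y 1 (\<lambda>_ _. \<phi>) * norm y"
proof (cases "y = 0")
  case True
  have "csubspace Y" using Y by (simp add: operator_space_def)
  then have "\<phi> 0 = 0" using dual_space_sum[OF _ \<phi>, of "{}" "\<lambda>_. 0"] by simp
  with True show ?thesis by simp
next
  case False
  define A where "A = (1 / norm y) *\<^sub>R y"
  have AY: "A \<in> Y" using y Y unfolding A_def by (simp add: operator_space_def csubspace_def scaleR_scaleC)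
  have "op_mnorm 1 (\<lambda>_ _. A) \<le> 1" using op_mnorm_1_le[of A] False by (simp add: A_def)
  then have "Re (\<Sum>k<1::nat. \<Sum>i<1::nat. cnj ((\<lambda>_ _. 1) k i) * (\<Sum>l<1::nat. \<Sum>j<1::nat. (\<lambda>_ _. \<phi>) i j ((\<lambda>_ _. A) k l) * (\<lambda>_ _. cnj (sgn (\<phi> A))) l j))
    \<le> dual_mnorm Y 1 (\<lambda>_ _. \<phi>) * (hs_norm 1 1 (\<lambda>_ _. 1) * hs_norm 1 1 (\<lambda>_ _. cnj (sgn (\<phi> A))))"
    by (intro Re_form_le_scaled Y) (use \<phi> AY in auto)
  moreover have "hs_norm 1 1 (\<lambda>_ _. 1) = 1" by (simp add: hs_norm_def)
  moreover have "hs_norm 1 1 (\<lambda>_ _. cnj (sgn (\<phi> A))) = norm (sgn (\<phi> A))" by (simp add: hs_norm_def)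
  moreover have "\<phi> A * cnj (sgn (\<phi> A)) = cmod (\<phi> A)"
  proof -
    have "\<phi> A * cnj (sgn (\<phi> A)) = (\<phi> A * cnj (\<phi> A)) / cmod (\<phi> A)" by (simp add: sgn_eq)
    also have "\<phi> A * cnj (\<phi> A) = complex_of_real ((cmod (\<phi> A))\<^sup>2)" by (simp only: complex_norm_square)
    also have "\<dots> / cmod (\<phi> A) = cmod (\<phi> A)" by (cases "\<phi> A = 0") (simp_all add: power2_eq_square)
    finally show ?thesis .
  qed
  ultimately have "cmod (\<phi> A) \<le> dual_mnorm Y 1 (\<lambda>_ _. \<phi>) * norm (sgn (\<phi> A))" by simp
  moreover have "norm (sgn (\<phi> A)) = (if \<phi> A = 0 then 0 else 1)" by (simp add: norm_sgn)
  moreover have "\<phi> A = (1 / norm y) * \<phi> y"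
    unfolding A_def scaleR_scaleC by (rule dual_space_scaleC[OF \<phi> y])
  moreover have "0 \<le> dual_mnorm Y 1 (\<lambda>_ _. \<phi>)" by (rule dual_mnorm_nonneg[OF Y \<phi>])
  ultimately show ?thesis using False
    by (auto simp: norm_mult norm_divide field_simps split: if_splits)
qed

section \<open>Averages of two translates\<close>

text \<open>The two halves of a bi-Lipschitz estimate for the \<open>n\<close>-th amplification of \<open>f\<close>.\<close>

definition amp_upper where
  "amp_upper X Y n L f \<longleftrightarrow> (\<forall>u v. (\<forall>i<n. \<forall>j<n. u i j \<in> X \<and> v i j \<in> X) \<longrightarrow>
     dual_mnorm Y n (\<lambda>i j. f (u i j) - f (v i j)) \<le> L * op_mnorm n (\<lambda>i j. u i j - v i j))"

definition amp_lower where
  "amp_lower X Y n c f \<longleftrightarrow> (\<forall>u v. (\<forall>i<n. \<forall>j<n. u i j \<in> X \<and> v i j \<in> X) \<longrightarrow>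
     c * op_mnorm n (\<lambda>i j. u i j - v i j) \<le> dual_mnorm Y n (\<lambda>i j. f (u i j) - f (v i j)))"

text \<open>Block-constant matrices multiply the norms on both sides by \<open>m\<close>.\<close>

lemma amp_upper_divisor:
  assumes Y: "operator_space Y" and f: "f \<in> X \<rightarrow> dual_space Y" and m: "m \<ge> 1"
    and up: "amp_upper X Y (n * m) L f"
  shows "amp_upper X Y n L f"
  unfolding amp_upper_def
proof (intro allI impI)
  fix u v assume uv: "\<forall>i<n. \<forall>j<n. u i j \<in> X \<and> v i j \<in> X"
  have sub: "csubspace Y" using Y by (simp add: operator_space_def)
  have mod: "p mod n < n" if "p < n * m" for p
    using that by (metis gr0I mod_less_divisor mult_0 not_less_zero)
  have "real m * dual_mnorm Y n (\<lambda>i j. f (u i j) - f (v i j))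
      \<le> dual_mnorm Y (n * m) (\<lambda>p q. f (u (p mod n) (q mod n)) - f (v (p mod n) (q mod n)))"
    by (rule dual_mnorm_le_block_constant[OF Y _ m]) (use f uv in \<open>auto intro!: dual_space_diff sub\<close>)
  also have "\<dots> \<le> L * op_mnorm (n * m) (\<lambda>p q. u (p mod n) (q mod n) - v (p mod n) (q mod n))"
    using up[unfolded amp_upper_def, rule_format, of "\<lambda>p q. u (p mod n) (q mod n)" "\<lambda>p q. v (p mod n) (q mod n)"] uv mod by simp
  also have "\<dots> = L * (m * op_mnorm n (\<lambda>i j. u i j - v i j))"
    by (subst op_mnorm_block_constant[OF m, of n "\<lambda>i j. u i j - v i j"]) simp
  finally show "dual_mnorm Y n (\<lambda>i j. f (u i j) - f (v i j)) \<le> L * op_mnorm n (\<lambda>i j. u i j - v i j)"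
    using m by (simp add: mult.left_commute)
qed

text \<open>Sylvester's doubling construction.\<close>

lemma hadamard_matrix:
  "\<exists>H :: nat \<Rightarrow> nat \<Rightarrow> real. (\<forall>a b. H a b = 1 \<or> H a b = -1) \<and>
    (\<forall>\<zeta> :: nat \<Rightarrow> complex. (\<Sum>a<2^k. (cmod (\<Sum>b<2^k. complex_of_real (H a b) * \<zeta> b))\<^sup>2) = 2^k * (\<Sum>b<2^k. (cmod (\<zeta> b))\<^sup>2))"
proof (induction k)
  case 0
  show ?case by (intro exI[of _ "\<lambda>_ _. 1"]) simp
next
  case (Suc k)
  then obtain H :: "nat \<Rightarrow> nat \<Rightarrow> real" where H: "\<And>a b. H a b = 1 \<or> H a b = -1"
    and HH: "\<And>\<zeta> :: nat \<Rightarrow> complex. (\<Sum>a<2^k. (cmod (\<Sum>b<2^k. complex_of_real (H a b) * \<zeta> b))\<^sup>2) = 2^k * (\<Sum>b<2^k. (cmod (\<zeta> b))\<^sup>2)"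
    by blast
  define G where "G a b = (if a < 2^k then if b < 2^k then H a b else H a (b - 2^k)
      else if b < 2^k then H (a - 2^k) b else - H (a - 2^k) (b - 2^k))" for a b
  have split: "(\<Sum>a<2 ^ Suc k. g a) = (\<Sum>a<2^k. g a) + (\<Sum>a<2^k. g (a + 2^k))" for g :: "nat \<Rightarrow> 'c::comm_monoid_add"
  proof -
    have "(\<Sum>a<2 ^ Suc k. g a) = (\<Sum>a<2^k. g a) + (\<Sum>a\<in>{2^k..<2 ^ Suc k}. g a)"
      by (subst sum.union_disjoint[symmetric]) (auto intro!: sum.cong)
    also have "(\<Sum>a\<in>{2^k..<2 ^ Suc k}. g a) = (\<Sum>a<2^k. g (a + 2^k))"
      using sum.shift_bounds_nat_ivl[of g 0 "2^k" "2^k"] by (simp add: atLeast0LessThan mult_2)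
    finally show ?thesis .
  qed
  have "(\<Sum>a<2 ^ Suc k. (cmod (\<Sum>b<2 ^ Suc k. complex_of_real (G a b) * \<zeta> b))\<^sup>2) = 2 ^ Suc k * (\<Sum>b<2 ^ Suc k. (cmod (\<zeta> b))\<^sup>2)"
    for \<zeta> :: "nat \<Rightarrow> complex"
  proof -
    define s t where "s a = (\<Sum>b<2^k. complex_of_real (H a b) * \<zeta> b)"
      and "t a = (\<Sum>b<2^k. complex_of_real (H a b) * \<zeta> (b + 2^k))" for a
    have "(\<Sum>a<2 ^ Suc k. (cmod (\<Sum>b<2 ^ Suc k. complex_of_real (G a b) * \<zeta> b))\<^sup>2)
      = (\<Sum>a<2^k. (cmod (s a + t a))\<^sup>2) + (\<Sum>a<2^k. (cmod (s a - t a))\<^sup>2)"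
      unfolding split by (simp add: G_def s_def t_def sum_negf)
    also have "\<dots> = (\<Sum>a<2^k. 2 * (cmod (s a))\<^sup>2 + 2 * (cmod (t a))\<^sup>2)"
      unfolding sum.distrib[symmetric]
      by (intro sum.cong refl) (simp add: cmod_power2 power2_sum power2_diff)
    also have "\<dots> = 2 * (\<Sum>a<2^k. (cmod (s a))\<^sup>2) + 2 * (\<Sum>a<2^k. (cmod (t a))\<^sup>2)"
      by (simp add: sum.distrib sum_distrib_left)
    also have "\<dots> = 2 ^ Suc k * (\<Sum>b<2 ^ Suc k. (cmod (\<zeta> b))\<^sup>2)"
      unfolding split s_def t_def HH by (simp add: algebra_simps)
    finally show ?thesis .
  qed
  moreover have "- H a b = 1 \<or> - H a b = -1" for a b using H[of a b] by auto
  then have "\<forall>a b. G a b = 1 \<or> G a b = -1"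
    using H by (simp add: G_def)
  ultimately show ?case by blast
qed

text \<open>This is the step for which bounds at high levels are needed. Put $m = 4^k$, let $J$ be the
  all-ones matrix and $H$ a Hadamard matrix of size $m$. Translate the block-constant matrices of \<open>u\<close>
  and \<open>v\<close> by \<open>e\<close> in the positions where $H$ is $-1$. Their distance is still $m$ times that of \<open>u\<close>
  and \<open>v\<close>, and with the increments $b_0 = f(u) - f(v)$ and $b_1 = f(u + e) - f(v + e)$ the difference
  of the images is $\frac12 (b_0 + b_1) \otimes J + \frac12 (b_0 - b_1) \otimes H$. Since $H$ has
  norm $\sqrt m = 2^k$ only, the mean of $b_0$ and $b_1$ must carry almost all of the norm: increments
  of \<open>f\<close> at different base points cannot cancel.\<close>

lemma amp_lower_two_point_average:
  assumes X: "csubspace X" and Y: "operator_space Y" and f: "f \<in> X \<rightarrow> dual_space Y"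
    and up: "amp_upper X Y n L f" and low: "amp_lower X Y (n * 4 ^ k) c f" and e: "e \<in> X"
  shows "amp_lower X Y n (c - L / 2 ^ k) (\<lambda>x. (1/2) *\<^sub>R (f x + f (x + e)))"
  unfolding amp_lower_def
proof (intro allI impI)
  fix u v assume uv: "\<forall>i<n. \<forall>j<n. u i j \<in> X \<and> v i j \<in> X"
  let ?uv = "op_mnorm n (\<lambda>i j. u i j - v i j)"
  have sub: "csubspace Y" using Y by (simp add: operator_space_def)
  define m :: nat where "m = 4 ^ k"
  have m: "m \<ge> 1" by (simp add: m_def)
  have m2: "m = 2 ^ (2 * k)" "real m = (2 ^ k)\<^sup>2" by (simp_all add: m_def power_mult power2_eq_square power_mult_distrib[symmetric])
  have mod: "p mod n < n" if "p < n * m" for p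
    using that by (metis gr0I mod_less_divisor mult_0 not_less_zero)
  obtain H :: "nat \<Rightarrow> nat \<Rightarrow> real" where H: "\<And>a b. H a b = 1 \<or> H a b = -1"
    and HH0: "\<And>\<zeta> :: nat \<Rightarrow> complex. (\<Sum>a<2 ^ (2 * k). (cmod (\<Sum>b<2 ^ (2 * k). complex_of_real (H a b) * \<zeta> b))\<^sup>2)
      = 2 ^ (2 * k) * (\<Sum>b<2 ^ (2 * k). (cmod (\<zeta> b))\<^sup>2)"
    using hadamard_matrix[of "2 * k"] by blast
  have HH: "(\<Sum>a<m. (cmod (\<Sum>b<m. complex_of_real (H a b) * \<zeta> b))\<^sup>2) = m * (\<Sum>b<m. (cmod (\<zeta> b))\<^sup>2)"
    for \<zeta> :: "nat \<Rightarrow> complex" using HH0[of \<zeta>] by (simp add: m2(1))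
  have Xadd: "x + e \<in> X" if "x \<in> X" for x using X e that by (simp add: csubspace_def)
  define s where "s p q = (if H (p div n) (q div n) = 1 then 0 else e)" for p q
  define b0 b1 where "b0 i j = f (u i j) - f (v i j)" and "b1 i j = f (u i j + e) - f (v i j + e)" for i j
  define S where "S i j = (1/2) *\<^sub>R (b0 i j + b1 i j)" for i j
  define R where "R i j = (1/2) *\<^sub>R (b0 i j + (-1) *\<^sub>R b1 i j)" for i j
  have b: "b0 i j \<in> dual_space Y" "b1 i j \<in> dual_space Y" if "i < n" "j < n" for i j
    unfolding b0_def b1_def using that uv f Xadd by (auto intro!: dual_space_diff sub)
  have SR: "S i j \<in> dual_space Y" "R i j \<in> dual_space Y" if "i < n" "j < n" for i j
    unfolding S_def R_def by (intro dual_space_scaleR dual_space_add sub b that)+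
  have bn: "dual_mnorm Y n b0 \<le> L * ?uv" "dual_mnorm Y n b1 \<le> L * ?uv"
    using up[unfolded amp_upper_def, rule_format, of u v]
      up[unfolded amp_upper_def, rule_format, of "\<lambda>i j. u i j + e" "\<lambda>i j. v i j + e"] uv Xadd
    by (simp_all add: b0_def[abs_def] b1_def[abs_def])
  have "c * (m * ?uv) = c * op_mnorm (n * m) (\<lambda>p q. (u (p mod n) (q mod n) + s p q) - (v (p mod n) (q mod n) + s p q))"
    by (simp add: op_mnorm_block_constant[OF m, of n "\<lambda>i j. u i j - v i j"])
  also have "\<dots> \<le> dual_mnorm Y (n * m) (\<lambda>p q. f (u (p mod n) (q mod n) + s p q) - f (v (p mod n) (q mod n) + s p q))"
  proof (rule low[folded m_def, unfolded amp_lower_def, rule_format])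
    fix p q assume "p < n * m" "q < n * m"
    then show "u (p mod n) (q mod n) + s p q \<in> X \<and> v (p mod n) (q mod n) + s p q \<in> X"
      using uv Xadd mod by (simp add: s_def)
  qed
  also have "\<dots> = dual_mnorm Y (n * m) (\<lambda>p q. S (p mod n) (q mod n) + H (p div n) (q div n) *\<^sub>R R (p mod n) (q mod n))"
  proof (rule dual_mnorm_cong)
    fix p q
    show "f (u (p mod n) (q mod n) + s p q) - f (v (p mod n) (q mod n) + s p q)
      = S (p mod n) (q mod n) + H (p div n) (q div n) *\<^sub>R R (p mod n) (q mod n)"
      using H[of "p div n" "q div n"]
      by (auto simp: fun_eq_iff s_def S_def R_def b0_def b1_def scaleR_fun_def scaleR_conv_of_real field_simps)
  qed
  also have "\<dots> \<le> dual_mnorm Y (n * m) (\<lambda>p q. S (p mod n) (q mod n)) + dual_mnorm Y (n * m) (\<lambda>p q. H (p div n) (q div n) *\<^sub>R R (p mod n) (q mod n))"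
    by (intro dual_mnorm_triangle Y dual_space_scaleR SR mod)
  also have "\<dots> \<le> m * dual_mnorm Y n S + 2 ^ k * dual_mnorm Y n R"
    by (intro add_mono dual_mnorm_block_constant_le dual_mnorm_block_le Y SR) (auto simp: HH m2(2))
  also have "dual_mnorm Y n R \<le> \<bar>1/2\<bar> * (dual_mnorm Y n b0 + \<bar>-1\<bar> * dual_mnorm Y n b1)"
    unfolding R_def
    by (intro order_trans[OF dual_mnorm_scaleR_le] order_trans[OF dual_mnorm_triangle] mult_left_mono add_left_mono dual_mnorm_scaleR_le Y b dual_space_add dual_space_scaleR sub) auto
  also have "\<dots> \<le> L * ?uv" using bn by simp
  finally have "c * (m * ?uv) \<le> m * dual_mnorm Y n S + 2 ^ k * (L * ?uv)"
    by simp
  moreover have "m * ((c - L / 2 ^ k) * ?uv)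
      = c * (m * ?uv) - 2 ^ k * (L * ?uv)"
    by (simp add: m2(2) field_simps power2_eq_square)
  ultimately have "m * ((c - L / 2 ^ k) * ?uv) \<le> m * dual_mnorm Y n S"
    by linarith
  then have "(c - L / 2 ^ k) * ?uv \<le> dual_mnorm Y n S"
    by (rule mult_left_le_imp_le) (use m in simp)
  also have "dual_mnorm Y n S = dual_mnorm Y n (\<lambda>i j. (1/2) *\<^sub>R (f (u i j) + f (u i j + e)) - (1/2) *\<^sub>R (f (v i j) + f (v i j + e)))"
    by (rule dual_mnorm_cong, rule ext) (simp add: S_def b0_def b1_def scaleR_fun_def scaleR_conv_of_real field_simps)
  finally show "(c - L / 2 ^ k) * ?uv
    \<le> dual_mnorm Y n (\<lambda>i j. (1/2) *\<^sub>R (f (u i j) + f (u i j + e)) - (1/2) *\<^sub>R (f (v i j) + f (v i j + e)))" .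
qed

lemma amp_upper_two_point_average:
  assumes X: "csubspace X" and Y: "operator_space Y" and f: "f \<in> X \<rightarrow> dual_space Y"
    and up: "amp_upper X Y n L f" and e: "e \<in> X"
  shows "amp_upper X Y n L (\<lambda>x. (1/2) *\<^sub>R (f x + f (x + e)))"
  unfolding amp_upper_def
proof (intro allI impI)
  fix u v assume uv: "\<forall>i<n. \<forall>j<n. u i j \<in> X \<and> v i j \<in> X"
  let ?uv = "op_mnorm n (\<lambda>i j. u i j - v i j)"
  have sub: "csubspace Y" using Y by (simp add: operator_space_def)
  have Xadd: "x + e \<in> X" if "x \<in> X" for x using X e that by (simp add: csubspace_def)
  define b0 b1 where "b0 i j = f (u i j) - f (v i j)" and "b1 i j = f (u i j + e) - f (v i j + e)" for i j
  have b: "b0 i j \<in> dual_space Y" "b1 i j \<in> dual_space Y" if "i < n" "j < n" for i j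
    unfolding b0_def b1_def using that uv f Xadd by (auto intro!: dual_space_diff sub)
  have bn: "dual_mnorm Y n b0 \<le> L * ?uv" "dual_mnorm Y n b1 \<le> L * ?uv"
    using up[unfolded amp_upper_def, rule_format, of u v]
      up[unfolded amp_upper_def, rule_format, of "\<lambda>i j. u i j + e" "\<lambda>i j. v i j + e"] uv Xadd
    by (simp_all add: b0_def[abs_def] b1_def[abs_def])
  have "dual_mnorm Y n (\<lambda>i j. (1/2) *\<^sub>R (f (u i j) + f (u i j + e)) - (1/2) *\<^sub>R (f (v i j) + f (v i j + e)))
      = dual_mnorm Y n (\<lambda>i j. (1/2) *\<^sub>R (b0 i j + b1 i j))"
    by (rule dual_mnorm_cong, rule ext) (simp add: b0_def b1_def scaleR_fun_def scaleR_conv_of_real field_simps)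
  also have "\<dots> \<le> \<bar>1/2\<bar> * (dual_mnorm Y n b0 + dual_mnorm Y n b1)"
    by (intro order_trans[OF dual_mnorm_scaleR_le] order_trans[OF dual_mnorm_triangle] mult_left_mono order_refl Y b dual_space_add sub) auto
  also have "\<dots> \<le> L * ?uv" using bn by simp
  finally show "dual_mnorm Y n (\<lambda>i j. (1/2) *\<^sub>R (f (u i j) + f (u i j + e)) - (1/2) *\<^sub>R (f (v i j) + f (v i j + e)))
      \<le> L * ?uv" .
qed

section \<open>Averages over boxes\<close>

definition avg :: "'x::real_vector \<Rightarrow> nat \<Rightarrow> ('x \<Rightarrow> 'w::real_vector) \<Rightarrow> 'x \<Rightarrow> 'w"
  where "avg e a h x = (1 / real a) *\<^sub>R (\<Sum>b<a. h (x + real b *\<^sub>R e))"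

text \<open>For a list of pairs $(e_i, a_i)$ this is the average of \<open>h\<close> over all points
  $x + \sum_i b_i e_i$ with $0 \le b_i < a_i$.\<close>

fun box_avg :: "('x::real_vector \<times> nat) list \<Rightarrow> ('x \<Rightarrow> 'w::real_vector) \<Rightarrow> 'x \<Rightarrow> 'w" where
  "box_avg [] h = h"
| "box_avg ((e, a) # B) h = avg e a (box_avg B h)"

definition refine :: "nat \<Rightarrow> ('x::real_vector \<times> nat) list \<Rightarrow> ('x \<times> nat) list"
  where "refine M B = map (\<lambda>(e, a). ((1 / real M) *\<^sub>R e, a * M)) B"

definition box_in :: "'x set \<Rightarrow> ('x \<times> nat) list \<Rightarrow> bool"
  where "box_in X B \<longleftrightarrow> (\<forall>(e, a)\<in>set B. e \<in> X \<and> a \<ge> 1)"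

text \<open>Every point of a box is within \<open>box_size\<close> of its corner, and the diameter of a single cell is at
  most \<open>box_mesh\<close>.\<close>

definition box_size :: "('x::real_normed_vector \<times> nat) list \<Rightarrow> real"
  where "box_size B = (\<Sum>(e, a)\<leftarrow>B. real a * norm e)"

definition box_mesh :: "('x::real_normed_vector \<times> nat) list \<Rightarrow> real"
  where "box_mesh B = (\<Sum>(e, a)\<leftarrow>B. norm e)"

lemma box_in_simps [simp]:
  "box_in X []" "box_in X ((e, a) # B) \<longleftrightarrow> e \<in> X \<and> a \<ge> 1 \<and> box_in X B"
  "box_in X (B @ C) \<longleftrightarrow> box_in X B \<and> box_in X C"
  by (auto simp: box_in_def)

lemma box_size_simps [simp]:
  "box_size [] = 0" "box_size ((e, a) # B) = real a * norm e + box_size B"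
  "box_size (B @ C) = box_size B + box_size C"
  by (simp_all add: box_size_def)

lemma box_mesh_simps [simp]:
  "box_mesh [] = 0" "box_mesh ((e, a) # B) = norm e + box_mesh B"
  "box_mesh (B @ C) = box_mesh B + box_mesh C"
  by (simp_all add: box_mesh_def)

lemma avg_diff: "avg e a (\<lambda>x. h x - k x) x = avg e a h x - avg e a k x"
  by (simp add: avg_def sum_subtractf scaleR_diff_right)

lemma avg_scaleR: "avg e a (\<lambda>x. r *\<^sub>R h x) x = r *\<^sub>R avg e a h x"
  by (simp add: avg_def scaleR_sum_right)

lemma avg_linear: "linear T \<Longrightarrow> avg e a (\<lambda>x. T (h x)) x = T (avg e a h x)"
  by (simp add: avg_def linear_sum linear_scale)

lemma box_avg_linear:
  assumes "linear T"
  shows "box_avg B (\<lambda>x. T (h x)) x = T (box_avg B h x)"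
proof (induction B arbitrary: x)
  case (Cons p B)
  then have "box_avg B (\<lambda>x. T (h x)) = (\<lambda>x. T (box_avg B h x))" by auto
  then show ?case by (cases p) (simp add: avg_linear[OF assms])
qed simp

lemma box_avg_diff: "box_avg B (\<lambda>x. h x - k x) x = box_avg B h x - box_avg B k x"
proof (induction B arbitrary: x)
  case (Cons p B)
  then have "box_avg B (\<lambda>x. h x - k x) = (\<lambda>x. box_avg B h x - box_avg B k x)" by auto
  then show ?case by (cases p) (simp add: avg_diff)
qed simp

lemma box_avg_scaleR: "box_avg B (\<lambda>x. r *\<^sub>R h x) x = r *\<^sub>R box_avg B h x"
proof (induction B arbitrary: x)
  case (Cons p B)
  then have "box_avg B (\<lambda>x. r *\<^sub>R h x) = (\<lambda>x. r *\<^sub>R box_avg B h x)" by auto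
  then show ?case by (cases p) (simp add: avg_scaleR)
qed simp

lemma box_avg_append: "box_avg (B @ C) h = box_avg B (box_avg C h)"
proof (induction B)
  case (Cons p B)
  then show ?case by (cases p) simp
qed simp

lemma avg_commute: "avg e a (avg e' a' h) = avg e' a' (avg e a h)"
proof
  fix x
  have "(\<Sum>b<a. \<Sum>b'<a'. h (x + real b *\<^sub>R e + real b' *\<^sub>R e')) = (\<Sum>b'<a'. \<Sum>b<a. h (x + real b' *\<^sub>R e' + real b *\<^sub>R e))"
    by (subst sum.swap) (simp add: ac_simps)
  then show "avg e a (avg e' a' h) x = avg e' a' (avg e a h) x"
    by (simp add: avg_def scaleR_sum_right[symmetric])
qed

lemma box_avg_avg: "box_avg B (avg e a h) = avg e a (box_avg B h)"
proof (induction B)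
  case (Cons p B)
  then show ?case by (cases p) (simp add: avg_commute[of e a])
qed simp

lemma avg_shift: "avg e a (\<lambda>x. h (x + v)) x = avg e a h (x + v)"
  by (simp add: avg_def ac_simps)

lemma box_avg_shift: "box_avg B (\<lambda>x. h (x + v)) x = box_avg B h (x + v)"
proof (induction B arbitrary: x)
  case (Cons p B)
  then have "box_avg B (\<lambda>x. h (x + v)) = (\<lambda>x. box_avg B h (x + v))" by auto
  then show ?case by (cases p) (simp add: avg_shift)
qed simp

lemma box_avg_extract: "box_avg (B1 @ (e, a) # B2) h = box_avg (B1 @ B2) (avg e a h)"
  by (simp add: box_avg_append box_avg_avg)

lemma avg_subdivide:
  assumes "M \<ge> 1"
  shows "avg e (a * M) h = avg (real M *\<^sub>R e) a (avg e M h)"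
proof
  fix x
  have "(\<Sum>b<M * a. h (x + real b *\<^sub>R e)) = (\<Sum>c<a. \<Sum>b<M. h (x + real (c * M + b) *\<^sub>R e))"
    by (rule sum_block)
  also have "\<dots> = (\<Sum>c<a. \<Sum>b<M. h (x + real c *\<^sub>R real M *\<^sub>R e + real b *\<^sub>R e))"
    by (simp add: scaleR_add_left add.assoc)
  finally show "avg e (a * M) h x = avg (real M *\<^sub>R e) a (avg e M h) x"
    by (simp add: avg_def scaleR_sum_right[symmetric] mult.commute)
qed

lemma avg_telescope:
  assumes "a \<ge> 1"
  shows "avg e a (\<lambda>x. h (x + e) - h x) x = (1 / real a) *\<^sub>R (h (x + real a *\<^sub>R e) - h x)"
proof -
  have "(\<Sum>b<a. h (x + real (Suc b) *\<^sub>R e) - h (x + real b *\<^sub>R e)) = h (x + real a *\<^sub>R e) - h (x + real 0 *\<^sub>R e)"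
    by (rule sum_lessThan_telescope)
  moreover have "(\<Sum>b<a. h (x + real (Suc b) *\<^sub>R e) - h (x + real b *\<^sub>R e)) = (\<Sum>b<a. h (x + real b *\<^sub>R e + e) - h (x + real b *\<^sub>R e))"
    by (intro sum.cong refl) (simp add: scaleR_add_left add_ac)
  ultimately show ?thesis by (simp add: avg_def)
qed

lemma avg_const: "a \<ge> 1 \<Longrightarrow> avg e a (\<lambda>_. c) x = c"
  by (simp add: avg_def sum_constant_scaleR)

lemma avg_norm_le:
  fixes h :: "'x::real_vector \<Rightarrow> 'w::real_normed_vector"
  assumes "a \<ge> 1" "\<And>b. b < a \<Longrightarrow> norm (h (x + real b *\<^sub>R e)) \<le> C"
  shows "norm (avg e a h x) \<le> C"
proof -
  have "norm (\<Sum>b<a. h (x + real b *\<^sub>R e)) \<le> (\<Sum>b<a. C)"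
    by (rule order_trans[OF norm_sum], rule sum_mono) (use assms(2) in auto)
  then show ?thesis using assms(1) by (simp add: avg_def field_simps)
qed

lemma box_avg_norm_le:
  fixes h :: "'x::real_vector \<Rightarrow> 'w::real_normed_vector"
  assumes X: "subspace X" and B: "box_in X B" and h: "\<And>x. x \<in> X \<Longrightarrow> norm (h x) \<le> C" and x: "x \<in> X"
  shows "norm (box_avg B h x) \<le> C"
  using B x
proof (induction B arbitrary: x)
  case Nil
  then show ?case by (simp add: h)
next
  case (Cons p B)
  obtain e a where p: "p = (e, a)" by (cases p)
  show ?case unfolding p box_avg.simps
    by (rule avg_norm_le) (use Cons p in \<open>auto intro!: Cons.IH subspace_add[OF X] subspace_scale[OF X]\<close>)
qed

lemma box_avg_le:
  fixes h :: "'x::real_vector \<Rightarrow> real"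
  assumes X: "subspace X" and B: "box_in X B" and h: "\<And>x. x \<in> X \<Longrightarrow> h x \<le> C" and x: "x \<in> X"
  shows "box_avg B h x \<le> C"
  using B x
proof (induction B arbitrary: x)
  case Nil
  then show ?case by (simp add: h)
next
  case (Cons p B)
  obtain e a where p: "p = (e, a)" by (cases p)
  have "(\<Sum>b<a. box_avg B h (x + real b *\<^sub>R e)) \<le> (\<Sum>b<a. C)"
    by (rule sum_mono, rule Cons.IH) (use Cons p in \<open>auto intro!: subspace_add[OF X] subspace_scale[OF X]\<close>)
  then show ?case using Cons.prems by (simp add: p avg_def field_simps)
qed

lemma box_avg_cong:
  assumes X: "subspace X" and B: "box_in X B" and h: "\<And>x. x \<in> X \<Longrightarrow> h x = k x" and x: "x \<in> X"
  shows "box_avg B h x = box_avg B k x"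
  using B x
proof (induction B arbitrary: x)
  case Nil
  then show ?case by (simp add: h)
next
  case (Cons p B)
  obtain e a where p: "p = (e, a)" by (cases p)
  have "(\<Sum>b<a. box_avg B h (x + real b *\<^sub>R e)) = (\<Sum>b<a. box_avg B k (x + real b *\<^sub>R e))"
    by (rule sum.cong[OF refl], rule Cons.IH) (use Cons p in \<open>auto intro!: subspace_add[OF X] subspace_scale[OF X]\<close>)
  then show ?case by (simp add: p avg_def)
qed

lemma box_avg_const: "box_in X B \<Longrightarrow> box_avg B (\<lambda>_. c) x = c"
proof (induction B arbitrary: x)
  case (Cons p B)
  obtain e a where p: "p = (e, a)" by (cases p)
  have "box_avg B (\<lambda>_. c) = (\<lambda>_. c)" using Cons p by auto
  then show ?case using Cons p by (simp add: avg_const)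
qed simp

lemma box_avg_displacement:
  fixes h :: "'x::real_normed_vector \<Rightarrow> 'w::real_normed_vector"
  assumes X: "subspace X" and B: "box_in X B" and K: "K \<ge> 0"
    and h: "\<And>x y. x \<in> X \<Longrightarrow> y \<in> X \<Longrightarrow> norm (h x - h y) \<le> K * norm (x - y)" and x: "x \<in> X"
  shows "norm (box_avg B h x - h x) \<le> K * box_size B"
  using B x
proof (induction B arbitrary: x)
  case Nil
  then show ?case by simp
next
  case (Cons p B)
  obtain e a where p: "p = (e, a)" by (cases p)
  have a: "a \<ge> 1" "e \<in> X" "box_in X B" using Cons.prems by (auto simp: p)
  have "box_avg (p # B) h x - h x = avg e a (\<lambda>z. box_avg B h z - h x) x"
    using avg_diff[of e a "box_avg B h" "\<lambda>_. h x" x] avg_const[OF a(1), of e "h x" x] by (simp add: p)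
  also have "norm \<dots> \<le> K * box_size (p # B)"
  proof (rule avg_norm_le[OF a(1)])
    fix b assume b: "b < a"
    let ?y = "x + real b *\<^sub>R e"
    have y: "?y \<in> X" using Cons.prems a by (auto intro!: subspace_add[OF X] subspace_scale[OF X])
    have "norm (box_avg B h ?y - h x) \<le> norm (box_avg B h ?y - h ?y) + norm (h ?y - h x)"
      using norm_triangle_ineq[of "box_avg B h ?y - h ?y" "h ?y - h x"] by simp
    also have "\<dots> \<le> K * box_size B + K * norm (real b *\<^sub>R e)"
      using Cons.IH[OF a(3) y] h[OF y Cons.prems(2)] by simp
    also have "\<dots> \<le> K * box_size B + K * (real a * norm e)"
      using b K by (intro add_left_mono mult_left_mono) (auto intro: mult_right_mono)
    finally show "norm (box_avg B h ?y - h x) \<le> K * box_size (p # B)" by (simp add: p algebra_simps)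
  qed
  finally show ?case .
qed

lemma box_avg_refine:
  assumes "M \<ge> 1"
  shows "box_avg (refine M B) h = box_avg B (box_avg (map (\<lambda>(e, a). ((1 / real M) *\<^sub>R e, M)) B) h)"
proof (induction B)
  case Nil
  then show ?case by (simp add: refine_def)
next
  case (Cons p B)
  obtain e a where p: "p = (e, a)" by (cases p)
  have "box_avg (refine M (p # B)) h = avg ((1 / real M) *\<^sub>R e) (a * M) (box_avg (refine M B) h)"
    by (simp add: p refine_def)
  also have "\<dots> = avg e a (avg ((1 / real M) *\<^sub>R e) M (box_avg (refine M B) h))"
    using assms by (simp add: avg_subdivide)
  also have "\<dots> = avg e a (box_avg B (avg ((1 / real M) *\<^sub>R e) M (box_avg (map (\<lambda>(e, a). ((1 / real M) *\<^sub>R e, M)) B) h)))"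
    by (simp only: Cons.IH box_avg_avg)
  finally show ?case by (simp add: p)
qed

lemma refine_simps [simp]:
  "refine M [] = []" "refine M ((e, a) # B) = ((1 / real M) *\<^sub>R e, a * M) # refine M B"
  "refine M (B @ C) = refine M B @ refine M C"
  by (simp_all add: refine_def)

lemma box_in_refine: "subspace X \<Longrightarrow> M \<ge> 1 \<Longrightarrow> box_in X B \<Longrightarrow> box_in X (refine M B)"
  by (auto simp: box_in_def refine_def intro!: subspace_scale)

text \<open>Both averages telescope in the direction \<open>e0\<close>, to averages of the same long difference quotient
  $(g(z + a_0 e_0) - g(z)) / a_0$, taken over base points that differ by at most one cell of \<open>B\<close> and
  the size of \<open>C\<close>. That quotient is $2K/a_0$-Lipschitz, so refining a box and smearing it over a small
  second box \<open>C\<close> changes little as soon as the sides are long compared with the steps.\<close>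

lemma box_avg_refine_error:
  fixes g :: "'x::real_normed_vector \<Rightarrow> 'w::real_normed_vector"
  assumes X: "subspace X" and B: "box_in X B" and C: "box_in X C" and K: "K \<ge> 0" and M: "M \<ge> 1"
    and g: "\<And>x y. x \<in> X \<Longrightarrow> y \<in> X \<Longrightarrow> norm (g x - g y) \<le> K * norm (x - y)" and x: "x \<in> X"
    and mem: "(e0, a0) \<in> set B"
  shows "norm (real M *\<^sub>R box_avg (refine M B @ C) (\<lambda>z. g (z + (1 / real M) *\<^sub>R e0) - g z) x
      - box_avg B (\<lambda>z. g (z + e0) - g z) x) \<le> 2 * K / a0 * (box_mesh B + box_size C)"
proof -
  obtain B1 B2 where B12: "B = B1 @ (e0, a0) # B2" using mem by (meson split_list)
  let ?D = "B1 @ B2"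
  let ?S = "map (\<lambda>(e, a). ((1 / real M) *\<^sub>R e, M)) ?D"
  have a0: "a0 \<ge> 1" "e0 \<in> X" and D: "box_in X ?D" using B by (auto simp: B12)
  define h where "h z = (1 / real a0) *\<^sub>R (g (z + real a0 *\<^sub>R e0) - g z)" for z
  have h: "norm (h y - h z) \<le> 2 * K / a0 * norm (y - z)" if "y \<in> X" "z \<in> X" for y z
  proof -
    let ?v = "real a0 *\<^sub>R e0"
    have v: "y + ?v \<in> X" "z + ?v \<in> X" using that a0 by (auto intro!: subspace_add[OF X] subspace_scale[OF X])
    have "h y - h z = (1 / real a0) *\<^sub>R ((g (y + ?v) - g (z + ?v)) - (g y - g z))"
      by (simp add: h_def algebra_simps flip: scaleR_diff_right)
    also have "norm \<dots> \<le> (1 / real a0) * (norm (g (y + ?v) - g (z + ?v)) + norm (g y - g z))"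
      using a0 norm_triangle_ineq4[of "g (y + ?v) - g (z + ?v)" "g y - g z"] by (simp add: divide_right_mono)
    also have "\<dots> \<le> (1 / real a0) * (K * norm (y - z) + K * norm (y - z))"
      using g[OF v] g[OF that] a0 by (intro mult_left_mono add_mono) auto
    finally show ?thesis by (simp add: field_simps)
  qed
  have "box_avg B (\<lambda>z. g (z + e0) - g z) = box_avg ?D (\<lambda>z. avg e0 a0 (\<lambda>z. g (z + e0) - g z) z)"
    unfolding B12 box_avg_extract ..
  also have "\<dots> = box_avg ?D h"
    unfolding avg_telescope[OF a0(1)] h_def ..
  finally have 1: "box_avg B (\<lambda>z. g (z + e0) - g z) x = box_avg ?D h x" by simp
  let ?e = "(1 / real M) *\<^sub>R e0"
  have "box_avg (refine M B @ C) (\<lambda>z. g (z + ?e) - g z)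
      = box_avg (refine M B1 @ (refine M B2 @ C)) (\<lambda>z. avg ?e (a0 * M) (\<lambda>z. g (z + ?e) - g z) z)"
    by (simp add: B12 box_avg_extract)
  also have "(\<lambda>z. avg ?e (a0 * M) (\<lambda>z. g (z + ?e) - g z) z) = (\<lambda>z. (1 / real M) *\<^sub>R h z)"
    using a0 M by (subst avg_telescope) (auto simp: h_def mult.commute)
  also have "box_avg (refine M B1 @ (refine M B2 @ C)) \<dots> = box_avg (refine M ?D @ C) (\<lambda>z. (1 / real M) *\<^sub>R h z)"
    by simp
  finally have "real M *\<^sub>R box_avg (refine M B @ C) (\<lambda>z. g (z + ?e) - g z) x = box_avg (refine M ?D @ C) h x"
    using M by (simp only: box_avg_scaleR) simp
  also have "\<dots> = box_avg ?D (box_avg (?S @ C) h) x"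
    by (simp only: box_avg_append[of "refine M ?D"] box_avg_refine[OF M] box_avg_append[of ?S])
  finally have "real M *\<^sub>R box_avg (refine M B @ C) (\<lambda>z. g (z + ?e) - g z) x - box_avg B (\<lambda>z. g (z + e0) - g z) x
      = box_avg ?D (\<lambda>z. box_avg (?S @ C) h z - h z) x"
    by (simp only: 1 box_avg_diff[of ?D "box_avg (?S @ C) h" h x])
  also have "norm \<dots> \<le> 2 * K / a0 * (box_mesh B + box_size C)"
  proof (rule box_avg_norm_le[OF X D _ x])
    fix z assume z: "z \<in> X"
    have S: "box_in X ?S" using D M X by (auto simp: box_in_def intro!: subspace_scale)
    have "norm (box_avg (?S @ C) h z - h z) \<le> 2 * K / a0 * box_size (?S @ C)"
      by (rule box_avg_displacement[OF X _ _ h z]) (use S C K in auto)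
    also have "\<dots> \<le> 2 * K / a0 * (box_mesh B + box_size C)"
    proof -
      have "box_size (map (\<lambda>(e, a). ((1 / real M) *\<^sub>R e, M)) E) = box_mesh E" for E :: "('x \<times> nat) list"
      proof (induction E)
        case (Cons p E)
        then show ?case using M by (cases p) simp
      qed simp
      then have "box_size (?S @ C) \<le> box_mesh B + box_size C"
        by (simp only: box_size_simps(3) B12 box_mesh_simps) simp
      then show ?thesis using K by (intro mult_left_mono) auto
    qed
    finally show "norm (box_avg (?S @ C) h z - h z) \<le> 2 * K / a0 * (box_mesh B + box_size C)" .
  qed
  finally show ?thesis .
qed

text \<open>After telescoping, only the two opposite faces of the box contribute.\<close>

lemma box_avg_difference_le:
  fixes h :: "'x::real_normed_vector \<Rightarrow> 'w::real_normed_vector"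
  assumes X: "subspace X" and B: "box_in X B" and h: "\<And>x. x \<in> X \<Longrightarrow> norm (h x) \<le> C" and x: "x \<in> X"
    and mem: "(e, a) \<in> set B"
  shows "norm (box_avg B (\<lambda>z. h (z + e) - h z) x) \<le> 2 * C / a"
proof -
  obtain B1 B2 where B12: "B = B1 @ (e, a) # B2" using mem by (meson split_list)
  have a: "a \<ge> 1" "e \<in> X" and D: "box_in X (B1 @ B2)" using B by (auto simp: B12)
  have "box_avg B (\<lambda>z. h (z + e) - h z) = box_avg (B1 @ B2) (\<lambda>z. avg e a (\<lambda>z. h (z + e) - h z) z)"
    unfolding B12 box_avg_extract ..
  also have "\<dots> = box_avg (B1 @ B2) (\<lambda>z. (1 / real a) *\<^sub>R (h (z + real a *\<^sub>R e) - h z))"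
    unfolding avg_telescope[OF a(1)] ..
  finally have "box_avg B (\<lambda>z. h (z + e) - h z) x = box_avg (B1 @ B2) (\<lambda>z. (1 / real a) *\<^sub>R (h (z + real a *\<^sub>R e) - h z)) x"
    by simp
  also have "norm \<dots> \<le> 2 * C / a"
  proof (rule box_avg_norm_le[OF X D _ x])
    fix z assume z: "z \<in> X"
    have "z + real a *\<^sub>R e \<in> X" using z a by (auto intro!: subspace_add[OF X] subspace_scale[OF X])
    then have "norm (h (z + real a *\<^sub>R e) - h z) \<le> 2 * C"
      using norm_triangle_ineq4[of "h (z + real a *\<^sub>R e)" "h z"] h[OF z] h[of "z + real a *\<^sub>R e"] by linarith
    then show "norm ((1 / real a) *\<^sub>R (h (z + real a *\<^sub>R e) - h z)) \<le> 2 * C / a"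
      using a by (simp add: divide_right_mono)
  qed
  finally show ?thesis .
qed

text \<open>The steps are $2^{q-1} e, \dots, 2 e, e$.\<close>

lemma avg_dyadic:
  "\<exists>es. length es = q \<and> (\<forall>X. subspace X \<longrightarrow> e \<in> X \<longrightarrow> set es \<subseteq> X) \<and>
     (\<forall>h :: 'x::real_vector \<Rightarrow> 'w::real_vector. avg e (2 ^ q) h = box_avg (map (\<lambda>u. (u, 2)) es) h)"
proof (induction q)
  case 0
  show ?case by (intro exI[of _ "[]"]) (auto simp: avg_def)
next
  case (Suc q)
  then obtain es where es: "length es = q" "\<And>X. subspace X \<Longrightarrow> e \<in> X \<Longrightarrow> set es \<subseteq> X"
    "\<And>h :: 'x \<Rightarrow> 'w. avg e (2 ^ q) h = box_avg (map (\<lambda>u. (u, 2)) es) h" by blast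
  have "avg e (2 ^ Suc q) h = avg (real (2 ^ q) *\<^sub>R e) 2 (avg e (2 ^ q) h)" for h :: "'x \<Rightarrow> 'w"
    using avg_subdivide[of "2 ^ q" e 2 h] by simp
  then show ?case
    using es by (intro exI[of _ "(real (2 ^ q) *\<^sub>R e) # es"]) (auto intro: subspace_scale)
qed

lemma box_avg_dyadic:
  "\<exists>es. length es = q * length V \<and> (\<forall>X. subspace X \<longrightarrow> set V \<subseteq> X \<longrightarrow> set es \<subseteq> X) \<and>
     (\<forall>h :: 'x::real_vector \<Rightarrow> 'w::real_vector. box_avg (map (\<lambda>e. (e, 2 ^ q)) V) h = box_avg (map (\<lambda>u. (u, 2)) es) h)"
proof (induction V)
  case Nil
  show ?case by (intro exI[of _ "[]"]) auto
next
  case (Cons e V)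
  then obtain es where es: "length es = q * length V" "\<And>X. subspace X \<Longrightarrow> set V \<subseteq> X \<Longrightarrow> set es \<subseteq> X"
    "\<And>h :: 'x \<Rightarrow> 'w. box_avg (map (\<lambda>e. (e, 2 ^ q)) V) h = box_avg (map (\<lambda>u. (u, 2)) es) h" by blast
  obtain fs where fs: "length fs = q" "\<And>X. subspace X \<Longrightarrow> e \<in> X \<Longrightarrow> set fs \<subseteq> X"
    "\<And>h :: 'x \<Rightarrow> 'w. avg e (2 ^ q) h = box_avg (map (\<lambda>u. (u, 2)) fs) h" using avg_dyadic[of q e] by blast
  show ?case using es fs
    by (intro exI[of _ "fs @ es"]) (auto simp: box_avg_append)
qed

lemma csubspace_imp_subspace: "csubspace X \<Longrightarrow> subspace X"
  by (auto simp: csubspace_def subspace_def scaleR_scaleC)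

lemma dual_space_zero: "0 \<in> dual_space Y"
  by (auto simp: dual_space_def intro: exI[of _ 0])

lemma box_avg_in_dual_space:
  assumes X: "subspace X" and Y: "csubspace Y" and B: "box_in X B" and f: "f \<in> X \<rightarrow> dual_space Y"
  shows "box_avg B f \<in> X \<rightarrow> dual_space Y"
  using B
proof (induction B)
  case (Cons p B)
  obtain e a where p: "p = (e, a)" by (cases p)
  have sum: "sum g S \<in> dual_space Y" if "\<And>s. s \<in> S \<Longrightarrow> g s \<in> dual_space Y" for g and S :: "nat set"
    using that by (induction S rule: infinite_finite_induct) (auto intro: dual_space_add Y dual_space_zero)
  show ?case
  proof
    fix x assume x: "x \<in> X"
    have "x + real b *\<^sub>R e \<in> X" for b :: nat using x Cons.prems p by (auto intro!: subspace_add[OF X] subspace_scale[OF X])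
    then show "box_avg (p # B) f x \<in> dual_space Y"
      using Cons by (auto simp: p avg_def intro!: dual_space_scaleR sum)
  qed
qed (use f in simp)

text \<open>Each of the two-point averages costs a factor $4^k$ in the level and $L / 2^k$ in the lower
  constant. The number of averages is arbitrary, but has to be fixed before the level.\<close>

lemma amp_bounds_dyadic_average:
  assumes X: "csubspace X" and Y: "operator_space Y" and f: "f \<in> X \<rightarrow> dual_space Y" and es: "set es \<subseteq> X"
    and up: "amp_upper X Y (n * (4 ^ k) ^ length es) L f" and low: "amp_lower X Y (n * (4 ^ k) ^ length es) c f"
  shows "amp_upper X Y n L (box_avg (map (\<lambda>u. (u, 2)) es) f)"
    "amp_lower X Y n (c - real (length es) * (L / 2 ^ k)) (box_avg (map (\<lambda>u. (u, 2)) es) f)"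
proof -
  have sub: "csubspace Y" using Y by (simp add: operator_space_def)
  have "amp_upper X Y n L (box_avg (map (\<lambda>u. (u, 2)) es) f) \<and>
    amp_lower X Y n (c - real (length es) * (L / 2 ^ k)) (box_avg (map (\<lambda>u. (u, 2)) es) f)"
    using es up low
  proof (induction es arbitrary: n)
    case (Cons e es)
    let ?g = "box_avg (map (\<lambda>u. (u, 2)) es) f"
    have g: "?g \<in> X \<rightarrow> dual_space Y"
      by (rule box_avg_in_dual_space[OF csubspace_imp_subspace[OF X] sub _ f]) (use Cons.prems in \<open>auto simp: box_in_def\<close>)
    have two: "box_avg (map (\<lambda>u. (u, 2)) (e # es)) f = (\<lambda>x. (1/2) *\<^sub>R (?g x + ?g (x + e)))"
      by (rule ext) (simp add: avg_def numeral_2_eq_2 lessThan_Suc add.commute)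
    have IH: "amp_upper X Y (n * 4 ^ k) L ?g" "amp_lower X Y (n * 4 ^ k) (c - real (length es) * (L / 2 ^ k)) ?g"
      using Cons.IH[of "n * 4 ^ k"] Cons.prems by (simp_all add: mult.assoc)
    have up: "amp_upper X Y n L ?g" by (rule amp_upper_divisor[OF Y g _ IH(1)]) simp
    have e: "e \<in> X" using Cons.prems by simp
    have "c - real (length (e # es)) * (L / 2 ^ k) = c - real (length es) * (L / 2 ^ k) - L / 2 ^ k"
      by (simp add: algebra_simps add_divide_distrib)
    then show ?case unfolding two
      using amp_lower_two_point_average[OF X Y g up IH(2) e] amp_upper_two_point_average[OF X Y g up e] by (simp only: simp_thms)
  qed simp
  then show "amp_upper X Y n L (box_avg (map (\<lambda>u. (u, 2)) es) f)"
    "amp_lower X Y n (c - real (length es) * (L / 2 ^ k)) (box_avg (map (\<lambda>u. (u, 2)) es) f)" by auto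
qed

section \<open>Generalised limits\<close>

text \<open>A generalised limit behaves like the limit along an ultrafilter finer than \<open>F\<close>: it replaces the
  passage to a convergent subnet, simultaneously for all bounded families.\<close>

definition generalised_limit :: "'i filter \<Rightarrow> (('i \<Rightarrow> real) \<Rightarrow> real) \<Rightarrow> bool"
  where "generalised_limit F \<Lambda> \<longleftrightarrow>
    (\<forall>s t. bounded (range s) \<longrightarrow> bounded (range t) \<longrightarrow> \<Lambda> (\<lambda>i. s i + t i) = \<Lambda> s + \<Lambda> t) \<and>
    (\<forall>s r. bounded (range s) \<longrightarrow> \<Lambda> (\<lambda>i. r * s i) = r * \<Lambda> s) \<and>
    (\<forall>s c. bounded (range s) \<longrightarrow> eventually (\<lambda>i. s i \<le> c) F \<longrightarrow> \<Lambda> s \<le> c)"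

text \<open>A cluster point of the evaluations \<open>\<lambda>s. s i\<close>, which lie in a product of compact intervals.
  The clauses of the definition are closed conditions on single coordinates and thus pass to it.\<close>

lemma generalised_limit_exists:
  fixes F :: "'i filter"
  assumes "F \<noteq> bot"
  obtains \<Lambda> where "generalised_limit F \<Lambda>"
proof -
  define K where "K s = (if bounded (range s) then SOME K. \<forall>i. norm (s i) \<le> K else 0)" for s :: "'i \<Rightarrow> real"
  have K: "norm (s i) \<le> K s" if "bounded (range s)" for s i
  proof -
    have "\<exists>K. \<forall>i. norm (s i) \<le> K" using that by (auto simp: bounded_iff)
    then have "\<forall>i. norm (s i) \<le> (SOME K. \<forall>i. norm (s i) \<le> K)" by (rule someI_ex)
    then show ?thesis using that by (simp add: K_def)
  qed
  define ev where "ev i s = (if bounded (range s) then s i else 0)" for i and s :: "'i \<Rightarrow> real"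
  define C :: "(('i \<Rightarrow> real) \<Rightarrow> real) set" where "C = (\<Pi>\<^sub>E s\<in>UNIV. {- K s..K s})"
  have "compactin (product_topology (\<lambda>_. euclidean) UNIV) C"
    unfolding C_def compactin_PiE by simp
  then have C: "compact C"
    by (simp add: euclidean_product_topology compactin_euclidean_iff)
  have "ev i \<in> C" for i
    using K by (auto simp: C_def ev_def abs_le_iff K_def minus_le_iff)
  then have "eventually (\<lambda>g. g \<in> C) (filtermap ev F)" by (simp add: eventually_filtermap)
  moreover have "filtermap ev F \<noteq> bot" using assms by (simp add: filtermap_bot_iff)
  ultimately obtain \<Lambda> where \<Lambda>: "inf (nhds \<Lambda>) (filtermap ev F) \<noteq> bot"
    using C unfolding compact_filter by blast
  have closed: "\<Lambda> \<in> Q" if Q: "closed Q" "eventually (\<lambda>i. ev i \<in> Q) F" for Q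
  proof (rule ccontr)
    assume "\<Lambda> \<notin> Q"
    then have "eventually (\<lambda>g. g \<in> - Q) (nhds \<Lambda>)" using Q(1) by (intro eventually_nhds_in_open) auto
    moreover have "eventually (\<lambda>g. g \<in> Q) (filtermap ev F)" using Q(2) by (simp add: eventually_filtermap)
    ultimately have "eventually (\<lambda>g. g \<in> - Q \<and> g \<in> Q) (inf (nhds \<Lambda>) (filtermap ev F))"
      unfolding eventually_inf by blast
    then have "eventually (\<lambda>g. False) (inf (nhds \<Lambda>) (filtermap ev F))" by (rule eventually_mono) auto
    with \<Lambda> show False by (simp add: trivial_limit_def)
  qed
  have cont: "continuous_on UNIV (\<lambda>g :: ('i \<Rightarrow> real) \<Rightarrow> real. g s)" for s
    by (rule continuous_on_product_coordinates)
  have "generalised_limit F \<Lambda>"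
    unfolding generalised_limit_def
  proof (intro conjI allI impI)
    fix s t :: "'i \<Rightarrow> real" assume st: "bounded (range s)" "bounded (range t)"
    have "bounded (range (\<lambda>i. s i + t i))" using bounded_plus_comp[OF st] by simp
    then have "\<Lambda> \<in> {g. g (\<lambda>i. s i + t i) = g s + g t}"
      using st by (intro closed closed_Collect_eq continuous_intros cont) (simp add: ev_def)
    then show "\<Lambda> (\<lambda>i. s i + t i) = \<Lambda> s + \<Lambda> t" by simp
  next
    fix s :: "'i \<Rightarrow> real" and r assume s: "bounded (range s)"
    have "bounded (range (\<lambda>i. r * s i))" using bounded_scaling[OF s, of r] by (simp add: image_image)
    then have "\<Lambda> \<in> {g. g (\<lambda>i. r * s i) = r * g s}"
      using s by (intro closed closed_Collect_eq continuous_intros cont) (simp add: ev_def)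
    then show "\<Lambda> (\<lambda>i. r * s i) = r * \<Lambda> s" by simp
  next
    fix s :: "'i \<Rightarrow> real" and c assume s: "bounded (range s)" "eventually (\<lambda>i. s i \<le> c) F"
    have "\<Lambda> \<in> {g. g s \<le> c}"
      using s by (intro closed closed_Collect_le continuous_intros cont) (simp add: ev_def)
    then show "\<Lambda> s \<le> c" by simp
  qed
  then show thesis by (rule that)
qed

lemma
  assumes "generalised_limit F \<Lambda>" "bounded (range s)"
  shows generalised_limit_add: "bounded (range t) \<Longrightarrow> \<Lambda> (\<lambda>i. s i + t i) = \<Lambda> s + \<Lambda> t"
    and generalised_limit_scale: "\<Lambda> (\<lambda>i. r * s i) = r * \<Lambda> s"
    and generalised_limit_le: "eventually (\<lambda>i. s i \<le> c) F \<Longrightarrow> \<Lambda> s \<le> c"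
  using assms unfolding generalised_limit_def by blast+

definition complex_limit :: "(('i \<Rightarrow> real) \<Rightarrow> real) \<Rightarrow> ('i \<Rightarrow> complex) \<Rightarrow> complex"
  where "complex_limit \<Lambda> z = Complex (\<Lambda> (\<lambda>i. Re (z i))) (\<Lambda> (\<lambda>i. Im (z i)))"

lemma bounded_range_Re_Im:
  fixes z :: "'i \<Rightarrow> complex"
  assumes "bounded (range z)"
  shows "bounded (range (\<lambda>i. Re (z i)))" "bounded (range (\<lambda>i. Im (z i)))"
proof -
  obtain K where "\<And>i. cmod (z i) \<le> K" using assms by (auto simp: bounded_iff)
  then have "\<bar>Re (z i)\<bar> \<le> K" "\<bar>Im (z i)\<bar> \<le> K" for i
    using abs_Re_le_cmod[of "z i"] abs_Im_le_cmod[of "z i"] by (meson order_trans)+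
  then show "bounded (range (\<lambda>i. Re (z i)))" "bounded (range (\<lambda>i. Im (z i)))"
    by (auto simp: bounded_iff)
qed

lemma cmod_eq_Re_rotation: "cmod w = Re (sgn w) * Re w + Im (sgn w) * Im w"
proof (cases "w = 0")
  case False
  have "Re (sgn w) * Re w + Im (sgn w) * Im w = ((Re w)\<^sup>2 + (Im w)\<^sup>2) / cmod w"
    by (simp add: sgn_eq power2_eq_square add_divide_distrib)
  also have "(Re w)\<^sup>2 + (Im w)\<^sup>2 = cmod w * cmod w"
    using cmod_power2[of w] by (simp only: power2_eq_square)
  also have "\<dots> / cmod w = cmod w" using False by simp
  finally show ?thesis by simp
qed simp

lemma rotation_le_cmod: "Re (sgn w) * Re z + Im (sgn w) * Im z \<le> cmod z"
proof -
  have "Re (sgn w) * Re z + Im (sgn w) * Im z = Re (cnj (sgn w) * z)" by simp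
  also have "\<dots> \<le> cmod (cnj (sgn w) * z)" by (rule complex_Re_le_cmod)
  also have "\<dots> \<le> cmod z" by (simp add: norm_mult norm_sgn mult_left_le_one_le)
  finally show ?thesis .
qed

lemma complex_limit_dist_le:
  assumes \<Lambda>: "generalised_limit F \<Lambda>" and z: "bounded (range z)" and ev: "eventually (\<lambda>i. cmod (z i - c) \<le> \<epsilon>) F"
  shows "cmod (complex_limit \<Lambda> z - c) \<le> \<epsilon>"
proof -
  define w where "w = complex_limit \<Lambda> z - c"
  define a b where "a = Re (sgn w)" and "b = Im (sgn w)"
  have rot: "a * Re v + b * Im v \<le> cmod v" for v
    unfolding a_def b_def by (rule rotation_le_cmod)
  have bd: "bounded (range (\<lambda>i. Re (z i)))" "bounded (range (\<lambda>i. Im (z i)))"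
    by (rule bounded_range_Re_Im[OF z])+
  have b1: "bounded (range (\<lambda>i. a * Re (z i)))" using bounded_scaling[OF bd(1), of a] by (simp add: image_image)
  have b2: "bounded (range (\<lambda>i. b * Im (z i)))" using bounded_scaling[OF bd(2), of b] by (simp add: image_image)
  have b3: "bounded (range (\<lambda>i. a * Re (z i) + b * Im (z i)))" using bounded_plus_comp[OF b1 b2] by simp
  have "a * \<Lambda> (\<lambda>i. Re (z i)) + b * \<Lambda> (\<lambda>i. Im (z i)) = \<Lambda> (\<lambda>i. a * Re (z i) + b * Im (z i))"
    by (simp only: generalised_limit_add[OF \<Lambda> b1 b2] generalised_limit_scale[OF \<Lambda> bd(1)] generalised_limit_scale[OF \<Lambda> bd(2)])
  also have "\<dots> \<le> \<epsilon> + (a * Re c + b * Im c)"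
  proof (rule generalised_limit_le[OF \<Lambda> b3])
    show "eventually (\<lambda>i. a * Re (z i) + b * Im (z i) \<le> \<epsilon> + (a * Re c + b * Im c)) F"
      using ev
    proof (rule eventually_mono)
      fix i assume "cmod (z i - c) \<le> \<epsilon>"
      then show "a * Re (z i) + b * Im (z i) \<le> \<epsilon> + (a * Re c + b * Im c)"
        using rot[of "z i - c"] by (simp add: algebra_simps)
    qed
  qed
  finally have "a * Re w + b * Im w \<le> \<epsilon>"
    by (simp add: w_def complex_limit_def algebra_simps)
  moreover have "cmod w = a * Re w + b * Im w"
    unfolding a_def b_def by (rule cmod_eq_Re_rotation)
  ultimately show ?thesis by (simp add: w_def)
qed

lemma complex_limit_diff:
  assumes \<Lambda>: "generalised_limit F \<Lambda>" and z: "bounded (range z)" "bounded (range z')"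
  shows "complex_limit \<Lambda> (\<lambda>i. z i - z' i) = complex_limit \<Lambda> z - complex_limit \<Lambda> z'"
proof -
  have m: "\<Lambda> (\<lambda>i. s i - t i) = \<Lambda> s - \<Lambda> t" if "bounded (range s)" "bounded (range t)" for s t
  proof -
    have "bounded (range (\<lambda>i. (-1) * t i))" using bounded_scaling[OF that(2), of "-1"] by (simp add: image_image)
    then have "\<Lambda> (\<lambda>i. s i + (-1) * t i) = \<Lambda> s + (-1) * \<Lambda> t"
      by (simp only: generalised_limit_add[OF \<Lambda> that(1)] generalised_limit_scale[OF \<Lambda> that(2)])
    then show ?thesis by simp
  qed
  show ?thesis
    using m[OF bounded_range_Re_Im(1)[OF z(1)] bounded_range_Re_Im(1)[OF z(2)]]
      m[OF bounded_range_Re_Im(2)[OF z(1)] bounded_range_Re_Im(2)[OF z(2)]]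
    by (simp add: complex_limit_def complex_eq_iff)
qed

section \<open>Tangent maps\<close>

lemma scaleR_fun_apply: "(c *\<^sub>R \<phi>) x = c *\<^sub>R \<phi> x"
  by (simp add: scaleR_fun_def)

text \<open>Tangent maps depend only on the scalar Lipschitz estimate; matrix norms enter through a second
  locale below.\<close>

locale lipschitz_into_dual =
  fixes X :: "'x::real_normed_vector set" and Y :: "('k::complex_hilbert \<Rightarrow>\<^sub>L 'k) set"
    and f :: "'x \<Rightarrow> ('k \<Rightarrow>\<^sub>L 'k) \<Rightarrow> complex" and L :: real
  assumes X: "subspace X" and Y: "operator_space Y" and f: "f \<in> X \<rightarrow> dual_space Y" and L: "L \<ge> 0"
    and lip: "\<And>x x' y. x \<in> X \<Longrightarrow> x' \<in> X \<Longrightarrow> y \<in> Y \<Longrightarrow> cmod (f x y - f x' y) \<le> L * norm y * norm (x - x')"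
begin

lemma Y_sub: "csubspace Y"
  using Y by (simp add: operator_space_def)

lemma Y_closed: "y \<in> Y \<Longrightarrow> y' \<in> Y \<Longrightarrow> y + y' \<in> Y" "y \<in> Y \<Longrightarrow> c *\<^sub>C y \<in> Y"
  using Y_sub by (auto simp: csubspace_def)

lemma X_closed: "x \<in> X \<Longrightarrow> x' \<in> X \<Longrightarrow> x + x' \<in> X" "x \<in> X \<Longrightarrow> r *\<^sub>R x \<in> X"
  using X by (auto intro: subspace_add subspace_scale)

definition quot :: "'x \<Rightarrow> real \<Rightarrow> 'x \<Rightarrow> ('k \<Rightarrow>\<^sub>L 'k) \<Rightarrow> complex"
  where "quot x t = (\<lambda>v. (1 / t) *\<^sub>R (f (x + t *\<^sub>R v) - f x))"

text \<open>The span of \<open>evals\<close> consists of the functionals that are continuous for the topology of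
  pointwise weak-star convergence.\<close>

definition evals :: "(('x \<Rightarrow> ('k \<Rightarrow>\<^sub>L 'k) \<Rightarrow> complex) \<Rightarrow> real) set"
  where "evals = {\<lambda>h. Re (h w y) | w y. w \<in> X \<and> y \<in> Y} \<union> {\<lambda>h. Im (h w y) | w y. w \<in> X \<and> y \<in> Y}"

text \<open>By the Hahn-Banach theorem this says that \<open>U\<close> lies in the weak-star closed convex hull of the
  difference quotients of \<open>f\<close>. Stated through functionals, it passes to averages and to limits at once,
  and its contrapositive finds a single difference quotient that is as good as \<open>U\<close> for a given
  functional.\<close>

definition averaged :: "('x \<Rightarrow> ('k \<Rightarrow>\<^sub>L 'k) \<Rightarrow> complex) \<Rightarrow> bool"
  where "averaged U \<longleftrightarrow> (\<forall>\<Phi>\<in>span evals. \<forall>M. (\<forall>x\<in>X. \<forall>t>0. \<Phi> (quot x t) \<le> M) \<longrightarrow> \<Phi> U \<le> M)"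

text \<open>Vanishing off \<open>Y\<close> is the convention for representatives in \<open>dual_space\<close>.\<close>

definition tangent :: "('x \<Rightarrow> ('k \<Rightarrow>\<^sub>L 'k) \<Rightarrow> complex) \<Rightarrow> bool"
  where "tangent T \<longleftrightarrow> averaged T \<and> (\<forall>v y. y \<notin> Y \<longrightarrow> T v y = 0) \<and>
    (\<forall>u\<in>X. \<forall>v\<in>X. \<forall>y\<in>Y. T (u + v) y = T u y + T v y)"

lemma Re_eval_in_span: "w \<in> X \<Longrightarrow> y \<in> Y \<Longrightarrow> (\<lambda>h. Re (h w y)) \<in> span evals"
  by (rule span_base) (auto simp: evals_def)

lemma Im_eval_in_span: "w \<in> X \<Longrightarrow> y \<in> Y \<Longrightarrow> (\<lambda>h. Im (h w y)) \<in> span evals"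
  by (rule span_base) (auto simp: evals_def)

lemma linear_of_span:
  assumes "\<Phi> \<in> span evals"
  shows "linear \<Phi>"
  using assms
proof (induction rule: span_induct_alt)
  case base
  show ?case by (rule linearI) (auto simp: zero_fun_def)
next
  case (step c \<Psi> \<Phi>)
  have "linear \<Psi>"
    using step(1) by (auto simp: evals_def scaleR_fun_def intro!: linearI)
  with step(2) have "linear (\<lambda>h. c *\<^sub>R \<Psi> h + \<Phi> h)"
    by (intro linear_compose_add linear_compose_scale_right)
  moreover have "c *\<^sub>R \<Psi> + \<Phi> = (\<lambda>h. c *\<^sub>R \<Psi> h + \<Phi> h)"
    by (rule ext) (simp add: scaleR_fun_apply)
  ultimately show ?case by simp
qed

text \<open>A functional in the span looks at the map only through finitely many directions.\<close>

lemma span_evals_continuous: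
  assumes "\<Phi> \<in> span evals"
  obtains ws C where "set ws \<subseteq> X" "C \<ge> 0"
    "\<And>h k \<epsilon>. \<epsilon> \<ge> 0 \<Longrightarrow> (\<And>w y. w \<in> set ws \<Longrightarrow> y \<in> Y \<Longrightarrow> cmod (h w y - k w y) \<le> \<epsilon> * norm y) \<Longrightarrow> \<bar>\<Phi> h - \<Phi> k\<bar> \<le> C * \<epsilon>"
proof -
  have "\<exists>ws C. set ws \<subseteq> X \<and> C \<ge> 0 \<and> (\<forall>h k \<epsilon>. \<epsilon> \<ge> 0 \<longrightarrow>
    (\<forall>w\<in>set ws. \<forall>y\<in>Y. cmod (h w y - k w y) \<le> \<epsilon> * norm y) \<longrightarrow> \<bar>\<Phi> h - \<Phi> k\<bar> \<le> C * \<epsilon>)"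
    using assms
  proof (induction rule: span_induct_alt)
    case base
    show ?case by (intro exI[of _ "[]"] exI[of _ 0]) auto
  next
    case (step c \<Psi> \<Phi>)
    obtain ws C where 1: "set ws \<subseteq> X" "C \<ge> 0" "\<And>h k \<epsilon>. \<epsilon> \<ge> 0 \<Longrightarrow>
       (\<forall>w\<in>set ws. \<forall>y\<in>Y. cmod (h w y - k w y) \<le> \<epsilon> * norm y) \<Longrightarrow> \<bar>\<Phi> h - \<Phi> k\<bar> \<le> C * \<epsilon>"
      using step(2) by blast
    obtain w y where wy: "w \<in> X" "y \<in> Y" "\<Psi> = (\<lambda>h. Re (h w y)) \<or> \<Psi> = (\<lambda>h. Im (h w y))"
      using step(1) by (auto simp: evals_def)
    have \<Psi>: "\<bar>\<Psi> h - \<Psi> k\<bar> \<le> cmod (h w y - k w y)" for h k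
      using wy(3) abs_Re_le_cmod[of "h w y - k w y"] abs_Im_le_cmod[of "h w y - k w y"] by auto
    show ?case
    proof (intro exI[of _ "w # ws"] exI[of _ "\<bar>c\<bar> * norm y + C"] conjI allI impI)
      fix h k and \<epsilon> :: real assume \<epsilon>: "\<epsilon> \<ge> 0"
        and hk: "\<forall>w\<in>set (w # ws). \<forall>y\<in>Y. cmod (h w y - k w y) \<le> \<epsilon> * norm y"
      have a: "\<bar>\<Phi> h - \<Phi> k\<bar> \<le> C * \<epsilon>" using hk by (intro 1(3) \<epsilon>) auto
      have "\<bar>\<Psi> h - \<Psi> k\<bar> \<le> \<epsilon> * norm y" using hk wy order_trans[OF \<Psi>] by auto
      then have "\<bar>c\<bar> * \<bar>\<Psi> h - \<Psi> k\<bar> \<le> \<bar>c\<bar> * (\<epsilon> * norm y)" by (intro mult_left_mono) auto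
      then have "\<bar>c * (\<Psi> h - \<Psi> k)\<bar> \<le> \<bar>c\<bar> * norm y * \<epsilon>" by (simp add: abs_mult mult_ac)
      moreover have "(c *\<^sub>R \<Psi> + \<Phi>) h - (c *\<^sub>R \<Psi> + \<Phi>) k = c * (\<Psi> h - \<Psi> k) + (\<Phi> h - \<Phi> k)"
        by (simp add: scaleR_fun_apply right_diff_distrib)
      ultimately show "\<bar>(c *\<^sub>R \<Psi> + \<Phi>) h - (c *\<^sub>R \<Psi> + \<Phi>) k\<bar> \<le> (\<bar>c\<bar> * norm y + C) * \<epsilon>"
        using a abs_triangle_ineq[of "c * (\<Psi> h - \<Psi> k)" "\<Phi> h - \<Phi> k"] unfolding distrib_right by linarith
    qed (use 1 wy in auto)
  qed
  then show thesis using that by metis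
qed

lemma averaged_le:
  assumes "averaged U" "\<Phi> \<in> span evals" "\<And>x t. x \<in> X \<Longrightarrow> t > 0 \<Longrightarrow> \<Phi> (quot x t) \<le> M"
  shows "\<Phi> U \<le> M"
  using assms unfolding averaged_def by blast

text \<open>Affine relations between the values of all difference quotients are inherited. Applied to the
  linearity of $f(x)$ on \<open>Y\<close>, this yields that averaged maps take values in the dual.\<close>

lemma averaged_eq:
  assumes "averaged U" "\<Phi> \<in> span evals" "\<And>x t. x \<in> X \<Longrightarrow> t > 0 \<Longrightarrow> \<Phi> (quot x t) = c"
  shows "\<Phi> U = c"
proof (rule antisym)
  show "\<Phi> U \<le> c" by (rule averaged_le[OF assms(1,2)]) (simp add: assms(3))
  have "- \<Phi> \<in> span evals" by (rule span_neg[OF assms(2)])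
  then have "(- \<Phi>) U \<le> - c" by (rule averaged_le[OF assms(1)]) (simp add: assms(3))
  then show "c \<le> \<Phi> U" by simp
qed

lemma quot_apply: "quot x t v y = (f (x + t *\<^sub>R v) y - f x y) / t"
  by (simp add: quot_def scaleR_fun_def scaleR_conv_of_real)

lemma quot_bound:
  assumes "x \<in> X" "t > 0" "v \<in> X" "y \<in> Y"
  shows "cmod (quot x t v y) \<le> L * norm y * norm v"
proof -
  have "cmod (f (x + t *\<^sub>R v) y - f x y) \<le> L * norm y * norm (t *\<^sub>R v)"
    using lip[of "x + t *\<^sub>R v" x y] assms X_closed by simp
  then show ?thesis using assms(2) by (simp add: quot_apply norm_divide field_simps)
qed

lemma quot_in_dual: "x \<in> X \<Longrightarrow> v \<in> X \<Longrightarrow> quot x t v \<in> dual_space Y"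
  unfolding quot_def by (intro dual_space_scaleR dual_space_diff Y_sub) (use f X_closed in auto)

lemma averaged_bound:
  assumes U: "averaged U" and v: "v \<in> X" and y: "y \<in> Y"
  shows "cmod (U v y) \<le> L * norm y * norm v"
proof -
  define a b where "a = Re (sgn (U v y))" and "b = Im (sgn (U v y))"
  let ?\<Phi> = "a *\<^sub>R (\<lambda>h. Re (h v y)) + b *\<^sub>R (\<lambda>h. Im (h v y))"
  have "?\<Phi> \<in> span evals"
    by (intro span_add span_scale Re_eval_in_span Im_eval_in_span v y)
  moreover have "?\<Phi> (quot x t) \<le> L * norm y * norm v" if "x \<in> X" "t > 0" for x t
    using rotation_le_cmod[of "U v y" "quot x t v y"] quot_bound[OF that v y]
    unfolding a_def b_def by (simp add: scaleR_fun_def del: Re_sgn Im_sgn)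
  ultimately have "?\<Phi> U \<le> L * norm y * norm v" by (rule averaged_le[OF U])
  moreover have "?\<Phi> U = cmod (U v y)"
    unfolding cmod_eq_Re_rotation[of "U v y"] a_def b_def by (simp add: scaleR_fun_def)
  ultimately show ?thesis by simp
qed

lemma averaged_add:
  assumes U: "averaged U" and v: "v \<in> X" and y: "y \<in> Y" "y' \<in> Y"
  shows "U v (y + y') = U v y + U v y'"
proof -
  have q: "quot x t v (y + y') = quot x t v y + quot x t v y'" if "x \<in> X" for x t
    using quot_in_dual[OF that v] y by (simp add: dual_space_def)
  have "((\<lambda>h. Re (h v (y + y'))) - (\<lambda>h. Re (h v y)) - (\<lambda>h. Re (h v y'))) U = 0"
    by (rule averaged_eq[OF U], intro span_diff Re_eval_in_span v y Y_closed) (simp add: q)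
  moreover have "((\<lambda>h. Im (h v (y + y'))) - (\<lambda>h. Im (h v y)) - (\<lambda>h. Im (h v y'))) U = 0"
    by (rule averaged_eq[OF U], intro span_diff Im_eval_in_span v y Y_closed) (simp add: q)
  ultimately show ?thesis by (simp add: complex_eq_iff)
qed

lemma averaged_scaleC:
  assumes U: "averaged U" and v: "v \<in> X" and y: "y \<in> Y"
  shows "U v (c *\<^sub>C y) = c * U v y"
proof -
  have q: "quot x t v (c *\<^sub>C y) = c * quot x t v y" if "x \<in> X" for x t
    using quot_in_dual[OF that v] y by (simp add: dual_space_def)
  have "((\<lambda>h. Re (h v (c *\<^sub>C y))) - Re c *\<^sub>R (\<lambda>h. Re (h v y)) + Im c *\<^sub>R (\<lambda>h. Im (h v y))) U = 0"
    by (rule averaged_eq[OF U], intro span_diff span_add span_scale Re_eval_in_span Im_eval_in_span v y Y_closed)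
      (simp add: q scaleR_fun_apply)
  moreover have "((\<lambda>h. Im (h v (c *\<^sub>C y))) - Re c *\<^sub>R (\<lambda>h. Im (h v y)) - Im c *\<^sub>R (\<lambda>h. Re (h v y))) U = 0"
    by (rule averaged_eq[OF U], intro span_diff span_add span_scale Re_eval_in_span Im_eval_in_span v y Y_closed)
      (simp add: q scaleR_fun_apply)
  ultimately show ?thesis by (simp add: complex_eq_iff scaleR_fun_def)
qed

lemma averaged_in_dual:
  assumes "averaged U" "v \<in> X" "\<And>y. y \<notin> Y \<Longrightarrow> U v y = 0"
  shows "U v \<in> dual_space Y"
proof -
  have "cmod (U v y) \<le> (L * norm v) * norm y" if "y \<in> Y" for y
    using averaged_bound[OF assms(1,2) that] by (simp add: mult_ac)
  then have "\<exists>K. \<forall>y\<in>Y. cmod (U v y) \<le> K * norm y" by (intro exI ballI)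
  then show ?thesis
    using averaged_add[OF assms(1,2)] averaged_scaleC[OF assms(1,2)] assms(3)
    unfolding dual_space_def by simp
qed

lemma tangent_in_dual: "tangent T \<Longrightarrow> v \<in> X \<Longrightarrow> T v \<in> dual_space Y"
  using averaged_in_dual by (simp add: tangent_def)

lemma averaged_box_avg:
  assumes "box_in X B" "x \<in> X" "t > 0"
  shows "averaged (box_avg B (\<lambda>z. quot z t) x)"
  unfolding averaged_def
proof (intro ballI allI impI)
  fix \<Phi> M assume \<Phi>: "\<Phi> \<in> span evals" and M: "\<forall>x\<in>X. \<forall>t>0. \<Phi> (quot x t) \<le> M"
  have "\<Phi> (box_avg B (\<lambda>z. quot z t) x) = box_avg B (\<lambda>z. \<Phi> (quot z t)) x"
    by (rule box_avg_linear[OF linear_of_span[OF \<Phi>], symmetric])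
  also have "\<dots> \<le> M" by (rule box_avg_le[OF X assms(1) _ assms(2)]) (use M assms(3) in auto)
  finally show "\<Phi> (box_avg B (\<lambda>z. quot z t) x) \<le> M" .
qed

definition limit_map :: "(('i \<Rightarrow> real) \<Rightarrow> real) \<Rightarrow> ('i \<Rightarrow> 'x \<Rightarrow> ('k \<Rightarrow>\<^sub>L 'k) \<Rightarrow> complex) \<Rightarrow> 'x \<Rightarrow> ('k \<Rightarrow>\<^sub>L 'k) \<Rightarrow> complex"
  where "limit_map \<Lambda> U = (\<lambda>v y. if v \<in> X \<and> y \<in> Y then complex_limit \<Lambda> (\<lambda>i. U i v y) else 0)"

lemma averaged_family_bounded:
  assumes "\<And>i. averaged (U i)" "v \<in> X" "y \<in> Y"
  shows "bounded (range (\<lambda>i. U i v y))"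
  using averaged_bound[OF assms(1,2,3)] by (auto simp: bounded_iff)

lemma span_eval_limit_map:
  assumes \<Lambda>: "generalised_limit F \<Lambda>" and U: "\<And>i. averaged (U i)" and \<Phi>: "\<Phi> \<in> span evals"
  shows "bounded (range (\<lambda>i. \<Phi> (U i))) \<and> \<Phi> (limit_map \<Lambda> U) = \<Lambda> (\<lambda>i. \<Phi> (U i))"
  using \<Phi>
proof (induction rule: span_induct_alt)
  case base
  have "bounded (range (\<lambda>i. 0 :: real))" by (auto simp: bounded_iff)
  from generalised_limit_scale[OF \<Lambda> this, of 0] this show ?case by (simp add: zero_fun_def)
next
  case (step c \<Psi> \<Phi>)
  obtain w y where wy: "w \<in> X" "y \<in> Y" "\<Psi> = (\<lambda>h. Re (h w y)) \<or> \<Psi> = (\<lambda>h. Im (h w y))"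
    using step(1) by (auto simp: evals_def)
  have \<Psi>: "bounded (range (\<lambda>i. \<Psi> (U i)))" "\<Psi> (limit_map \<Lambda> U) = \<Lambda> (\<lambda>i. \<Psi> (U i))"
    using wy bounded_range_Re_Im[OF averaged_family_bounded[OF U wy(1,2)]]
    by (auto simp: limit_map_def complex_limit_def)
  have b: "bounded (range (\<lambda>i. c * \<Psi> (U i)))" using bounded_scaling[OF \<Psi>(1), of c] by (simp add: image_image)
  have s: "(\<lambda>i. (c *\<^sub>R \<Psi> + \<Phi>) (U i)) = (\<lambda>i. c * \<Psi> (U i) + \<Phi> (U i))"
    by (simp add: scaleR_fun_def)
  have "bounded (range (\<lambda>i. c * \<Psi> (U i) + \<Phi> (U i)))"
    using bounded_plus_comp[OF b] step(2) by blast
  moreover have "\<Lambda> (\<lambda>i. c * \<Psi> (U i) + \<Phi> (U i)) = c * \<Lambda> (\<lambda>i. \<Psi> (U i)) + \<Lambda> (\<lambda>i. \<Phi> (U i))"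
    using step(2) by (simp only: generalised_limit_add[OF \<Lambda> b] generalised_limit_scale[OF \<Lambda> \<Psi>(1)])
  ultimately show ?case unfolding s using \<Psi>(2) step(2) by (simp add: scaleR_fun_def)
qed

lemma averaged_limit_map:
  assumes \<Lambda>: "generalised_limit F \<Lambda>" and U: "\<And>i. averaged (U i)"
  shows "averaged (limit_map \<Lambda> U)"
  unfolding averaged_def
proof (intro ballI allI impI)
  fix \<Phi> M assume \<Phi>: "\<Phi> \<in> span evals" and M: "\<forall>x\<in>X. \<forall>t>0. \<Phi> (quot x t) \<le> M"
  have "\<Phi> (U i) \<le> M" for i by (rule averaged_le[OF U \<Phi>]) (use M in auto)
  then have "\<Lambda> (\<lambda>i. \<Phi> (U i)) \<le> M"
    using span_eval_limit_map[where U = U, OF \<Lambda> U \<Phi>] by (intro generalised_limit_le[OF \<Lambda>]) auto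
  then show "\<Phi> (limit_map \<Lambda> U) \<le> M"
    using span_eval_limit_map[where U = U, OF \<Lambda> U \<Phi>] by simp
qed

lemma tangent_limit_map:
  assumes \<Lambda>: "generalised_limit F \<Lambda>" and U: "\<And>i. averaged (U i)"
    and add: "\<And>u v y \<epsilon>. u \<in> X \<Longrightarrow> v \<in> X \<Longrightarrow> y \<in> Y \<Longrightarrow> \<epsilon> > 0 \<Longrightarrow>
      eventually (\<lambda>i. cmod (U i (u + v) y - U i u y - U i v y) \<le> \<epsilon>) F"
  shows "tangent (limit_map \<Lambda> U)"
  unfolding tangent_def
proof (intro conjI ballI averaged_limit_map[OF \<Lambda> U])
  show "\<forall>v y. y \<notin> Y \<longrightarrow> limit_map \<Lambda> U v y = 0" by (simp add: limit_map_def)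
  fix u v y assume uv: "u \<in> X" "v \<in> X" and y: "y \<in> Y"
  let ?z = "\<lambda>i. U i (u + v) y - U i u y - U i v y"
  note b = averaged_family_bounded[where U = U, OF U X_closed(1)[OF uv] y] averaged_family_bounded[where U = U, OF U uv(1) y] averaged_family_bounded[where U = U, OF U uv(2) y]
  have b12: "bounded (range (\<lambda>i. U i (u + v) y - U i u y))" using bounded_minus_comp[OF b(1,2)] by simp
  have b3: "bounded (range ?z)" using bounded_minus_comp[OF b12 b(3)] by simp
  have "cmod (complex_limit \<Lambda> ?z) \<le> \<epsilon>" if "\<epsilon> > 0" for \<epsilon>
    using complex_limit_dist_le[OF \<Lambda> b3, of 0 \<epsilon>] add[OF uv y that] by simp
  then have "cmod (complex_limit \<Lambda> ?z) \<le> 0" by (rule field_le_epsilon[of _ 0, simplified])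
  then have "complex_limit \<Lambda> (\<lambda>i. U i (u + v) y) - complex_limit \<Lambda> (\<lambda>i. U i u y) - complex_limit \<Lambda> (\<lambda>i. U i v y) = 0"
    by (simp add: complex_limit_diff[OF \<Lambda> b12 b(3)] complex_limit_diff[OF \<Lambda> b(1,2)])
  then show "limit_map \<Lambda> U (u + v) y = limit_map \<Lambda> U u y + limit_map \<Lambda> U v y"
    using uv y X_closed by (simp add: limit_map_def algebra_simps)
qed

lemma limit_map_dist_le:
  assumes \<Lambda>: "generalised_limit F \<Lambda>" and U: "\<And>i. averaged (U i)" and v: "v \<in> X" and y: "y \<in> Y"
    and ev: "eventually (\<lambda>i. cmod (U i v y - c) \<le> \<epsilon>) F"
  shows "cmod (limit_map \<Lambda> U v y - c) \<le> \<epsilon>"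
  using complex_limit_dist_le[OF \<Lambda> averaged_family_bounded[where U = U, OF U v y] ev] v y by (simp add: limit_map_def)

text \<open>Compare $g(kr)$ with the value at the integer part of $kr$ and let $k$ grow.\<close>

lemma additive_bounded_homogeneous:
  fixes g :: "real \<Rightarrow> complex"
  assumes add: "\<And>r s. g (r + s) = g r + g s" and b: "\<And>r. cmod (g r) \<le> K * \<bar>r\<bar>"
  shows "g r = r * g 1"
proof -
  have z: "g 0 = 0" using add[of 0 0] by simp
  have nat: "g (of_nat k * s) = of_nat k * g s" for k s
    by (induction k) (simp_all add: z algebra_simps add)
  have "cmod (g r - r * g 1) \<le> \<epsilon>" if \<epsilon>: "\<epsilon> > 0" for \<epsilon>
  proof -
    have neg: "g (- s) = - g s" for s using add[of s "- s"] z by (simp add: eq_neg_iff_add_eq_0 add.commute)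
    have int: "g (of_int i) = of_int i * g 1" for i
    proof (cases i rule: int_cases2)
      case (nonneg k) then show ?thesis using nat[of k 1] by simp
    next
      case (nonpos k) then show ?thesis using nat[of k 1] neg[of "real k"] by simp
    qed
    have K: "0 \<le> K" using b[of 1] norm_ge_zero[of "g 1"] by linarith
    obtain k :: nat where k: "real k > 2 * K / \<epsilon>" using reals_Archimedean2 by blast
    have k0: "real k > 0" using k K \<epsilon> by (smt (verit) divide_nonneg_pos)
    define i where "i = \<lfloor>real k * r\<rfloor>"
    define s where "s = real k * r - of_int i"
    have s: "\<bar>s\<bar> \<le> 1" unfolding s_def i_def by linarith
    have "g (real k * r) = of_int i * g 1 + g s"
      using add[of "of_int i" s] int[of i] by (simp add: s_def)
    then have "of_nat k * (g r - r * g 1) = g s - s * g 1"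
      using nat[of k r] by (simp add: s_def algebra_simps)
    then have "real k * cmod (g r - r * g 1) = cmod (g s - s * g 1)"
      by (metis norm_mult norm_of_nat)
    also have "\<dots> \<le> cmod (g s) + cmod (s * g 1)" by (rule norm_triangle_ineq4)
    also have "\<dots> \<le> K * \<bar>s\<bar> + \<bar>s\<bar> * (K * \<bar>1\<bar>)"
      unfolding norm_mult norm_of_real by (intro add_mono b mult_left_mono abs_ge_zero)
    also have "\<dots> = 2 * (K * \<bar>s\<bar>)" by simp
    also have "\<dots> \<le> 2 * K" using mult_left_mono[OF s K] by simp
    finally have "cmod (g r - r * g 1) \<le> 2 * K / k" using k0 by (simp add: field_simps)
    also have "\<dots> \<le> \<epsilon>" using k k0 \<epsilon> by (simp add: field_simps)
    finally show ?thesis .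
  qed
  then have "cmod (g r - r * g 1) \<le> 0" by (rule field_le_epsilon[of _ 0, simplified])
  then show ?thesis by simp
qed

lemma tangent_scaleR:
  assumes T: "tangent T" and v: "v \<in> X"
  shows "T (r *\<^sub>R v) = r *\<^sub>R T v"
proof
  fix y
  show "T (r *\<^sub>R v) y = (r *\<^sub>R T v) y"
  proof (cases "y \<in> Y")
    case True
    have "T (r *\<^sub>R v) y = r * T (1 *\<^sub>R v) y"
    proof (rule additive_bounded_homogeneous[where K = "L * norm y * norm v"])
      show "T ((r + s) *\<^sub>R v) y = T (r *\<^sub>R v) y + T (s *\<^sub>R v) y" for r s
        using T X_closed(2)[OF v] True by (simp add: tangent_def scaleR_add_left)
      show "cmod (T (r *\<^sub>R v) y) \<le> L * norm y * norm v * \<bar>r\<bar>" for r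
        using averaged_bound[of T "r *\<^sub>R v" y] T X_closed(2)[OF v] True by (simp add: tangent_def mult_ac)
    qed
    then show ?thesis by (simp add: scaleR_fun_def scaleR_conv_of_real)
  next
    case False
    then show ?thesis using T by (simp add: tangent_def scaleR_fun_def)
  qed
qed

lemma tangent_add:
  assumes T: "tangent T" and uv: "u \<in> X" "v \<in> X"
  shows "T (u + v) = T u + T v"
proof
  fix y
  show "T (u + v) y = (T u + T v) y"
    using T uv by (cases "y \<in> Y") (auto simp: tangent_def)
qed

end

section \<open>Improving a tangent map at one matrix\<close>

lemma box_avg_in_subspace:
  assumes X: "subspace X" and B: "box_in X B" and S: "subspace S" and k: "\<And>z. z \<in> X \<Longrightarrow> k z \<in> S" and x: "x \<in> X"
  shows "box_avg B k x \<in> S"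
  using B x
proof (induction B arbitrary: x)
  case (Cons p B)
  obtain e a where p: "p = (e, a)" by (cases p)
  have "x + real b *\<^sub>R e \<in> X" for b using Cons.prems p by (auto intro!: subspace_add[OF X] subspace_scale[OF X])
  then show ?case using Cons by (auto simp: p avg_def intro!: subspace_scale[OF S] subspace_sum[OF S])
qed (simp add: k)

lemma box_avg_rescale:
  "box_avg B (\<lambda>z. F (x + t *\<^sub>R z)) z0 = box_avg (map (\<lambda>(e, a). (t *\<^sub>R e, a)) B) F (x + t *\<^sub>R z0)"
proof (induction B arbitrary: z0)
  case (Cons p B)
  obtain e a where p: "p = (e, a)" by (cases p)
  show ?case by (simp add: p avg_def Cons.IH scaleR_add_right add.assoc mult.commute)
qed simp

lemma box_mesh_map_scale: "t \<ge> 0 \<Longrightarrow> box_mesh (map (\<lambda>(e, a). (t *\<^sub>R e, a)) B) = t * box_mesh B"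
proof (induction B)
  case (Cons p B)
  then show ?case by (cases p) (simp add: algebra_simps)
qed simp

lemma box_mesh_map_const: "box_mesh (map (\<lambda>e. (e, a)) xs) = (\<Sum>x\<leftarrow>xs. norm x)"
  by (induction xs) auto

lemma box_size_map_const: "box_size (map (\<lambda>e. (r *\<^sub>R e, a)) xs) = real a * \<bar>r\<bar> * (\<Sum>x\<leftarrow>xs. norm x)"
  by (induction xs) (auto simp: algebra_simps)

lemma ex_nat_divide_le:
  fixes c :: real
  assumes "\<eta> > 0"
  obtains m :: nat where "m \<ge> 1" "c / m \<le> \<eta>"
proof -
  obtain m :: nat where m: "real m > max 1 (c / \<eta>)" using reals_Archimedean2 by blast
  then have "m \<ge> 1" by simp
  moreover have "c / m \<le> \<eta>" using m assms by (simp add: field_simps)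
  ultimately show thesis by (rule that)
qed

context lipschitz_into_dual
begin

text \<open>For a tangent map all summands agree on \<open>Y\<close>, so that \<open>box_diff\<close> leaves the values of weak-star
  continuous functionals unchanged (\<open>box_diff_tangent\<close>), whereas for a difference quotient at scale
  \<open>t\<close> it averages the short difference quotients over a box (\<open>box_diff_quot_apply\<close>). In this way a
  tangent map yields one box of base points at which \<open>f\<close> behaves like it.\<close>

definition box_diff :: "('x \<times> nat) list \<Rightarrow> ('x \<Rightarrow> ('k \<Rightarrow>\<^sub>L 'k) \<Rightarrow> complex) \<Rightarrow> 'x \<Rightarrow> ('k \<Rightarrow>\<^sub>L 'k) \<Rightarrow> complex"
  where "box_diff B h = box_avg B (\<lambda>z w. h (z + w) - h z) 0"

lemma linear_eval: "linear (\<lambda>h :: 'x \<Rightarrow> ('k \<Rightarrow>\<^sub>L 'k) \<Rightarrow> complex. h w y)"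
  by (rule linearI) (auto simp: scaleR_fun_def)

lemma box_diff_apply: "box_diff B h w y = box_avg B (\<lambda>z. h (z + w) y - h z y) 0"
  unfolding box_diff_def
  using box_avg_linear[OF linear_eval[of w y], of B "\<lambda>z w. h (z + w) - h z" 0] by simp

lemma box_diff_in_span:
  assumes \<Phi>: "\<Phi> \<in> span evals" and B: "box_in X B"
  shows "(\<lambda>h. \<Phi> (box_diff B h)) \<in> span evals"
  using \<Phi>
proof (induction rule: span_induct_alt)
  case base
  have "(\<lambda>h. 0 (box_diff B h)) = (0 :: ('x \<Rightarrow> ('k \<Rightarrow>\<^sub>L 'k) \<Rightarrow> complex) \<Rightarrow> real)" by (rule ext) simp
  then show ?case by (simp only: span_zero)
next
  case (step c \<Psi> \<Phi>)
  have ev: "linear (\<lambda>\<Theta> :: ('x \<Rightarrow> ('k \<Rightarrow>\<^sub>L 'k) \<Rightarrow> complex) \<Rightarrow> real. \<Theta> h)" for h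
    by (rule linearI) (auto simp: scaleR_fun_def)
  have key: "(\<lambda>h. \<rho> (box_diff B h w y)) \<in> span evals"
    if \<rho>: "linear \<rho>" "\<And>v. v \<in> X \<Longrightarrow> (\<lambda>h. \<rho> (h v y)) \<in> span evals" and w: "w \<in> X" for \<rho> :: "complex \<Rightarrow> real" and w y
  proof -
    let ?k = "\<lambda>z. (\<lambda>h. \<rho> (h (z + w) y)) - (\<lambda>h. \<rho> (h z y))"
    have "(\<lambda>h. \<rho> (box_diff B h w y)) = box_avg B ?k 0"
    proof
      fix h
      have "\<rho> (box_diff B h w y) = box_avg B (\<lambda>z. \<rho> (h (z + w) y - h z y)) 0"
        unfolding box_diff_apply by (rule box_avg_linear[OF \<rho>(1), symmetric])
      also have "\<dots> = box_avg B (\<lambda>z. ?k z h) 0" by (simp add: linear_diff[OF \<rho>(1)])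
      also have "\<dots> = box_avg B ?k 0 h" by (rule box_avg_linear[OF ev])
      finally show "\<rho> (box_diff B h w y) = box_avg B ?k 0 h" .
    qed
    moreover have "box_avg B ?k 0 \<in> span evals"
      by (rule box_avg_in_subspace[OF X B subspace_span _ subspace_0[OF X]]) (intro span_diff \<rho>(2) X_closed w)
    ultimately show ?thesis by simp
  qed
  obtain w y where wy: "w \<in> X" "y \<in> Y" "\<Psi> = (\<lambda>h. Re (h w y)) \<or> \<Psi> = (\<lambda>h. Im (h w y))"
    using step(1) by (auto simp: evals_def)
  have "linear Re" "linear Im" by (rule linearI; simp)+
  with wy have "(\<lambda>h. \<Psi> (box_diff B h)) \<in> span evals"
    using key[of Re y w, OF _ Re_eval_in_span] key[of Im y w, OF _ Im_eval_in_span] by auto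
  then have "c *\<^sub>R (\<lambda>h. \<Psi> (box_diff B h)) + (\<lambda>h. \<Phi> (box_diff B h)) \<in> span evals"
    by (intro span_add span_scale step(2))
  moreover have "(\<lambda>h. (c *\<^sub>R \<Psi> + \<Phi>) (box_diff B h)) = c *\<^sub>R (\<lambda>h. \<Psi> (box_diff B h)) + (\<lambda>h. \<Phi> (box_diff B h))"
    by (rule ext) (simp add: scaleR_fun_apply)
  ultimately show ?case by simp
qed

lemma box_diff_tangent:
  assumes T: "tangent T" and \<Phi>: "\<Phi> \<in> span evals" and B: "box_in X B"
  shows "\<Phi> (box_diff B T) = \<Phi> T"
proof -
  obtain ws C where ws: "set ws \<subseteq> X" "C \<ge> 0" "\<And>h k \<epsilon>. \<epsilon> \<ge> 0 \<Longrightarrow>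
      (\<And>w y. w \<in> set ws \<Longrightarrow> y \<in> Y \<Longrightarrow> cmod (h w y - k w y) \<le> \<epsilon> * norm y) \<Longrightarrow> \<bar>\<Phi> h - \<Phi> k\<bar> \<le> C * \<epsilon>"
    by (rule span_evals_continuous[OF \<Phi>]) blast
  have "\<bar>\<Phi> (box_diff B T) - \<Phi> T\<bar> \<le> C * 0"
  proof (rule ws(3))
    fix w y assume w: "w \<in> set ws" and y: "y \<in> Y"
    have "box_avg B (\<lambda>z. T (z + w) y - T z y) 0 = box_avg B (\<lambda>_. T w y) 0"
      by (rule box_avg_cong[OF X B _ subspace_0[OF X]]) (use T w y ws(1) in \<open>auto simp: tangent_def\<close>)
    then show "cmod (box_diff B T w y - T w y) \<le> 0 * norm y"
      by (simp add: box_diff_apply box_avg_const[OF B])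
  qed simp
  then show ?thesis by simp
qed

lemma box_avg_quot_apply:
  "box_avg B (\<lambda>z. quot z \<tau>) x w y = (1 / \<tau>) *\<^sub>R box_avg B (\<lambda>z. f (z + \<tau> *\<^sub>R w) y - f z y) x"
proof -
  have "box_avg B (\<lambda>z. quot z \<tau>) x w y = box_avg B (\<lambda>z. quot z \<tau> w y) x"
    by (rule box_avg_linear[OF linear_eval, symmetric])
  also have "(\<lambda>z. quot z \<tau> w y) = (\<lambda>z. (1 / \<tau>) *\<^sub>R (f (z + \<tau> *\<^sub>R w) y - f z y))"
    by (rule ext) (simp add: quot_def scaleR_fun_apply)
  finally show ?thesis by (simp only: box_avg_scaleR)
qed

lemma box_diff_quot_apply:
  "box_diff B (quot x t) w y = (1 / t) *\<^sub>R box_avg (map (\<lambda>(e, a). (t *\<^sub>R e, a)) B) (\<lambda>z. f (z + t *\<^sub>R w) y - f z y) x"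
proof -
  have "(\<lambda>z. quot x t (z + w) y - quot x t z y) = (\<lambda>z. (1 / t) *\<^sub>R (f ((x + t *\<^sub>R z) + t *\<^sub>R w) y - f (x + t *\<^sub>R z) y))"
    by (rule ext) (simp add: quot_def scaleR_fun_apply scaleR_add_right add.assoc flip: scaleR_diff_right)
  then have "box_diff B (quot x t) w y = (1 / t) *\<^sub>R box_avg B (\<lambda>z. f ((x + t *\<^sub>R z) + t *\<^sub>R w) y - f (x + t *\<^sub>R z) y) 0"
    unfolding box_diff_apply by (simp only: box_avg_scaleR)
  also have "box_avg B (\<lambda>z. f ((x + t *\<^sub>R z) + t *\<^sub>R w) y - f (x + t *\<^sub>R z) y) 0
      = box_avg (map (\<lambda>(e, a). (t *\<^sub>R e, a)) B) (\<lambda>z. f (z + t *\<^sub>R w) y - f z y) x"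
    using box_avg_rescale[of B "\<lambda>z. f (z + t *\<^sub>R w) y - f z y" x t 0] by simp
  finally show ?thesis .
qed

text \<open>The defect of additivity in \<open>u\<close> is a difference of translates by \<open>\<tau> u\<close>, hence small if the box is
  long in that direction.\<close>

lemma box_avg_quot_additive_error:
  assumes B: "box_in X B" and x: "x \<in> X" and \<tau>: "\<tau> > 0" and u: "(\<tau> *\<^sub>R u, a) \<in> set B" "u \<in> X" and v: "v \<in> X" and y: "y \<in> Y"
  shows "cmod (box_avg B (\<lambda>z. quot z \<tau>) x (u + v) y - box_avg B (\<lambda>z. quot z \<tau>) x u y - box_avg B (\<lambda>z. quot z \<tau>) x v y)
    \<le> 2 * (L * norm y * norm v) / a"
proof -
  define h where "h z = quot z \<tau> v y" for z
  have ev: "box_avg B (\<lambda>z. quot z \<tau>) x w y = box_avg B (\<lambda>z. quot z \<tau> w y) x" for w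
    by (rule box_avg_linear[OF linear_eval, symmetric])
  have "box_avg B (\<lambda>z. quot z \<tau>) x (u + v) y - box_avg B (\<lambda>z. quot z \<tau>) x u y - box_avg B (\<lambda>z. quot z \<tau>) x v y
    = box_avg B (\<lambda>z. quot z \<tau> (u + v) y - quot z \<tau> u y - quot z \<tau> v y) x"
    by (simp only: ev box_avg_diff)
  also have "(\<lambda>z. quot z \<tau> (u + v) y - quot z \<tau> u y - quot z \<tau> v y) = (\<lambda>z. h (z + \<tau> *\<^sub>R u) - h z)"
    by (rule ext) (simp add: h_def quot_apply scaleR_add_right add.assoc diff_divide_distrib)
  also have "cmod (box_avg B (\<lambda>z. h (z + \<tau> *\<^sub>R u) - h z) x) \<le> 2 * (L * norm y * norm v) / a"
    by (rule box_avg_difference_le[OF X B _ x u(1)]) (simp add: h_def quot_bound \<tau> v y)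
  finally show ?thesis .
qed

definition directions :: "'x set \<Rightarrow> 'x list"
  where "directions F = (if finite F then SOME l. set l = F \<inter> X else [])"

lemma set_directions: "finite F \<Longrightarrow> set (directions F) = F \<inter> X"
proof -
  assume F: "finite F"
  have "\<exists>l. set l = F \<inter> X" using F by (intro finite_list) auto
  from someI_ex[OF this] F show ?thesis by (simp add: directions_def)
qed

lemma set_directions_subset: "set (directions F) \<subseteq> X"
  using set_directions[of F] by (cases "finite F") (auto simp: directions_def)

text \<open>If the boxes are eventually long in every given direction, the limit of the averages is additive.
  The index runs through the finite sets of directions together with a length.\<close>

lemma tangent_limit_of_boxes:
  fixes B :: "'x set \<times> nat \<Rightarrow> ('x \<times> nat) list" and \<tau> :: "'x set \<times> nat \<Rightarrow> real"
  assumes B: "\<And>i. box_in X (B i)" and \<tau>: "\<And>i. \<tau> i > 0" and x: "x \<in> X"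
    and mem: "\<And>F k u. u \<in> set (directions F) \<Longrightarrow> (\<tau> (F, k) *\<^sub>R u, Suc k) \<in> set (B (F, k))"
  obtains \<F> \<Lambda> where "generalised_limit \<F> \<Lambda>"
    "tangent (limit_map \<Lambda> (\<lambda>i. box_avg (B i) (\<lambda>z. quot z (\<tau> i)) x))"
proof -
  define U where "U i = box_avg (B i) (\<lambda>z. quot z (\<tau> i)) x" for i
  have U_avg: "averaged (U i)" for i
    unfolding U_def by (rule averaged_box_avg[OF B x \<tau>])
  define \<F> where "\<F> = finite_subsets_at_top (UNIV :: 'x set) \<times>\<^sub>F (sequentially :: nat filter)"
  have "\<F> \<noteq> bot" by (simp add: \<F>_def prod_filter_eq_bot)
  then obtain \<Lambda> where \<Lambda>: "generalised_limit \<F> \<Lambda>" by (rule generalised_limit_exists)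
  have "tangent (limit_map \<Lambda> U)"
  proof (rule tangent_limit_map[OF \<Lambda> U_avg])
    fix u v y and \<epsilon> :: real assume u: "u \<in> X" and v: "v \<in> X" and y: "y \<in> Y" and \<epsilon>: "\<epsilon> > 0"
    obtain k0 :: nat where k0: "k0 \<ge> 1" "2 * (L * norm y * norm v) / k0 \<le> \<epsilon>"
      using ex_nat_divide_le[OF \<epsilon>] by blast
    have ev: "eventually (\<lambda>F. finite F \<and> u \<in> F) (finite_subsets_at_top UNIV)"
      unfolding eventually_finite_subsets_at_top by (intro exI[of _ "{u}"]) auto
    have "eventually (\<lambda>i. (finite (fst i) \<and> u \<in> fst i) \<and> k0 \<le> snd i) \<F>"
      unfolding \<F>_def eventually_prod_filter using ev eventually_ge_at_top[of k0]
      by (intro exI[of _ "\<lambda>F. finite F \<and> u \<in> F"] exI[of _ "\<lambda>k. k0 \<le> k"]) auto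
    then show "eventually (\<lambda>i. cmod (U i (u + v) y - U i u y - U i v y) \<le> \<epsilon>) \<F>"
    proof (rule eventually_mono)
      fix i assume i: "(finite (fst i) \<and> u \<in> fst i) \<and> k0 \<le> snd i"
      have "(\<tau> i *\<^sub>R u, Suc (snd i)) \<in> set (B i)"
        using i mem[of u "fst i" "snd i"] set_directions[of "fst i"] u by simp
      then have "cmod (U i (u + v) y - U i u y - U i v y) \<le> 2 * (L * norm y * norm v) / Suc (snd i)"
        unfolding U_def by (intro box_avg_quot_additive_error[OF B x \<tau> _ u v y])
      also have "\<dots> \<le> 2 * (L * norm y * norm v) / k0"
        using i k0(1) L by (intro divide_left_mono) auto
      also have "\<dots> \<le> \<epsilon>" by (rule k0(2))
      finally show "cmod (U i (u + v) y - U i u y - U i v y) \<le> \<epsilon>" .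
    qed
  qed
  with \<Lambda> show thesis unfolding U_def by (rule that)
qed

lemma tangent_exists: "\<exists>T. tangent T"
proof -
  define B where "B i = map (\<lambda>u. (1 *\<^sub>R u, Suc (snd i))) (directions (fst i))" for i :: "'x set \<times> nat"
  have a: "box_in X (B i)" for i
    using set_directions_subset by (auto simp: B_def box_in_def)
  have m: "(1 *\<^sub>R u, Suc k) \<in> set (B (F, k))" if "u \<in> set (directions F)" for F k u
    using that by (simp add: B_def)
  show ?thesis
  proof (rule tangent_limit_of_boxes[where B = B and \<tau> = "\<lambda>_. 1" and x = 0])
    show "box_in X (B i)" for i by (rule a)
    show "(0::real) < 1" by simp
    show "0 \<in> X" by (rule subspace_0[OF X])
    show "(1 *\<^sub>R u, Suc k) \<in> set (B (F, k))" if "u \<in> set (directions F)" for F k u by (rule m[OF that])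
  qed blast
qed

end

text \<open>In addition, averages over cubes with \<open>n * n\<close> directions and \<open>Q\<close> points on each side keep a lower
  bound at level \<open>n\<close>; the number of directions is that of the entries of one matrix.\<close>

locale amplified_lipschitz_into_dual = lipschitz_into_dual X Y f L
  for X :: "('h::complex_hilbert \<Rightarrow>\<^sub>L 'h) set" and Y :: "('k::complex_hilbert \<Rightarrow>\<^sub>L 'k) set" and f L +
  fixes n Q :: nat and c :: real
  assumes Q: "Q \<ge> 1"
    and upper: "amp_upper X Y n L f"
    and lower: "\<And>vs. set vs \<subseteq> X \<Longrightarrow> length vs = n * n \<Longrightarrow> amp_lower X Y n c (box_avg (map (\<lambda>e. (e, Q)) vs) f)"
begin

text \<open>Take a box that is long in the entries of \<open>V\<close> (\<open>Q * m\<close> steps) and short (\<open>m'\<close> steps, but many)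
  in the directions \<open>ws\<close> seen by \<open>\<Phi>\<close>, and place it where \<open>\<Phi>\<close> is almost as large as at \<open>T\<close>. Refining it
  and adding ever more directions with ever shorter sides leads to a tangent map \<open>T'\<close>. For \<open>\<Phi>\<close>, the
  average over the box is changed only by an amount of order $1/m'$. For \<open>V\<close>, the same average is close
  to one over a coarse cube with \<open>Q\<close> points on each side, because \<open>m\<close> is so large compared with \<open>m'\<close> that
  the remaining directions are negligible at the scale \<open>m * t\<close> of the cube; there the lower bound of the
  locale applies. It is essential that \<open>Q\<close> depends on neither \<open>\<Phi>\<close> nor \<open>\<eta>\<close>.\<close>

lemma tangent_improve:
  assumes T: "tangent T" and \<Phi>: "\<Phi> \<in> span evals" and V: "\<And>i j. i < n \<Longrightarrow> j < n \<Longrightarrow> V i j \<in> X" and \<eta>: "\<eta> > 0"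
  shows "\<exists>T'. tangent T' \<and> \<Phi> T - \<eta> \<le> \<Phi> T' \<and>
    c * op_mnorm n V - real n * real n * (2 * L / Q * (\<Sum>i<n. \<Sum>j<n. norm (V i j))) - \<eta>
      \<le> dual_mnorm Y n (\<lambda>i j. T' (V i j))"
proof -
  obtain ws C where ws: "set ws \<subseteq> X" "C \<ge> 0" and \<Phi>C: "\<And>h k \<epsilon>. \<epsilon> \<ge> 0 \<Longrightarrow>
      (\<And>w y. w \<in> set ws \<Longrightarrow> y \<in> Y \<Longrightarrow> cmod (h w y - k w y) \<le> \<epsilon> * norm y) \<Longrightarrow> \<bar>\<Phi> h - \<Phi> k\<bar> \<le> C * \<epsilon>"
    by (rule span_evals_continuous[OF \<Phi>]) blast
  define vs where "vs = map (\<lambda>p. V (p mod n) (p div n)) [0..<n * n]"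
  have n0: "n > 0" if "p < n * n" for p using that by (cases "n = 0") auto
  have vsX: "set vs \<subseteq> X"
    using V n0 by (auto simp: vs_def less_mult_imp_div_less intro!: V)
  have vs_len: "length vs = n * n" by (simp add: vs_def)
  have V_mem: "V i j \<in> set vs" if "i < n" "j < n" for i j
  proof -
    have "j * n + i < n * n"
    proof -
      have "j * n + i < Suc j * n" using that by simp
      also have "\<dots> \<le> n * n" using that by (intro mult_le_mono1) simp
      finally show ?thesis .
    qed
    moreover have "V i j = V ((j * n + i) mod n) ((j * n + i) div n)" using that by simp
    ultimately show ?thesis unfolding vs_def by (auto intro!: image_eqI[of _ _ "j * n + i"])
  qed
  define sV where "sV = (\<Sum>v\<leftarrow>vs. norm v)"
  define sW where "sW = (\<Sum>w\<leftarrow>ws. norm w)"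
  have sV: "sV = (\<Sum>i<n. \<Sum>j<n. norm (V i j))"
  proof -
    have "sV = (\<Sum>p<n * n. norm (V (p mod n) (p div n)))"
      unfolding sV_def vs_def by (simp add: comp_def interv_sum_list_conv_sum_set_nat atLeast0LessThan)
    also have "\<dots> = (\<Sum>i<n. \<Sum>j<n. norm (V i j))" by (rule sum_mod_div)
    finally show ?thesis .
  qed
  have s0: "sV \<ge> 0" "sW \<ge> 0" unfolding sV_def sW_def by (rule sum_list_nonneg; auto)+
  \<comment> \<open>The lengths \<open>m'\<close> and then \<open>m\<close> make all comparison errors at most of order \<open>\<eta>\<close>, except for the one of order
    $1/Q$ that the conclusion displays.\<close>
  obtain m' :: nat where m': "m' \<ge> 1" "C * (2 * L * (sV + sW + 1)) / m' \<le> \<eta> / 2"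
    using ex_nat_divide_le[of "\<eta> / 2"] \<eta> by (metis half_gt_zero)
  obtain m :: nat where m: "m \<ge> 1" "(real n * real n * (2 * L / Q) * (m' * sW + 1)) / m \<le> \<eta>"
    using ex_nat_divide_le[OF \<eta>] by blast
  define B0 where "B0 = map (\<lambda>v. (v, Q * m)) vs @ map (\<lambda>w. (w, m')) ws"
  have B0: "box_in X B0" using vsX ws m(1) m'(1) Q by (auto simp: B0_def box_in_def)
  have "\<exists>x\<in>X. \<exists>t>0. \<Phi> (box_diff B0 (quot x t)) > \<Phi> T - \<eta> / 2"
  proof (rule ccontr)
    assume "\<not> ?thesis"
    then have le: "\<Phi> (box_diff B0 (quot x t)) \<le> \<Phi> T - \<eta> / 2" if "x \<in> X" "t > 0" for x t
      using that by (meson not_le)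
    have "averaged T" using T by (simp add: tangent_def)
    from averaged_le[OF this box_diff_in_span[OF \<Phi> B0] le]
    have "\<Phi> (box_diff B0 T) \<le> \<Phi> T - \<eta> / 2" .
    then show False using box_diff_tangent[OF T \<Phi> B0] \<eta> by simp
  qed
  then obtain x t where x: "x \<in> X" and t: "t > 0" and xt: "\<Phi> (box_diff B0 (quot x t)) > \<Phi> T - \<eta> / 2" by blast
  define B where "B = map (\<lambda>(e, a). (t *\<^sub>R e, a)) B0"
  have BX: "box_in X B" using B0 X_closed(2) by (auto simp: B_def box_in_def)
  have B_mesh: "box_mesh B = t * (sV + sW)"
    using t by (simp add: B_def box_mesh_map_scale) (simp add: B0_def box_mesh_map_const sV_def sW_def)
  \<comment> \<open>The sides in the additional directions \<open>directions F\<close> have \<open>Suc k\<close> steps; dividing the steps by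
    \<open>M\<close> keeps the total length of these sides below \<open>t\<close>, whatever \<open>F\<close> is.\<close>
  define sF where "sF F = nat \<lceil>1 + (\<Sum>g\<leftarrow>directions F. norm g)\<rceil>" for F
  have gl0: "(\<Sum>g\<leftarrow>directions F. norm g) \<ge> 0" for F by (rule sum_list_nonneg) auto
  have sF: "sF F \<ge> 1" "(\<Sum>g\<leftarrow>directions F. norm g) \<le> sF F" for F
    using gl0[of F] unfolding sF_def by linarith+
  define M where "M i = Suc (snd i) * Suc (snd i) * sF (fst i)" for i
  have M: "M i \<ge> 1" for i using sF(1)[of "fst i"] by (simp add: M_def)
  define Ci where "Ci i = map (\<lambda>g. ((t / M i) *\<^sub>R g, Suc (snd i))) (directions (fst i))" for i
  have CiX: "box_in X (Ci i)" for i
    using set_directions_subset[of "fst i"] X_closed(2) by (auto simp: Ci_def box_in_def)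
  have Ci_size: "box_size (Ci i) \<le> t" for i
  proof -
    define a b where "a = real (Suc (snd i))" and "b = real (sF (fst i))"
    have ab: "a \<ge> 1" "b \<ge> 1" using sF(1)[of "fst i"] by (simp_all add: a_def b_def)
    have Mab: "real (M i) = a * a * b" unfolding M_def a_def b_def by (simp only: of_nat_mult)
    have "box_size (Ci i) = a * (t / M i) * (\<Sum>g\<leftarrow>directions (fst i). norm g)"
      unfolding Ci_def box_size_map_const a_def using t by simp
    also have "\<dots> \<le> a * (t / M i) * b"
      using t sF(2) ab unfolding b_def by (intro mult_left_mono) auto
    also have "\<dots> = t / a" unfolding Mab using ab by (simp add: field_simps)
    also have "\<dots> \<le> t" using t ab by (simp add: field_simps)
    finally show ?thesis .
  qed
  define U where "U i = box_avg (refine (M i) B @ Ci i) (\<lambda>z. quot z (t / M i)) x" for i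
  have box_i: "box_in X (refine (M i) B @ Ci i)" for i
    using box_in_refine[OF X M BX] CiX by simp
  have \<tau>: "t / M i > 0" for i using t M[of i] by simp
  have U_avg: "averaged (U i)" for i
    unfolding U_def by (rule averaged_box_avg[OF box_i x \<tau>])
  have U_apply: "U i w y = (1 / t) *\<^sub>R (real (M i) *\<^sub>R box_avg (refine (M i) B @ Ci i) (\<lambda>z. f (z + (1 / real (M i)) *\<^sub>R t *\<^sub>R w) y - f z y) x)" for i w y
    unfolding U_def box_avg_quot_apply by simp
  \<comment> \<open>Here the refined box is compared with \<open>B\<close> itself.\<close>
  have est1: "cmod (U i w y - box_diff B0 (quot x t) w y) \<le> 2 * L / m' * (sV + sW + 1) * norm y"
    if w: "w \<in> set ws" and y: "y \<in> Y" for i w y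
  proof -
    let ?P = "real (M i) *\<^sub>R box_avg (refine (M i) B @ Ci i) (\<lambda>z. f (z + (1 / real (M i)) *\<^sub>R t *\<^sub>R w) y - f z y) x"
      and ?P' = "box_avg B (\<lambda>z. f (z + t *\<^sub>R w) y - f z y) x"
    have "cmod (?P - ?P') \<le> 2 * (L * norm y) / m' * (box_mesh B + box_size (Ci i))"
    proof (rule box_avg_refine_error[OF X BX CiX _ M _ x])
      show "(t *\<^sub>R w, m') \<in> set B" using w by (force simp: B_def B0_def)
    qed (use L y lip in auto)
    also have "\<dots> \<le> 2 * (L * norm y) / m' * (t * (sV + sW) + t)"
      using L Ci_size by (intro mult_left_mono) (auto simp: B_mesh)
    also have "\<dots> = t * (2 * L / m' * (sV + sW + 1) * norm y)" by (simp add: algebra_simps)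
    finally have e: "cmod (?P - ?P') \<le> t * (2 * L / m' * (sV + sW + 1) * norm y)" .
    show ?thesis
      unfolding U_apply box_diff_quot_apply B_def[symmetric] scaleR_diff_right[symmetric] norm_scaleR
      using e t by (simp add: divide_le_eq mult.commute)
  qed
  \<comment> \<open>The same points, seen as a refinement of the coarse cube \<open>B1\<close> by the factor \<open>m * M i\<close>, with all
    directions outside \<open>V\<close> moved to the second box.\<close>
  define B1 where "B1 = map (\<lambda>v. ((m * t) *\<^sub>R v, Q)) vs"
  have B1X: "box_in X B1" using vsX X_closed(2) Q by (auto simp: B1_def box_in_def)
  define E where "E i = map (\<lambda>w. ((t / M i) *\<^sub>R w, m' * M i)) ws" for i
  have EX: "box_in X (E i)" for i
    using ws(1) X_closed(2) m'(1) M[of i] by (auto simp: E_def box_in_def)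
  have list_eq: "refine (M i) B @ Ci i = refine (m * M i) B1 @ (E i @ Ci i)" for i
    using m(1) M[of i] by (simp add: B_def B0_def B1_def E_def refine_def comp_def)
  define G where "G = box_avg B1 f"
  have est2: "cmod (U i v y - ((1 / (m * t)) *\<^sub>R (G (x + (m * t) *\<^sub>R v) - G x)) y) \<le> 2 * L / Q * (sV + (m' * sW + 1) / m) * norm y"
    if v: "v \<in> set vs" and y: "y \<in> Y" for i v y
  proof -
    let ?P = "real (m * M i) *\<^sub>R box_avg (refine (m * M i) B1 @ (E i @ Ci i)) (\<lambda>z. f (z + (1 / real (m * M i)) *\<^sub>R (m * t) *\<^sub>R v) y - f z y) x"
      and ?P' = "box_avg B1 (\<lambda>z. f (z + (m * t) *\<^sub>R v) y - f z y) x"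
    have mM: "m * M i \<ge> 1" using m(1) M[of i] by simp
    have Geq: "(G (x + (m * t) *\<^sub>R v) - G x) y = ?P'"
    proof -
      have l: "linear (\<lambda>h :: ('k \<Rightarrow>\<^sub>L 'k) \<Rightarrow> complex. h y)" by (rule linearI) (auto simp: scaleR_fun_def)
      have "G x' y = box_avg B1 (\<lambda>z. f z y) x'" for x'
        unfolding G_def by (rule box_avg_linear[OF l, symmetric])
      then show ?thesis by (simp add: box_avg_diff box_avg_shift[of B1 "\<lambda>z. f z y"])
    qed
    have "cmod (?P - ?P') \<le> 2 * (L * norm y) / Q * (box_mesh B1 + box_size (E i @ Ci i))"
    proof (rule box_avg_refine_error[OF X B1X _ _ mM _ x])
      show "((m * t) *\<^sub>R v, Q) \<in> set B1" using v by (force simp: B1_def)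
    qed (use L y lip EX CiX in auto)
    also have "\<dots> \<le> 2 * (L * norm y) / Q * (m * t * sV + (m' * t * sW + t))"
    proof -
      have "box_mesh B1 = m * t * sV"
        using box_mesh_map_scale[of "m * t" "map (\<lambda>v. (v, Q)) vs"] t
        by (simp add: B1_def comp_def box_mesh_map_const sV_def)
      moreover have "box_size (E i) = m' * t * sW"
        unfolding E_def box_size_map_const using t M[of i] by (simp add: sW_def)
      ultimately show ?thesis using L Ci_size[of i] by (intro mult_left_mono) auto
    qed
    also have "m * t * sV + (m' * t * sW + t) = (m * t) * (sV + (m' * sW + 1) / m)"
    proof -
      have "real m \<noteq> 0" using m(1) by simp
      then show ?thesis by (simp add: field_simps)
    qed
    also have "2 * (L * norm y) / Q * ((m * t) * (sV + (m' * sW + 1) / m)) = (m * t) * (2 * L / Q * (sV + (m' * sW + 1) / m) * norm y)"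
      by simp
    finally have e: "cmod (?P - ?P') \<le> (m * t) * (2 * L / Q * (sV + (m' * sW + 1) / m) * norm y)" .
    have U: "U i v y = (1 / (m * t)) *\<^sub>R (?P)"
      unfolding U_apply list_eq using m(1) by simp
    show ?thesis
      unfolding U scaleR_fun_apply Geq scaleR_diff_right[symmetric] norm_scaleR
      using e t m(1) by (simp add: divide_le_eq mult.commute)
  qed
  have "((t / M (F, k)) *\<^sub>R u, Suc k) \<in> set (refine (M (F, k)) B @ Ci (F, k))"
    if "u \<in> set (directions F)" for F k u
    using that by (auto simp: Ci_def)
  then obtain \<F> \<Lambda> where \<Lambda>: "generalised_limit \<F> \<Lambda>" and tan: "tangent (limit_map \<Lambda> U)"
    unfolding U_def by (rule tangent_limit_of_boxes[OF box_i \<tau> x])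
  define T' where "T' = limit_map \<Lambda> U"
  have T': "tangent T'" unfolding T'_def by (rule tan)
  have "\<bar>\<Phi> T' - \<Phi> (box_diff B0 (quot x t))\<bar> \<le> C * (2 * L / m' * (sV + sW + 1))"
  proof (rule \<Phi>C)
    fix w y assume w: "w \<in> set ws" and y: "y \<in> Y"
    then show "cmod (T' w y - box_diff B0 (quot x t) w y) \<le> 2 * L / m' * (sV + sW + 1) * norm y"
      unfolding T'_def by (intro limit_map_dist_le[OF \<Lambda> U_avg] always_eventually allI est1) (use ws in auto)
  qed (use L s0 in auto)
  also have "\<dots> \<le> \<eta> / 2" using m'(2) by simp
  finally have "\<Phi> T - \<eta> \<le> \<Phi> T'" using xt by linarith
  moreover have "c * op_mnorm n V - real n * real n * (2 * L / Q * (\<Sum>i<n. \<Sum>j<n. norm (V i j))) - \<eta>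
      \<le> dual_mnorm Y n (\<lambda>i j. T' (V i j))"
  proof -
    define r where "r = 1 / (m * t)"
    have r: "r > 0" using m(1) t by (simp add: r_def)
    define W where "W i j = r *\<^sub>R (G (x + (m * t) *\<^sub>R V i j) - G x)" for i j
    have Gd: "G \<in> X \<rightarrow> dual_space Y"
      unfolding G_def by (rule box_avg_in_dual_space[OF X Y_sub B1X f])
    have GV: "G (x + (m * t) *\<^sub>R V i j) - G x \<in> dual_space Y" if "i < n" "j < n" for i j
      by (intro dual_space_diff Y_sub) (use Gd x V[OF that] X_closed in auto)
    have Wd: "W i j \<in> dual_space Y" if "i < n" "j < n" for i j
      unfolding W_def by (intro dual_space_scaleR GV that)
    have low: "amp_lower X Y n c G"
      using lower[of "map (\<lambda>v. (m * t) *\<^sub>R v) vs"] vsX vs_len X_closed(2)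
      by (auto simp: G_def B1_def comp_def)
    have "c * op_mnorm n V = r * (c * op_mnorm n (\<lambda>i j. (m * t) *\<^sub>R V i j))"
      unfolding op_mnorm_scaleR using m(1) t by (simp add: r_def)
    also have "c * op_mnorm n (\<lambda>i j. (m * t) *\<^sub>R V i j) \<le> dual_mnorm Y n (\<lambda>i j. G (x + (m * t) *\<^sub>R V i j) - G x)"
      using low[unfolded amp_lower_def, rule_format, of "\<lambda>i j. x + (m * t) *\<^sub>R V i j" "\<lambda>i j. x"] x V X_closed by simp
    also have "dual_mnorm Y n (\<lambda>i j. G (x + (m * t) *\<^sub>R V i j) - G x) \<le> \<bar>1 / r\<bar> * dual_mnorm Y n W"
      using dual_mnorm_scaleR_le[where \<phi> = W and r = "1 / r", OF Y Wd] r by (simp add: W_def)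
    also have "r * (\<bar>1 / r\<bar> * dual_mnorm Y n W) = dual_mnorm Y n W" using r by simp
    also have "dual_mnorm Y n W \<le> dual_mnorm Y n (\<lambda>i j. T' (V i j)) + (\<Sum>i<n. \<Sum>j<n. 2 * L / Q * (sV + (m' * sW + 1) / m))"
    proof (rule dual_mnorm_perturb[OF Y])
      show "T' (V i j) \<in> dual_space Y" if "i < n" "j < n" for i j
        by (rule tangent_in_dual[OF T' V[OF that]])
      show "cmod (W i j y - T' (V i j) y) \<le> 2 * L / Q * (sV + (m' * sW + 1) / m) * norm y" if "i < n" "j < n" "y \<in> Y" for i j y
        unfolding T'_def W_def r_def norm_minus_commute[of _ "limit_map \<Lambda> U (V i j) y"]
        by (intro limit_map_dist_le[OF \<Lambda> U_avg] always_eventually allI est2 V V_mem that)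
    qed (use Wd L s0 in auto)
    also have "(\<Sum>i<n. \<Sum>j<n. 2 * L / Q * (sV + (m' * sW + 1) / m))
        = real n * real n * (2 * L / Q * sV) + (real n * real n * (2 * L / Q) * (m' * sW + 1)) / m"
      by (simp add: algebra_simps add_divide_distrib)
    finally have "c * op_mnorm n V \<le> dual_mnorm Y n (\<lambda>i j. T' (V i j))
        + (real n * real n * (2 * L / Q * sV) + (real n * real n * (2 * L / Q) * (m' * sW + 1)) / m)"
      using r by (simp add: mult_left_mono)
    then show ?thesis using m(2) unfolding sV[symmetric] by linarith
  qed
  ultimately show ?thesis using T' by blast
qed

end

section \<open>A variational selection principle\<close>

lemma sum_powers_le_2:
  fixes \<theta> :: real
  assumes "0 \<le> \<theta>" "\<theta> \<le> 1/2"
  shows "(\<Sum>i<n. \<theta> ^ i) \<le> 2"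
proof -
  have "(\<Sum>i<n. \<theta> ^ i) \<le> 2 - 2 * \<theta> ^ n"
  proof (induction n)
    case (Suc n)
    have "2 * \<theta> ^ Suc n \<le> \<theta> ^ n" using assms mult_right_mono[of "2 * \<theta>" 1 "\<theta> ^ n"] by simp
    with Suc show ?case by simp
  qed simp
  then show ?thesis using assms(1) by (smt (verit) zero_le_power)
qed

text \<open>Weak-star limits lose norm, unless the functionals that witness the norm are fixed before the
  limit is taken. So maximise $\sum_l \theta^{l+1} \psi_l$ successively: \<open>R l\<close> almost maximises the sum of
  the terms before \<open>l\<close>, up to an error of order $\theta^{l+2}$, and $\psi_l$ is chosen to be large at
  \<open>R l\<close>. A later \<open>R k\<close> competes with \<open>R l\<close> for a longer sum; it cannot gain more than
  $2 \theta^{l+2}$ in the earlier terms, and all later terms together are of order $\theta^{l+2}$. So it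
  may lose only a fraction of order $\theta$ in $\psi_l$.\<close>

lemma variational_selection:
  fixes \<C> :: "'t set" and \<Psi> :: "nat \<Rightarrow> ('t \<Rightarrow> real) set" and S :: "('t \<Rightarrow> real) set" and \<kappa> :: "nat \<Rightarrow> real"
  assumes S0: "(\<lambda>_. 0) \<in> S" and S1: "\<And>\<Phi> \<psi> l r. \<Phi> \<in> S \<Longrightarrow> \<psi> \<in> \<Psi> l \<Longrightarrow> (\<lambda>T. \<Phi> T + r * \<psi> T) \<in> S"
    and bdd: "\<And>\<Phi>. \<Phi> \<in> S \<Longrightarrow> bdd_above (\<Phi> ` \<C>)" and ne: "\<C> \<noteq> {}"
    and K: "\<And>l \<psi> T. \<psi> \<in> \<Psi> l \<Longrightarrow> T \<in> \<C> \<Longrightarrow> \<bar>\<psi> T\<bar> \<le> K" and \<epsilon>: "\<epsilon> > 0"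
    and improve: "\<And>l T \<Phi> \<eta>. T \<in> \<C> \<Longrightarrow> \<Phi> \<in> S \<Longrightarrow> \<eta> > 0 \<Longrightarrow> \<exists>T'\<in>\<C>. \<Phi> T - \<eta> \<le> \<Phi> T' \<and> (\<exists>\<psi>\<in>\<Psi> l. \<kappa> l \<le> \<psi> T')"
  obtains R \<psi> where "\<And>k :: nat. R k \<in> \<C>" "\<And>l. \<psi> l \<in> \<Psi> l" "\<And>l k. l \<le> k \<Longrightarrow> \<kappa> l - \<epsilon> \<le> \<psi> l (R k)"
proof -
  obtain T0 where T0: "T0 \<in> \<C>" using ne by blast
  have near_max: "\<exists>T\<in>\<C>. \<exists>\<psi>\<in>\<Psi> l. (\<forall>T'\<in>\<C>. \<Phi> T' \<le> \<Phi> T + 2 * \<eta>) \<and> \<kappa> l \<le> \<psi> T" if \<Phi>: "\<Phi> \<in> S" and \<eta>: "\<eta> > 0" for l \<Phi> \<eta>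
  proof -
    have "\<exists>T\<in>\<C>. (SUP T\<in>\<C>. \<Phi> T) - \<eta> < \<Phi> T"
      using less_cSUP_iff[OF ne bdd[OF \<Phi>], of "(SUP T\<in>\<C>. \<Phi> T) - \<eta>"] \<eta> by simp
    then obtain T where T: "T \<in> \<C>" "(SUP T\<in>\<C>. \<Phi> T) - \<eta> < \<Phi> T" by blast
    obtain T' \<psi> where T': "T' \<in> \<C>" "\<Phi> T - \<eta> \<le> \<Phi> T'" "\<psi> \<in> \<Psi> l" "\<kappa> l \<le> \<psi> T'"
      using improve[OF T(1) \<Phi> \<eta>] by blast
    have "\<Phi> T'' \<le> \<Phi> T' + 2 * \<eta>" if "T'' \<in> \<C>" for T''
      using cSUP_upper[OF that bdd[OF \<Phi>]] T(2) T'(2) by linarith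
    then show ?thesis using T' by blast
  qed
  have K0: "K \<ge> 0"
    using near_max[OF S0, of 1 0] K by (smt (verit, ccfv_SIG))
  \<comment> \<open>\<open>\<theta> * (4 + 4 * K)\<close> bounds the loss of a later map in any of the selected functionals.\<close>
  define \<theta> where "\<theta> = min (1/2) (\<epsilon> / (4 + 4 * K))"
  have K4: "4 + 4 * K > 0" using K0 by simp
  have "\<theta> \<le> \<epsilon> / (4 + 4 * K)" by (simp add: \<theta>_def)
  then have "\<theta> * (4 + 4 * K) \<le> \<epsilon>" by (simp only: pos_le_divide_eq[OF K4])
  moreover have "\<theta> \<le> 1/2" unfolding \<theta>_def by (rule min.cobounded1)
  moreover have "0 < \<theta>" using \<epsilon> K4 by (simp add: \<theta>_def)
  ultimately have \<theta>: "0 < \<theta>" "\<theta> \<le> 1/2" "\<theta> * (4 + 4 * K) \<le> \<epsilon>" by blast+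
  have "\<forall>l \<Phi>. \<exists>p. \<Phi> \<in> S \<longrightarrow> fst p \<in> \<C> \<and> snd p \<in> \<Psi> l \<and> (\<forall>T'\<in>\<C>. \<Phi> T' \<le> \<Phi> (fst p) + 2 * \<theta> ^ (l + 2)) \<and> \<kappa> l \<le> snd p (fst p)"
    using near_max \<theta>(1) by (metis fst_conv snd_conv zero_less_power)
  then obtain pick where pick: "\<And>l \<Phi>. \<Phi> \<in> S \<Longrightarrow> fst (pick l \<Phi>) \<in> \<C> \<and> snd (pick l \<Phi>) \<in> \<Psi> l \<and>
      (\<forall>T'\<in>\<C>. \<Phi> T' \<le> \<Phi> (fst (pick l \<Phi>)) + 2 * \<theta> ^ (l + 2)) \<and> \<kappa> l \<le> snd (pick l \<Phi>) (fst (pick l \<Phi>))"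
    by metis
  define \<Phi> where "\<Phi> = rec_nat (\<lambda>_. 0) (\<lambda>l \<Phi> T. \<Phi> T + \<theta> ^ Suc l * snd (pick l \<Phi>) T)"
  define R where "R l = fst (pick l (\<Phi> l))" for l
  define \<psi> where "\<psi> l = snd (pick l (\<Phi> l))" for l
  have \<Phi>Suc: "\<Phi> (Suc l) = (\<lambda>T. \<Phi> l T + \<theta> ^ Suc l * \<psi> l T)" for l by (simp add: \<Phi>_def \<psi>_def)
  have \<Phi>S: "\<Phi> l \<in> S" for l
  proof (induction l)
    case 0
    then show ?case by (simp add: \<Phi>_def S0)
  next
    case (Suc l)
    then have "\<psi> l \<in> \<Psi> l" using pick unfolding \<psi>_def by blast
    then show ?case unfolding \<Phi>Suc by (intro S1 Suc)
  qed
  have R: "R l \<in> \<C>" and \<psi>: "\<psi> l \<in> \<Psi> l" and max: "T \<in> \<C> \<Longrightarrow> \<Phi> l T \<le> \<Phi> l (R l) + 2 * \<theta> ^ (l + 2)" and \<kappa>: "\<kappa> l \<le> \<psi> l (R l)" for l T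
    using pick[OF \<Phi>S] unfolding R_def \<psi>_def by blast+
  have tail: "\<bar>\<Phi> (Suc l + k) T - \<Phi> (Suc l) T\<bar> \<le> K * \<theta> ^ (l + 2) * (\<Sum>i<k. \<theta> ^ i)" if "T \<in> \<C>" for l k T
  proof (induction k)
    case (Suc k)
    have "\<bar>\<theta> ^ Suc (Suc l + k) * \<psi> (Suc l + k) T\<bar> \<le> \<theta> ^ Suc (Suc l + k) * K"
      using K[OF \<psi> that] \<theta>(1) by (simp add: abs_mult)
    then have "\<bar>\<Phi> (Suc l + Suc k) T - \<Phi> (Suc l) T\<bar> \<le> K * \<theta> ^ (l + 2) * (\<Sum>i<k. \<theta> ^ i) + \<theta> ^ Suc (Suc l + k) * K"
      using Suc by (simp add: \<Phi>Suc)
    then show ?case by (simp add: algebra_simps power_add)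
  qed simp
  have "\<kappa> l - \<epsilon> \<le> \<psi> l (R k)" if lk: "l \<le> k" for l k
  proof (cases "k = l")
    case True
    then show ?thesis using \<kappa>[of l] \<epsilon> by simp
  next
    case False
    then obtain j where k: "k = Suc l + j" using lk less_iff_Suc_add[of l k] by auto
    have t: "\<bar>\<Phi> k T - \<Phi> (Suc l) T\<bar> \<le> 2 * K * \<theta> ^ (l + 2)" if "T \<in> \<C>" for T
    proof -
      have "K * \<theta> ^ (l + 2) * (\<Sum>i<j. \<theta> ^ i) \<le> K * \<theta> ^ (l + 2) * 2"
        using K0 \<theta> by (intro mult_left_mono sum_powers_le_2) auto
      then show ?thesis using tail[OF that, of l j] unfolding k by simp
    qed
    have pk: "\<theta> ^ (k + 2) \<le> \<theta> ^ (l + 2)" using \<theta> lk by (intro power_decreasing) auto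
    have "\<Phi> k (R l) \<le> \<Phi> k (R k) + 2 * \<theta> ^ (k + 2)" by (rule max[OF R])
    moreover have "\<Phi> l (R k) \<le> \<Phi> l (R l) + 2 * \<theta> ^ (l + 2)" by (rule max[OF R])
    ultimately have "\<theta> ^ Suc l * \<psi> l (R l) - \<theta> ^ (l + 2) * (4 + 4 * K) \<le> \<theta> ^ Suc l * \<psi> l (R k)"
      using t[OF R[of l]] t[OF R[of k]] pk by (simp add: \<Phi>Suc algebra_simps abs_le_iff)
    then have "\<theta> ^ Suc l * (\<psi> l (R l) - \<theta> * (4 + 4 * K)) \<le> \<theta> ^ Suc l * \<psi> l (R k)"
      by (simp add: algebra_simps)
    then have "\<psi> l (R l) - \<theta> * (4 + 4 * K) \<le> \<psi> l (R k)"
      using \<theta>(1) by (simp only: mult_le_cancel_left_pos zero_less_power)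
    then show ?thesis using \<kappa>[of l] \<theta>(3) by linarith
  qed
  with R \<psi> show thesis by (rule that)
qed

section \<open>A tangent map that embeds\<close>

lemma sum_fun_eval: "(\<Sum>s\<in>S. F s) h = (\<Sum>s\<in>S. F s h)"
  for F :: "'s \<Rightarrow> 'a \<Rightarrow> 'b::comm_monoid_add"
  by (induction S rule: infinite_finite_induct) auto

text \<open>Approximation up to 1 is enough, since it is used for multiples of a matrix.\<close>

lemma dense_sequence_of_matrices:
  fixes X :: "'a::real_normed_vector set"
  assumes sep: "separable_space (top_of_set X)" and X: "X \<noteq> {}"
  obtains Vs :: "nat \<Rightarrow> nat \<Rightarrow> nat \<Rightarrow> 'a" where "\<And>l i j. Vs l i j \<in> X"
    "\<And>V. (\<And>i j. i < n \<Longrightarrow> j < n \<Longrightarrow> V i j \<in> X) \<Longrightarrow> \<exists>l. (\<Sum>i<n. \<Sum>j<n. norm (V i j - Vs l i j)) \<le> 1"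
proof -
  obtain D where D: "countable D" "D \<subseteq> X" "top_of_set X closure_of D = X"
    using sep unfolding separable_space_def by auto
  have dense: "\<exists>d\<in>D. norm (v - d) < \<epsilon>" if "v \<in> X" "\<epsilon> > 0" for v \<epsilon>
  proof -
    have "X \<inter> closure (X \<inter> D) = X" using D(3) by (simp add: closure_of_subtopology)
    moreover have "X \<inter> D = D" using D(2) by blast
    ultimately have "v \<in> closure D" using that(1) by auto
    then show ?thesis using that(2) unfolding closure_approachable by (metis dist_commute dist_norm)
  qed
  have Dne: "D \<noteq> {}"
  proof -
    obtain x where "x \<in> X" using X by blast
    then show ?thesis using dense[of x 1] by auto
  qed
  define d where "d = from_nat_into D"
  have d: "d k \<in> X" for k using from_nat_into[OF Dne] D(2) by (auto simp: d_def)
  have d_onto: "\<exists>k. d k = x" if "x \<in> D" for x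
    using from_nat_into_surj[OF D(1) that] by (auto simp: d_def)
  define Vs where "Vs l i j = d ((from_nat l :: nat list) ! (i * n + j))" for l i j
  have "\<exists>l. (\<Sum>i<n. \<Sum>j<n. norm (V i j - Vs l i j)) \<le> 1" if V: "\<And>i j. i < n \<Longrightarrow> j < n \<Longrightarrow> V i j \<in> X" for V
  proof -
    define \<epsilon> where "\<epsilon> = 1 / (real n * real n + 1)"
    have \<epsilon>: "\<epsilon> > 0" by (simp add: \<epsilon>_def add_nonneg_pos)
    have "\<exists>k. norm (V i j - d k) \<le> \<epsilon>" if "i < n" "j < n" for i j
      using dense[OF V[OF that] \<epsilon>] d_onto by (metis less_imp_le)
    then obtain e where e: "\<And>i j. i < n \<Longrightarrow> j < n \<Longrightarrow> norm (V i j - d (e i j)) \<le> \<epsilon>" by metis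
    define l where "l = to_nat (map (\<lambda>p. e (p div n) (p mod n)) [0..<n * n])"
    have "norm (V i j - Vs l i j) \<le> \<epsilon>" if ij: "i < n" "j < n" for i j
    proof -
      have "i * n + j < n * n"
      proof -
        have "i * n + j < Suc i * n" using ij by simp
        also have "\<dots> \<le> n * n" using ij by (intro mult_le_mono1) simp
        finally show ?thesis .
      qed
      then have "Vs l i j = d (e i j)" using ij by (simp add: Vs_def l_def)
      then show ?thesis using e[OF ij] by simp
    qed
    then have "(\<Sum>i<n. \<Sum>j<n. norm (V i j - Vs l i j)) \<le> (\<Sum>i<n. \<Sum>j<n. \<epsilon>)" by (intro sum_mono) auto
    also have "\<dots> = real n * real n * \<epsilon>" by simp
    also have "\<dots> \<le> 1"
    proof -
      have "real n * real n + 1 > 0" by (simp add: add_nonneg_pos)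
      then show ?thesis by (simp add: \<epsilon>_def divide_le_eq)
    qed
    finally show ?thesis by blast
  qed
  moreover have "Vs l i j \<in> X" for l i j unfolding Vs_def by (rule d)
  ultimately show thesis using that by blast
qed

context amplified_lipschitz_into_dual
begin

lemma pairing_in_span:
  assumes V: "\<And>i j. i < n \<Longrightarrow> j < n \<Longrightarrow> V i j \<in> X" and a: "a \<in> predual_ball Y n"
  shows "(\<lambda>h. Re (\<Sum>i<n. \<Sum>j<n. h (V i j) (a i j))) \<in> span evals"
proof -
  have "(\<Sum>i<n. \<Sum>j<n. (\<lambda>h. Re (h (V i j) (a i j)))) \<in> span evals"
    by (intro span_sum Re_eval_in_span) (use V predual_ball_entry(1)[OF Y a] in auto)
  also have "(\<Sum>i<n. \<Sum>j<n. (\<lambda>h. Re (h (V i j) (a i j)))) = (\<lambda>h. Re (\<Sum>i<n. \<Sum>j<n. h (V i j) (a i j)))"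
    by (rule ext) (simp add: sum_fun_eval)
  finally show ?thesis .
qed

lemma tangent_upper:
  assumes T: "tangent T" and V: "\<And>i j. i < n \<Longrightarrow> j < n \<Longrightarrow> V i j \<in> X"
  shows "dual_mnorm Y n (\<lambda>i j. T (V i j)) \<le> L * op_mnorm n V"
proof (rule dual_mnorm_le[OF Y_sub])
  show "T (V i j) \<in> dual_space Y" if "i < n" "j < n" for i j by (rule tangent_in_dual[OF T V[OF that]])
  fix a assume a: "a \<in> predual_ball Y n"
  have avg: "averaged T" using T by (simp add: tangent_def)
  show "Re (\<Sum>i<n. \<Sum>j<n. T (V i j) (a i j)) \<le> L * op_mnorm n V"
  proof (rule averaged_le[OF avg pairing_in_span[OF V a]])
    fix x t assume x: "x \<in> X" and t: "t > (0::real)"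
    have "Re (\<Sum>i<n. \<Sum>j<n. quot x t (V i j) (a i j)) \<le> dual_mnorm Y n (\<lambda>i j. quot x t (V i j))"
      by (rule Re_pairing_le_dual_mnorm[OF Y _ a]) (use quot_in_dual x V in auto)
    also have "\<dots> \<le> \<bar>1 / t\<bar> * dual_mnorm Y n (\<lambda>i j. f (x + t *\<^sub>R V i j) - f x)"
      unfolding quot_def
      by (rule dual_mnorm_scaleR_le[OF Y]) (intro dual_space_diff Y_sub; use f x V X_closed in auto)
    also have "\<dots> \<le> \<bar>1 / t\<bar> * (L * op_mnorm n (\<lambda>i j. t *\<^sub>R V i j))"
      using upper[unfolded amp_upper_def, rule_format, of "\<lambda>i j. x + t *\<^sub>R V i j" "\<lambda>i j. x"] x V X_closed
      by (intro mult_left_mono) auto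
    also have "\<dots> = L * op_mnorm n V" using t by (simp add: op_mnorm_scaleR)
    finally show "Re (\<Sum>i<n. \<Sum>j<n. quot x t (V i j) (a i j)) \<le> L * op_mnorm n V" .
  qed
qed

lemma abs_pairing_tangent_le:
  assumes T: "tangent T" and V: "\<And>i j. i < n \<Longrightarrow> j < n \<Longrightarrow> V i j \<in> X" and a: "a \<in> predual_ball Y n"
  shows "\<bar>Re (\<Sum>i<n. \<Sum>j<n. T (V i j) (a i j))\<bar> \<le> L * op_mnorm n V"
proof (rule abs_leI)
  have d: "T (V i j) \<in> dual_space Y" if "i < n" "j < n" for i j by (rule tangent_in_dual[OF T V[OF that]])
  show "Re (\<Sum>i<n. \<Sum>j<n. T (V i j) (a i j)) \<le> L * op_mnorm n V"
    by (rule order_trans[OF Re_pairing_le_dual_mnorm[OF Y d a] tangent_upper[OF T V]])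
  have "Re (\<Sum>i<n. \<Sum>j<n. ((-1) *\<^sub>R T (V i j)) (a i j)) \<le> dual_mnorm Y n (\<lambda>i j. (-1) *\<^sub>R T (V i j))"
    by (rule Re_pairing_le_dual_mnorm[OF Y dual_space_scaleR[OF d] a])
  also have "\<dots> \<le> \<bar>-1\<bar> * dual_mnorm Y n (\<lambda>i j. T (V i j))" by (rule dual_mnorm_scaleR_le[OF Y d])
  also have "\<dots> \<le> L * op_mnorm n V" using tangent_upper[OF T V] by simp
  finally show "- Re (\<Sum>i<n. \<Sum>j<n. T (V i j) (a i j)) \<le> L * op_mnorm n V"
    by (simp add: scaleR_fun_apply sum_negf del: scaleR_minus1_left)
qed

lemma span_evals_bounded_on_tangents:
  assumes "\<Phi> \<in> span evals"
  shows "bdd_above (\<Phi> ` {T. tangent T})"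
proof -
  obtain ws C where ws: "set ws \<subseteq> X" "C \<ge> 0" and \<Phi>C: "\<And>h k \<epsilon>. \<epsilon> \<ge> 0 \<Longrightarrow>
      (\<And>w y. w \<in> set ws \<Longrightarrow> y \<in> Y \<Longrightarrow> cmod (h w y - k w y) \<le> \<epsilon> * norm y) \<Longrightarrow> \<bar>\<Phi> h - \<Phi> k\<bar> \<le> C * \<epsilon>"
    by (rule span_evals_continuous[OF assms]) blast
  define s where "s = (\<Sum>w\<leftarrow>ws. norm w)"
  have "\<Phi> T \<le> C * (L * s) + \<Phi> 0" if T: "tangent T" for T
  proof -
    have "\<bar>\<Phi> T - \<Phi> 0\<bar> \<le> C * (L * s)"
    proof (rule \<Phi>C)
      show "L * s \<ge> 0" unfolding s_def by (intro mult_nonneg_nonneg L sum_list_nonneg) auto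
      fix w y assume w: "w \<in> set ws" and y: "y \<in> Y"
      have "norm w \<le> s" unfolding s_def using w by (intro member_le_sum_list) auto
      have "cmod (T w y) \<le> L * norm y * norm w"
        using averaged_bound[of T w y] T w y ws(1) by (auto simp: tangent_def)
      also have "\<dots> \<le> L * norm y * s" using \<open>norm w \<le> s\<close> L by (intro mult_left_mono) auto
      finally show "cmod (T w y - 0 w y) \<le> L * s * norm y" by (simp add: mult_ac)
    qed
    then show ?thesis by linarith
  qed
  then show ?thesis by (intro bdd_aboveI2) auto
qed

text \<open>Apply the selection principle to a dense sequence of matrices and to the tests from the predual
  ball. The selected tests survive the limit and give the lower bound with an additive error, which
  disappears on replacing a matrix by its large multiples. Dividing the tests by \<open>N l\<close> makes them
  uniformly bounded on the tangent maps.\<close>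

lemma embedding_tangent:
  assumes sep: "separable_space (top_of_set X)" and c: "c - real n * real n * (2 * L / Q * (real n * real n)) \<ge> 3/4"
  shows "\<exists>T. tangent T \<and> (\<forall>V. (\<forall>i<n. \<forall>j<n. V i j \<in> X) \<longrightarrow> op_mnorm n V / 2 \<le> dual_mnorm Y n (\<lambda>i j. T (V i j)))"
proof -
  have Xne: "X \<noteq> {}" using subspace_0[OF X] by blast
  obtain Vs :: "nat \<Rightarrow> nat \<Rightarrow> nat \<Rightarrow> 'h \<Rightarrow>\<^sub>L 'h" where VsX: "\<And>l i j. Vs l i j \<in> X"
    and Vs: "\<And>V. (\<And>i j. i < n \<Longrightarrow> j < n \<Longrightarrow> V i j \<in> X) \<Longrightarrow> \<exists>l. (\<Sum>i<n. \<Sum>j<n. norm (V i j - Vs l i j)) \<le> 1"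
    by (rule dense_sequence_of_matrices[OF sep Xne]) blast
  define N where "N l = 1 + op_mnorm n (Vs l)" for l
  have N: "N l \<ge> 1" for l by (simp add: N_def op_mnorm_nonneg)
  define \<psi> where "\<psi> l a = (1 / N l) *\<^sub>R (\<lambda>T. Re (\<Sum>i<n. \<Sum>j<n. T (Vs l i j) (a i j)))"
    for l and a :: "nat \<Rightarrow> nat \<Rightarrow> 'k \<Rightarrow>\<^sub>L 'k"
  define \<kappa> where "\<kappa> l = (1 / N l) * (3/4 * op_mnorm n (Vs l) - 1/4)" for l :: nat
  have \<psi>_apply: "\<psi> l a T = (1 / N l) * Re (\<Sum>i<n. \<Sum>j<n. T (Vs l i j) (a i j))" for l a T
    by (simp add: \<psi>_def scaleR_fun_apply)
  have \<psi>_span: "\<psi> l a \<in> span evals" if "a \<in> predual_ball Y n" for l a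
    unfolding \<psi>_def by (intro span_scale pairing_in_span VsX that)
  have "\<exists>R a. (\<forall>k. tangent (R k)) \<and> (\<forall>l. a l \<in> predual_ball Y n) \<and> (\<forall>l k. l \<le> k \<longrightarrow> \<kappa> l - 1/4 \<le> \<psi> l (a l) (R k))"
  proof (rule variational_selection[where \<C> = "{T. tangent T}" and \<Psi> = "\<lambda>l. \<psi> l ` predual_ball Y n" and S = "span evals"
        and \<kappa> = \<kappa> and K = L and \<epsilon> = "1/4"])
    show "(\<lambda>_. 0) \<in> span evals" using span_zero[of evals] by (simp add: zero_fun_def)
    show "(\<lambda>T. \<Phi> T + r * \<psi>' T) \<in> span evals" if "\<Phi> \<in> span evals" "\<psi>' \<in> \<psi> l ` predual_ball Y n" for \<Phi> \<psi>' l r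
    proof -
      have "\<Phi> + r *\<^sub>R \<psi>' \<in> span evals" using that \<psi>_span by (auto intro: span_add span_scale)
      also have "\<Phi> + r *\<^sub>R \<psi>' = (\<lambda>T. \<Phi> T + r * \<psi>' T)" by (rule ext) (simp add: scaleR_fun_apply)
      finally show ?thesis .
    qed
    show "bdd_above (\<Phi> ` {T. tangent T})" if "\<Phi> \<in> span evals" for \<Phi>
      by (rule span_evals_bounded_on_tangents[OF that])
    show "{T. tangent T} \<noteq> {}" using tangent_exists by blast
    show "\<bar>\<psi>' T\<bar> \<le> L" if mem: "\<psi>' \<in> \<psi> l ` predual_ball Y n" "T \<in> {T. tangent T}" for l \<psi>' T
    proof -
      obtain a where a: "a \<in> predual_ball Y n" "\<psi>' = \<psi> l a" using mem(1) by blast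
      have "\<bar>Re (\<Sum>i<n. \<Sum>j<n. T (Vs l i j) (a i j))\<bar> \<le> L * op_mnorm n (Vs l)"
        using mem(2) by (intro abs_pairing_tangent_le VsX a) simp
      also have "\<dots> \<le> L * N l" using L by (intro mult_left_mono) (simp_all add: N_def)
      finally show ?thesis unfolding a(2) \<psi>_apply using N[of l] by (simp add: abs_mult divide_le_eq)
    qed
    show "\<exists>T'\<in>{T. tangent T}. \<Phi> T - \<eta> \<le> \<Phi> T' \<and> (\<exists>\<psi>'\<in>\<psi> l ` predual_ball Y n. \<kappa> l \<le> \<psi>' T')"
      if T: "T \<in> {T. tangent T}" and \<Phi>: "\<Phi> \<in> span evals" and \<eta>: "\<eta> > 0" for l T \<Phi> \<eta>
    proof -
      define \<delta> where "\<delta> = min \<eta> (1/8)"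
      have \<delta>: "\<delta> > 0" "\<delta> \<le> \<eta>" "\<delta> \<le> 1/8" using \<eta> by (auto simp: \<delta>_def)
      obtain T' where T': "tangent T'" "\<Phi> T - \<delta> \<le> \<Phi> T'"
        and low: "c * op_mnorm n (Vs l) - real n * real n * (2 * L / Q * (\<Sum>i<n. \<Sum>j<n. norm (Vs l i j))) - \<delta>
          \<le> dual_mnorm Y n (\<lambda>i j. T' (Vs l i j))"
        using tangent_improve[of T \<Phi> "Vs l" \<delta>] T \<Phi> VsX \<delta>(1) by blast
      have d: "T' (Vs l i j) \<in> dual_space Y" for i j by (rule tangent_in_dual[OF T'(1) VsX])
      have "(\<Sum>i<n. \<Sum>j<n. norm (Vs l i j)) \<le> (\<Sum>i<n. \<Sum>j<n. op_mnorm n (Vs l))"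
        by (intro sum_mono norm_entry_le_op_mnorm) auto
      then have "real n * real n * (2 * L / Q * (\<Sum>i<n. \<Sum>j<n. norm (Vs l i j))) \<le> real n * real n * (2 * L / Q * (real n * real n * op_mnorm n (Vs l)))"
        using L by (intro mult_left_mono) auto
      then have "(c - real n * real n * (2 * L / Q * (real n * real n))) * op_mnorm n (Vs l) - \<delta> \<le> dual_mnorm Y n (\<lambda>i j. T' (Vs l i j))"
        using low by (simp add: left_diff_distrib mult.assoc)
      moreover have "3/4 * op_mnorm n (Vs l) \<le> (c - real n * real n * (2 * L / Q * (real n * real n))) * op_mnorm n (Vs l)"
        using c by (intro mult_right_mono op_mnorm_nonneg)
      ultimately have D: "3/4 * op_mnorm n (Vs l) - 1/8 \<le> dual_mnorm Y n (\<lambda>i j. T' (Vs l i j))"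
        using \<delta>(3) by linarith
      have "\<exists>a\<in>predual_ball Y n. 3/4 * op_mnorm n (Vs l) - 1/4 \<le> Re (\<Sum>i<n. \<Sum>j<n. T' (Vs l i j) (a i j))"
      proof (rule ccontr)
        assume "\<not> ?thesis"
        then have "dual_mnorm Y n (\<lambda>i j. T' (Vs l i j)) \<le> 3/4 * op_mnorm n (Vs l) - 1/4"
          by (intro dual_mnorm_le[OF Y_sub d]) (meson le_cases)
        with D show False by simp
      qed
      then obtain a where a: "a \<in> predual_ball Y n" "3/4 * op_mnorm n (Vs l) - 1/4 \<le> Re (\<Sum>i<n. \<Sum>j<n. T' (Vs l i j) (a i j))"
        by blast
      have "\<kappa> l \<le> \<psi> l a T'"
        unfolding \<kappa>_def \<psi>_apply using a(2) N[of l] by (intro mult_left_mono) auto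
      then show ?thesis using T' \<delta>(2) a(1) by (intro bexI[of _ T'] conjI bexI[of _ "\<psi> l a"]) auto
    qed
    fix R \<psi>' assume R: "\<And>k. R k \<in> {T. tangent T}" and \<psi>': "\<And>l. \<psi>' l \<in> \<psi> l ` predual_ball Y n"
      and le: "\<And>l k. l \<le> k \<Longrightarrow> \<kappa> l - 1/4 \<le> \<psi>' l (R k)"
    have "\<forall>l. \<exists>a. a \<in> predual_ball Y n \<and> \<psi>' l = \<psi> l a" using \<psi>' by blast
    then obtain a where "\<And>l. a l \<in> predual_ball Y n \<and> \<psi>' l = \<psi> l (a l)" by metis
    then show ?thesis using R le by (intro exI[of _ R] exI[of _ a]) auto
  qed simp
  then obtain R a where R: "\<And>k. tangent (R k)" and a: "\<And>l. a l \<in> predual_ball Y n"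
    and Ra: "\<And>l k. l \<le> k \<Longrightarrow> \<kappa> l - 1/4 \<le> \<psi> l (a l) (R k)" by blast
  obtain \<Lambda> where \<Lambda>: "generalised_limit (sequentially :: nat filter) \<Lambda>"
    by (rule generalised_limit_exists[OF sequentially_bot])
  define T where "T = limit_map \<Lambda> R"
  have R_avg: "averaged (R k)" for k using R by (simp add: tangent_def)
  have T: "tangent T"
    unfolding T_def
  proof (rule tangent_limit_map[OF \<Lambda> R_avg])
    fix u v y and \<epsilon> :: real assume "u \<in> X" "v \<in> X" "y \<in> Y" "\<epsilon> > 0"
    then show "eventually (\<lambda>i. cmod (R i (u + v) y - R i u y - R i v y) \<le> \<epsilon>) sequentially"
      using R by (simp add: tangent_def)
  qed
  have low: "op_mnorm n (Vs l) / 2 - 1/2 \<le> dual_mnorm Y n (\<lambda>i j. T (Vs l i j))" for l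
  proof -
    have "- \<psi> l (a l) \<in> span evals" by (intro span_neg \<psi>_span a)
    from span_eval_limit_map[where U = R, OF \<Lambda> R_avg this]
    have b: "bounded (range (\<lambda>k. (- \<psi> l (a l)) (R k)))" and e: "(- \<psi> l (a l)) T = \<Lambda> (\<lambda>k. (- \<psi> l (a l)) (R k))"
      unfolding T_def by blast+
    have "eventually (\<lambda>k. (- \<psi> l (a l)) (R k) \<le> - (\<kappa> l - 1/4)) sequentially"
      using eventually_ge_at_top[of l]
    proof (rule eventually_mono)
      fix k assume "l \<le> k"
      from Ra[OF this] show "(- \<psi> l (a l)) (R k) \<le> - (\<kappa> l - 1/4)" by simp
    qed
    then have "(- \<psi> l (a l)) T \<le> - (\<kappa> l - 1/4)" unfolding e by (rule generalised_limit_le[OF \<Lambda> b])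
    then have "\<kappa> l - 1/4 \<le> \<psi> l (a l) T" by simp
    then have "N l * (\<kappa> l - 1/4) \<le> N l * \<psi> l (a l) T" using N[of l] by (intro mult_left_mono) auto
    moreover have "N l * (\<kappa> l - 1/4) = op_mnorm n (Vs l) / 2 - 1/2"
    proof -
      have "N l * (\<kappa> l - 1/4) = (3/4 * op_mnorm n (Vs l) - 1/4) - N l / 4"
        using N[of l] by (simp add: \<kappa>_def right_diff_distrib)
      then show ?thesis unfolding N_def by (simp add: field_simps)
    qed
    moreover have "N l * \<psi> l (a l) T = Re (\<Sum>i<n. \<Sum>j<n. T (Vs l i j) (a l i j))"
      using N[of l] by (simp add: \<psi>_apply)
    moreover have "Re (\<Sum>i<n. \<Sum>j<n. T (Vs l i j) (a l i j)) \<le> dual_mnorm Y n (\<lambda>i j. T (Vs l i j))"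
      by (rule Re_pairing_le_dual_mnorm[OF Y tangent_in_dual[OF T VsX] a])
    ultimately show ?thesis by linarith
  qed
  have low1: "op_mnorm n V / 2 - (1 + L) \<le> dual_mnorm Y n (\<lambda>i j. T (V i j))"
    if V: "\<And>i j. i < n \<Longrightarrow> j < n \<Longrightarrow> V i j \<in> X" for V
  proof -
    obtain l where l: "(\<Sum>i<n. \<Sum>j<n. norm (V i j - Vs l i j)) \<le> 1" using Vs[of V] V by blast
    have "op_mnorm n V = op_mnorm n (\<lambda>i j. Vs l i j + (V i j - Vs l i j))" by simp
    also have "\<dots> \<le> op_mnorm n (Vs l) + op_mnorm n (\<lambda>i j. V i j - Vs l i j)" by (rule op_mnorm_triangle)
    also have "op_mnorm n (\<lambda>i j. V i j - Vs l i j) \<le> 1" by (rule order_trans[OF op_mnorm_le_sum_norms l])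
    finally have 1: "op_mnorm n V \<le> op_mnorm n (Vs l) + 1" by simp
    have "dual_mnorm Y n (\<lambda>i j. T (Vs l i j)) \<le> dual_mnorm Y n (\<lambda>i j. T (V i j)) + (\<Sum>i<n. \<Sum>j<n. L * norm (V i j - Vs l i j))"
    proof (rule dual_mnorm_perturb[OF Y tangent_in_dual[OF T VsX] tangent_in_dual[OF T V]])
      fix i j y assume ij: "i < n" "j < n" and y: "y \<in> Y"
      have dX: "Vs l i j - V i j \<in> X" using VsX V[OF ij] by (intro subspace_diff[OF X])
      have "T ((Vs l i j - V i j) + V i j) = T (Vs l i j - V i j) + T (V i j)"
        by (rule tangent_add[OF T dX V[OF ij]])
      then have "T (Vs l i j) y - T (V i j) y = T (Vs l i j - V i j) y" by simp
      also have "cmod \<dots> \<le> L * norm y * norm (Vs l i j - V i j)"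
        using averaged_bound[of T, OF _ dX y] T by (simp add: tangent_def)
      finally show "cmod (T (Vs l i j) y - T (V i j) y) \<le> L * norm (V i j - Vs l i j) * norm y"
        by (simp add: mult_ac norm_minus_commute)
    qed (use L in auto)
    also have "(\<Sum>i<n. \<Sum>j<n. L * norm (V i j - Vs l i j)) \<le> L * 1"
      unfolding sum_distrib_left[symmetric] using l L by (intro mult_left_mono)
    finally show ?thesis using 1 low[of l] by simp
  qed
  have "op_mnorm n V / 2 \<le> dual_mnorm Y n (\<lambda>i j. T (V i j))" if V: "\<forall>i<n. \<forall>j<n. V i j \<in> X" for V
  proof (rule field_le_epsilon)
    fix \<epsilon> :: real assume "\<epsilon> > 0"
    then obtain k :: nat where k: "k \<ge> 1" "(1 + L) / k \<le> \<epsilon>" by (rule ex_nat_divide_le)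
    have TV: "T (V i j) \<in> dual_space Y" if "i < n" "j < n" for i j using tangent_in_dual[OF T] V that by blast
    have "op_mnorm n (\<lambda>i j. real k *\<^sub>R V i j) / 2 - (1 + L) \<le> dual_mnorm Y n (\<lambda>i j. T (real k *\<^sub>R V i j))"
      by (rule low1) (use V X_closed in auto)
    also have "\<dots> = dual_mnorm Y n (\<lambda>i j. real k *\<^sub>R T (V i j))"
      by (rule dual_mnorm_cong) (use V tangent_scaleR[OF T] in auto)
    also have "\<dots> \<le> \<bar>real k\<bar> * dual_mnorm Y n (\<lambda>i j. T (V i j))" by (rule dual_mnorm_scaleR_le[OF Y TV])
    finally have "k * (op_mnorm n V / 2) - (1 + L) \<le> k * dual_mnorm Y n (\<lambda>i j. T (V i j))"
      by (simp add: op_mnorm_scaleR)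
    then have "op_mnorm n V / 2 \<le> dual_mnorm Y n (\<lambda>i j. T (V i j)) + (1 + L) / k"
      using k(1) by (simp add: field_simps)
    with k(2) show "op_mnorm n V / 2 \<le> dual_mnorm Y n (\<lambda>i j. T (V i j)) + \<epsilon>" by linarith
  qed
  with T show ?thesis by blast
qed

end

section \<open>Amplified embeddings\<close>

lemma mat_in_matrices: "(\<And>i j. i < n \<Longrightarrow> j < n \<Longrightarrow> u i j \<in> X) \<Longrightarrow> mat n n (\<lambda>(i, j). u i j) \<in> matrices n X"
  by (auto simp: matrices_def elements_mat_def)

lemma matrices_entry: "A \<in> matrices n X \<Longrightarrow> i < n \<Longrightarrow> j < n \<Longrightarrow> A $$ (i, j) \<in> X"
  using elements_matI[of A n n i j] by (auto simp: matrices_def)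

lemma op_norm_diff_matrices:
  assumes "A \<in> matrices n X" "B \<in> matrices n X"
  shows "op_norm n (A - B) = op_mnorm n (\<lambda>i j. A $$ (i, j) - B $$ (i, j))"
  unfolding op_mnorm_def
  by (rule arg_cong[of _ _ "op_norm n"]) (use assms in \<open>auto simp: matrices_def intro!: eq_matI\<close>)

lemma dual_norm_diff_matrices:
  assumes "A \<in> matrices n X" "B \<in> matrices n X"
  shows "dual_norm Y n (map_mat g A - map_mat g B) = dual_mnorm Y n (\<lambda>i j. g (A $$ (i, j)) - g (B $$ (i, j)))"
proof -
  have dims: "dim_row A = n" "dim_col A = n" "dim_row B = n" "dim_col B = n"
    using assms by (auto simp: matrices_def)
  have "map_mat g A - map_mat g B = mat n n (\<lambda>(i, j). g (A $$ (i, j)) - g (B $$ (i, j)))"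
    by (rule eq_matI) (simp_all add: dims)
  then show ?thesis by (simp only: dual_mnorm_def)
qed

text \<open>The distortion is an infimum that need not be attained, hence the constant \<open>D + 1\<close>.\<close>

lemma lipschitz_embedding_bounds:
  assumes emb: "lipschitz_embedding A d B e g" and dist: "lipschitz_distortion A d e g \<le> D"
    and d0: "\<And>x y. x \<in> A \<Longrightarrow> y \<in> A \<Longrightarrow> d x y \<ge> 0" and e0: "\<And>x y. x \<in> A \<Longrightarrow> y \<in> A \<Longrightarrow> e (g x) (g y) \<ge> 0"
  obtains r where "r > 0" "\<And>x y. x \<in> A \<Longrightarrow> y \<in> A \<Longrightarrow> r * d x y \<le> e (g x) (g y)"
    "\<And>x y. x \<in> A \<Longrightarrow> y \<in> A \<Longrightarrow> e (g x) (g y) \<le> (D + 1) * r * d x y"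
proof -
  define S where "S = {D. D > 0 \<and> (\<exists>r>0. \<forall>x\<in>A. \<forall>y\<in>A. r * d x y \<le> e (g x) (g y) \<and> e (g x) (g y) \<le> D * r * d x y)}"
  have lip1: "lipschitz_map A d e g" and lip2: "lipschitz_map (g ` A) e d (inv_into A g)" and inj: "inj_on g A"
    using emb by (simp_all only: lipschitz_embedding_def)
  from lip1 obtain L1 where "L1 \<ge> 0 \<and> (\<forall>x\<in>A. \<forall>y\<in>A. e (g x) (g y) \<le> L1 * d x y)"
    unfolding lipschitz_map_def by (elim exE conjE) (rule that, intro conjI)
  then have L1: "L1 \<ge> 0" "\<And>x y. x \<in> A \<Longrightarrow> y \<in> A \<Longrightarrow> e (g x) (g y) \<le> L1 * d x y" by simp_all
  from lip2 obtain L2 where "L2 \<ge> 0 \<and> (\<forall>x\<in>g ` A. \<forall>y\<in>g ` A. d (inv_into A g x) (inv_into A g y) \<le> L2 * e x y)"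
    unfolding lipschitz_map_def by (elim exE conjE) (rule that, intro conjI)
  then have L2: "L2 \<ge> 0" "\<And>x y. x \<in> A \<Longrightarrow> y \<in> A \<Longrightarrow> d x y \<le> L2 * e (g x) (g y)"
    using inj by simp_all
  have "(L1 + 1) * (L2 + 1) \<in> S"
    unfolding S_def
  proof (intro CollectI conjI exI[of _ "1 / (L2 + 1)"] ballI)
    fix x y assume xy: "x \<in> A" "y \<in> A"
    have "d x y \<le> L2 * e (g x) (g y)"
      by (rule L2(2)[OF xy])
    also have "\<dots> \<le> (L2 + 1) * e (g x) (g y)" using e0[OF xy] by (intro mult_right_mono) auto
    finally show "1 / (L2 + 1) * d x y \<le> e (g x) (g y)" using L2(1) by (simp add: divide_le_eq mult.commute)
    have "e (g x) (g y) \<le> (L1 + 1) * d x y"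
      using L1(2)[OF xy] d0[OF xy] by (simp add: algebra_simps)
    then show "e (g x) (g y) \<le> (L1 + 1) * (L2 + 1) * (1 / (L2 + 1)) * d x y" using L2(1) by simp
  qed (use L1(1) L2(1) in auto)
  then have "S \<noteq> {}" by blast
  moreover have "Inf S < D + 1" using dist unfolding lipschitz_distortion_def S_def by linarith
  ultimately obtain D' where D': "D' \<in> S" "D' < D + 1" using cInf_lessD by blast
  then obtain r where r: "r > 0" "\<And>x y. x \<in> A \<Longrightarrow> y \<in> A \<Longrightarrow> r * d x y \<le> e (g x) (g y)"
    "\<And>x y. x \<in> A \<Longrightarrow> y \<in> A \<Longrightarrow> e (g x) (g y) \<le> D' * r * d x y" unfolding S_def by blast
  have "e (g x) (g y) \<le> (D + 1) * r * d x y" if "x \<in> A" "y \<in> A" for x y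
  proof -
    have "D' * r * d x y \<le> (D + 1) * r * d x y"
      using D'(2) r(1) d0[OF that] by (intro mult_right_mono) auto
    with r(3)[OF that] show ?thesis by linarith
  qed
  with r(1,2) show thesis by (rule that)
qed

lemma amplification_embeds_of_bounds:
  assumes X: "csubspace X" and Y: "operator_space Y" and T: "T \<in> X \<rightarrow> dual_space Y" and lin: "real_linear_on X T"
    and a: "0 < a" "a \<le> b"
    and lo: "\<And>V. (\<forall>i<n. \<forall>j<n. V i j \<in> X) \<Longrightarrow> a * op_mnorm n V \<le> dual_mnorm Y n (\<lambda>i j. T (V i j))"
    and up: "\<And>V. (\<forall>i<n. \<forall>j<n. V i j \<in> X) \<Longrightarrow> dual_mnorm Y n (\<lambda>i j. T (V i j)) \<le> b * op_mnorm n V"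
  shows "amplification_embeds X op_norm (dual_space Y) (dual_norm Y) (b / a) n T"
proof -
  have sX: "subspace X" by (rule csubspace_imp_subspace[OF X])
  have sub: "csubspace Y" using Y by (simp add: operator_space_def)
  let ?d = "\<lambda>A B. op_norm n (A - B)" and ?e = "\<lambda>A B. dual_norm Y n (A - B)"
  have diff: "T x - T y = T (x - y)" if "x \<in> X" "y \<in> X" for x y
  proof -
    have "T ((x - y) + y) = T (x - y) + T y"
      using lin that subspace_diff[OF sX that] unfolding real_linear_on_def by blast
    then show ?thesis by simp
  qed
  have e_eq: "?e (map_mat T A) (map_mat T B) = dual_mnorm Y n (\<lambda>i j. T (A $$ (i, j) - B $$ (i, j)))"
    if "A \<in> matrices n X" "B \<in> matrices n X" for A B
    unfolding dual_norm_diff_matrices[OF that]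
    by (rule dual_mnorm_cong) (intro diff matrices_entry[OF that(1)] matrices_entry[OF that(2)])
  have dX: "\<forall>i<n. \<forall>j<n. A $$ (i, j) - B $$ (i, j) \<in> X" if "A \<in> matrices n X" "B \<in> matrices n X" for A B
    using matrices_entry[OF that(1)] matrices_entry[OF that(2)] subspace_diff[OF sX] by blast
  have low: "a * ?d A B \<le> ?e (map_mat T A) (map_mat T B)" if "A \<in> matrices n X" "B \<in> matrices n X" for A B
    unfolding e_eq[OF that] op_norm_diff_matrices[OF that] by (rule lo[OF dX[OF that]])
  have upp: "?e (map_mat T A) (map_mat T B) \<le> b * ?d A B" if "A \<in> matrices n X" "B \<in> matrices n X" for A B
    unfolding e_eq[OF that] op_norm_diff_matrices[OF that] by (rule up[OF dX[OF that]])
  have d0: "0 \<le> ?d A B" if "A \<in> matrices n X" "B \<in> matrices n X" for A B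
    unfolding op_norm_diff_matrices[OF that] by (rule op_mnorm_nonneg)
  have maps: "map_mat T A \<in> matrices n (dual_space Y)" if "A \<in> matrices n X" for A
  proof -
    have "dim_row A = n" "dim_col A = n" using that by (auto simp: matrices_def)
    then have "map_mat T A = mat n n (\<lambda>(i, j). T (A $$ (i, j)))" by (intro eq_matI) auto
    moreover have "mat n n (\<lambda>(i, j). T (A $$ (i, j))) \<in> matrices n (dual_space Y)"
      by (rule mat_in_matrices) (use T matrices_entry[OF that] in auto)
    ultimately show ?thesis by simp
  qed
  have inj: "inj_on (map_mat T) (matrices n X)"
  proof (rule inj_onI)
    fix A B assume AB: "A \<in> matrices n X" "B \<in> matrices n X" and eq: "map_mat T A = map_mat T B"
    have "dual_mnorm Y n (\<lambda>i j. T (A $$ (i, j)) - T (B $$ (i, j))) \<le> 0"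
    proof (rule dual_mnorm_le[OF sub])
      show "T (A $$ (i, j)) - T (B $$ (i, j)) \<in> dual_space Y" if "i < n" "j < n" for i j
        by (intro dual_space_diff sub) (use T matrices_entry[OF AB(1) that] matrices_entry[OF AB(2) that] in auto)
      fix p
      have "T (A $$ (i, j)) - T (B $$ (i, j)) = 0" if "i < n" "j < n" for i j
      proof -
        have "map_mat T A $$ (i, j) = map_mat T B $$ (i, j)" by (simp only: eq)
        then show ?thesis using AB that by (auto simp: matrices_def)
      qed
      then show "Re (\<Sum>i<n. \<Sum>j<n. (T (A $$ (i, j)) - T (B $$ (i, j))) (p i j)) \<le> 0" by simp
    qed
    then have "a * op_mnorm n (\<lambda>i j. A $$ (i, j) - B $$ (i, j)) \<le> 0"
      using low[OF AB] unfolding dual_norm_diff_matrices[OF AB] op_norm_diff_matrices[OF AB] by linarith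
    then have z: "op_mnorm n (\<lambda>i j. A $$ (i, j) - B $$ (i, j)) \<le> 0"
      using a(1) by (simp add: mult_le_0_iff)
    show "A = B"
    proof (rule eq_matI)
      fix i j assume "i < dim_row B" "j < dim_col B"
      then have ij: "i < n" "j < n" using AB by (auto simp: matrices_def)
      have "norm (A $$ (i, j) - B $$ (i, j)) \<le> 0"
        using norm_entry_le_op_mnorm[OF ij, of "\<lambda>i j. A $$ (i, j) - B $$ (i, j)"] z by linarith
      then show "A $$ (i, j) = B $$ (i, j)" by simp
    qed (use AB in \<open>auto simp: matrices_def\<close>)
  qed
  have b: "b > 0" using a by linarith
  have "lipschitz_embedding (matrices n X) ?d (matrices n (dual_space Y)) ?e (map_mat T)"
    unfolding lipschitz_embedding_def
  proof (intro conjI inj)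
    show "map_mat T \<in> matrices n X \<rightarrow> matrices n (dual_space Y)" using maps by blast
    show "lipschitz_map (matrices n X) ?d ?e (map_mat T)"
      unfolding lipschitz_map_def using upp b by (intro exI[of _ b]) auto
    show "lipschitz_map (map_mat T ` matrices n X) ?e ?d (inv_into (matrices n X) (map_mat T))"
      unfolding lipschitz_map_def
    proof (intro exI[of _ "1 / a"] conjI ballI)
      fix P Q assume "P \<in> map_mat T ` matrices n X" "Q \<in> map_mat T ` matrices n X"
      then obtain A B where AB: "A \<in> matrices n X" "B \<in> matrices n X" "P = map_mat T A" "Q = map_mat T B" by blast
      have "?d A B \<le> 1 / a * ?e (map_mat T A) (map_mat T B)"
        using low[OF AB(1,2)] a(1) by (simp add: field_simps)
      then show "?d (inv_into (matrices n X) (map_mat T) P) (inv_into (matrices n X) (map_mat T) Q) \<le> 1 / a * ?e P Q"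
        using AB inj by simp
    qed (use a in simp)
  qed
  moreover have "lipschitz_distortion (matrices n X) ?d ?e (map_mat T) \<le> b / a"
    unfolding lipschitz_distortion_def
  proof (rule cInf_lower)
    show "b / a \<in> {D. D > 0 \<and> (\<exists>r>0. \<forall>x\<in>matrices n X. \<forall>y\<in>matrices n X.
        r * ?d x y \<le> ?e (map_mat T x) (map_mat T y) \<and> ?e (map_mat T x) (map_mat T y) \<le> D * r * ?d x y)}"
      using a b low upp by (intro CollectI conjI exI[of _ a]) auto
    show "bdd_below {D. D > 0 \<and> (\<exists>r>0. \<forall>x\<in>matrices n X. \<forall>y\<in>matrices n X.
        r * ?d x y \<le> ?e (map_mat T x) (map_mat T y) \<and> ?e (map_mat T x) (map_mat T y) \<le> D * r * ?d x y)}"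
      by (intro bdd_belowI[of _ 0]) auto
  qed
  ultimately show ?thesis unfolding amplification_embeds_def by blast
qed

lemma amp_bounds_of_amplification_embeds:
  assumes X: "csubspace X" and Y: "operator_space Y" and f: "f \<in> X \<rightarrow> dual_space Y"
    and emb: "amplification_embeds X op_norm (dual_space Y) (dual_norm Y) D n f"
  obtains g where "g \<in> X \<rightarrow> dual_space Y" "amp_lower X Y n 1 g" "amp_upper X Y n (D + 1) g"
proof -
  have sX: "subspace X" by (rule csubspace_imp_subspace[OF X])
  have sub: "csubspace Y" using Y by (simp add: operator_space_def)
  let ?d = "\<lambda>A B. op_norm n (A - B)" and ?e = "\<lambda>A B. dual_norm Y n (A - B)"
  have fd: "f x - f y \<in> dual_space Y" if "x \<in> X" "y \<in> X" for x y
    by (intro dual_space_diff sub) (use f that in auto)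
  have d0: "0 \<le> ?d A B" if "A \<in> matrices n X" "B \<in> matrices n X" for A B
    unfolding op_norm_diff_matrices[OF that] by (rule op_mnorm_nonneg)
  have e0: "0 \<le> ?e (map_mat f A) (map_mat f B)" if "A \<in> matrices n X" "B \<in> matrices n X" for A B
    unfolding dual_norm_diff_matrices[OF that]
    by (rule dual_mnorm_nonneg[OF Y]) (intro fd matrices_entry[OF that(1)] matrices_entry[OF that(2)])
  obtain r where r: "r > 0"
    and lo: "\<And>A B. A \<in> matrices n X \<Longrightarrow> B \<in> matrices n X \<Longrightarrow> r * ?d A B \<le> ?e (map_mat f A) (map_mat f B)"
    and up: "\<And>A B. A \<in> matrices n X \<Longrightarrow> B \<in> matrices n X \<Longrightarrow> ?e (map_mat f A) (map_mat f B) \<le> (D + 1) * r * ?d A B"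
    using emb unfolding amplification_embeds_def
    by (elim conjE) (rule lipschitz_embedding_bounds[where A = "matrices n X" and d = ?d and e = ?e and g = "map_mat f" and D = D]; use d0 e0 in blast)
  have lo': "r * op_mnorm n (\<lambda>i j. u i j - v i j) \<le> dual_mnorm Y n (\<lambda>i j. f (u i j) - f (v i j))"
    and up': "dual_mnorm Y n (\<lambda>i j. f (u i j) - f (v i j)) \<le> (D + 1) * r * op_mnorm n (\<lambda>i j. u i j - v i j)"
    if uv: "\<forall>i<n. \<forall>j<n. u i j \<in> X \<and> v i j \<in> X" for u v
  proof -
    let ?A = "mat n n (\<lambda>(i, j). u i j)" and ?B = "mat n n (\<lambda>(i, j). v i j)"
    have AB: "?A \<in> matrices n X" "?B \<in> matrices n X" using uv by (auto intro!: mat_in_matrices)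
    have 1: "op_mnorm n (\<lambda>i j. ?A $$ (i, j) - ?B $$ (i, j)) = op_mnorm n (\<lambda>i j. u i j - v i j)"
      by (rule op_mnorm_cong) simp
    have 2: "dual_mnorm Y n (\<lambda>i j. f (?A $$ (i, j)) - f (?B $$ (i, j))) = dual_mnorm Y n (\<lambda>i j. f (u i j) - f (v i j))"
      by (rule dual_mnorm_cong) simp
    show "r * op_mnorm n (\<lambda>i j. u i j - v i j) \<le> dual_mnorm Y n (\<lambda>i j. f (u i j) - f (v i j))"
      using lo[OF AB] unfolding op_norm_diff_matrices[OF AB] dual_norm_diff_matrices[OF AB] 1 2 .
    show "dual_mnorm Y n (\<lambda>i j. f (u i j) - f (v i j)) \<le> (D + 1) * r * op_mnorm n (\<lambda>i j. u i j - v i j)"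
      using up[OF AB] unfolding op_norm_diff_matrices[OF AB] dual_norm_diff_matrices[OF AB] 1 2 .
  qed
  define g where "g x = (1 / r) *\<^sub>R f x" for x
  have g: "g \<in> X \<rightarrow> dual_space Y" using f unfolding g_def by (intro Pi_I dual_space_scaleR) blast
  moreover have "amp_lower X Y n 1 g"
    unfolding amp_lower_def
  proof (intro allI impI)
    fix u v assume uv: "\<forall>i<n. \<forall>j<n. u i j \<in> X \<and> v i j \<in> X"
    have gd: "g (u i j) - g (v i j) \<in> dual_space Y" if "i < n" "j < n" for i j
      by (intro dual_space_diff sub) (use g uv that in auto)
    have "r * op_mnorm n (\<lambda>i j. u i j - v i j) \<le> dual_mnorm Y n (\<lambda>i j. f (u i j) - f (v i j))" by (rule lo'[OF uv])
    also have "\<dots> = dual_mnorm Y n (\<lambda>i j. r *\<^sub>R (g (u i j) - g (v i j)))"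
      using r by (intro dual_mnorm_cong) (simp add: g_def scaleR_diff_right)
    also have "\<dots> \<le> \<bar>r\<bar> * dual_mnorm Y n (\<lambda>i j. g (u i j) - g (v i j))" by (rule dual_mnorm_scaleR_le[OF Y gd])
    finally show "1 * op_mnorm n (\<lambda>i j. u i j - v i j) \<le> dual_mnorm Y n (\<lambda>i j. g (u i j) - g (v i j))"
      using r by simp
  qed
  moreover have "amp_upper X Y n (D + 1) g"
    unfolding amp_upper_def
  proof (intro allI impI)
    fix u v assume uv: "\<forall>i<n. \<forall>j<n. u i j \<in> X \<and> v i j \<in> X"
    have "dual_mnorm Y n (\<lambda>i j. g (u i j) - g (v i j)) = dual_mnorm Y n (\<lambda>i j. (1 / r) *\<^sub>R (f (u i j) - f (v i j)))"
      by (rule dual_mnorm_cong) (simp add: g_def scaleR_diff_right)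
    also have "\<dots> \<le> \<bar>1 / r\<bar> * dual_mnorm Y n (\<lambda>i j. f (u i j) - f (v i j))"
      by (rule dual_mnorm_scaleR_le[OF Y]) (use fd uv in auto)
    also have "\<dots> \<le> \<bar>1 / r\<bar> * ((D + 1) * r * op_mnorm n (\<lambda>i j. u i j - v i j))"
      by (intro mult_left_mono up'[OF uv]) simp
    also have "\<dots> = (D + 1) * op_mnorm n (\<lambda>i j. u i j - v i j)" using r by simp
    finally show "dual_mnorm Y n (\<lambda>i j. g (u i j) - g (v i j)) \<le> (D + 1) * op_mnorm n (\<lambda>i j. u i j - v i j)" .
  qed
  ultimately show thesis by (rule that)
qed

lemma amp_upper_imp_lipschitz:
  assumes Y: "operator_space Y" and f: "f \<in> X \<rightarrow> dual_space Y" and N: "N \<ge> 1" and up: "amp_upper X Y N L f" and L: "L \<ge> 0"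
    and x: "x \<in> X" "x' \<in> X" and y: "y \<in> Y"
  shows "cmod (f x y - f x' y) \<le> L * norm y * norm (x - x')"
proof -
  have sub: "csubspace Y" using Y by (simp add: operator_space_def)
  have up1: "amp_upper X Y 1 L f" by (rule amp_upper_divisor[OF Y f N]) (simp add: up)
  have "f x - f x' \<in> dual_space Y" by (intro dual_space_diff sub) (use f x in auto)
  from cmod_apply_le_dual_mnorm[OF Y this y]
  have "cmod (f x y - f x' y) \<le> dual_mnorm Y 1 (\<lambda>_ _. f x - f x') * norm y" by simp
  also have "\<dots> \<le> (L * op_mnorm 1 (\<lambda>_ _. x - x')) * norm y"
    using up1[unfolded amp_upper_def, rule_format, of "\<lambda>_ _. x" "\<lambda>_ _. x'"] x by (intro mult_right_mono) auto
  also have "\<dots> \<le> (L * norm (x - x')) * norm y"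
    by (intro mult_right_mono mult_left_mono op_mnorm_1_le L) simp
  finally show ?thesis by (simp add: mult_ac)
qed

theorem theorem1p6:
  fixes X :: "('h::complex_hilbert \<Rightarrow>\<^sub>L 'h) set"
    and Y :: "('k::complex_hilbert \<Rightarrow>\<^sub>L 'k) set"
  assumes "operator_space X" and "operator_space Y"
    and "separable_space (top_of_set X)"
    and "almost_completely_lipschitz_embeds X op_norm (dual_space Y) (dual_norm Y)"
  shows "almost_completely_real_linearly_embeds X op_norm (dual_space Y) (dual_norm Y)"
proof -
  have Xc: "csubspace X" using assms(1) by (simp add: operator_space_def)
  have sX: "subspace X" by (rule csubspace_imp_subspace[OF Xc])
  note Y = assms(2)
  obtain D F where D: "D > 0" and F: "\<And>n. n \<ge> 1 \<Longrightarrow> F n \<in> X \<rightarrow> dual_space Y"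
      "\<And>n. n \<ge> 1 \<Longrightarrow> amplification_embeds X op_norm (dual_space Y) (dual_norm Y) D n (F n)"
    using assms(4) unfolding almost_completely_lipschitz_embeds_def by blast
  define L where "L = D + 1"
  have L1: "L \<ge> 1" using D by (simp add: L_def)
  have "\<exists>T. T \<in> X \<rightarrow> dual_space Y \<and> real_linear_on X T \<and> amplification_embeds X op_norm (dual_space Y) (dual_norm Y) (2 * L) n T"
    if n: "n \<ge> 1" for n :: nat
  proof -
    \<comment> \<open>First the number of points of the cubes, then their number \<open>d\<close> of doublings, and only then the
      level \<open>N\<close> whose embedding survives that many two-point averages.\<close>
    obtain q0 :: nat where q0: "q0 \<ge> 1" "(real n * real n * (2 * L * (real n * real n))) / q0 \<le> 1/8"
      by (rule ex_nat_divide_le[of "1/8"]) simp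
    define Q :: nat where "Q = 2 ^ q0"
    have Qb: "Q \<ge> 1" "q0 \<le> Q" by (simp_all add: Q_def less_imp_le)
    define d where "d = q0 * (n * n)"
    obtain k0 :: nat where k0: "k0 \<ge> 1" "(real d * L) / k0 \<le> 1/8"
      by (rule ex_nat_divide_le[of "1/8"]) simp
    define N where "N = n * (4 ^ k0) ^ d"
    have N: "N \<ge> 1" using n by (simp add: N_def)
    obtain f where f: "f \<in> X \<rightarrow> dual_space Y" and lowN: "amp_lower X Y N 1 f" and upN: "amp_upper X Y N L f"
      using amp_bounds_of_amplification_embeds[OF Xc Y F(1)[OF N] F(2)[OF N]] unfolding L_def by blast
    have up: "amp_upper X Y n L f"
      by (rule amp_upper_divisor[OF Y f _ upN[unfolded N_def]]) simp
    define c where "c = 1 - real d * (L / 2 ^ k0)"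
    interpret amplified_lipschitz_into_dual X Y f L n Q c
    proof
      show "cmod (f x y - f x' y) \<le> L * norm y * norm (x - x')" if "x \<in> X" "x' \<in> X" "y \<in> Y" for x x' y
        by (rule amp_upper_imp_lipschitz[OF Y f N upN _ that]) (use L1 in simp)
      show "amp_lower X Y n c (box_avg (map (\<lambda>e. (e, Q)) vs) f)" if vs: "set vs \<subseteq> X" "length vs = n * n" for vs
      proof -
        obtain es where es: "length es = q0 * length vs" "set es \<subseteq> X"
          and eq: "box_avg (map (\<lambda>e. (e, 2 ^ q0)) vs) f = box_avg (map (\<lambda>u. (u, 2)) es) f"
          using box_avg_dyadic[of q0 vs] sX vs(1) by blast
        have len: "length es = d" using es(1) vs(2) by (simp add: d_def)
        show ?thesis
          unfolding Q_def eq c_def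
          using amp_bounds_dyadic_average(2)[OF Xc Y f es(2), of n k0 L 1] upN lowN unfolding len N_def by blast
      qed
    qed (use sX Y f L1 Qb up in auto)
    have "real n * real n * (2 * L / Q * (real n * real n)) \<le> 1/8"
    proof -
      have "real n * real n * (2 * L / Q * (real n * real n)) = (real n * real n * (2 * L * (real n * real n))) / Q" by simp
      also have "\<dots> \<le> (real n * real n * (2 * L * (real n * real n))) / q0"
        using Qb q0(1) L1 by (intro divide_left_mono) auto
      finally show ?thesis using q0(2) by linarith
    qed
    moreover have "real d * (L / 2 ^ k0) \<le> 1/8"
    proof -
      have "real k0 \<le> 2 ^ k0" using of_nat_less_two_power[of k0, where 'a = real] by simp
      then have "(real d * L) / 2 ^ k0 \<le> (real d * L) / k0"
        using k0(1) L1 by (intro divide_left_mono) auto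
      with k0(2) have "(real d * L) / 2 ^ k0 \<le> 1/8" by linarith
      then show ?thesis by (simp only: times_divide_eq_right)
    qed
    ultimately have "c - real n * real n * (2 * L / Q * (real n * real n)) \<ge> 3/4"
      unfolding c_def by linarith
    from embedding_tangent[OF assms(3) this] obtain T where T: "tangent T"
      and lo: "\<And>V. (\<forall>i<n. \<forall>j<n. V i j \<in> X) \<Longrightarrow> op_mnorm n V / 2 \<le> dual_mnorm Y n (\<lambda>i j. T (V i j))" by blast
    have Td: "T \<in> X \<rightarrow> dual_space Y" using tangent_in_dual[OF T] by blast
    have Tl: "real_linear_on X T"
      using tangent_add[OF T] tangent_scaleR[OF T] by (simp add: real_linear_on_def)
    have "amplification_embeds X op_norm (dual_space Y) (dual_norm Y) (L / (1/2)) n T"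
      by (rule amplification_embeds_of_bounds[OF Xc Y Td Tl]) (use L1 lo tangent_upper[OF T] in auto)
    then show ?thesis using Td Tl by (auto simp: mult.commute)
  qed
  then have "\<exists>T. \<forall>n\<ge>1. T n \<in> X \<rightarrow> dual_space Y \<and> real_linear_on X (T n) \<and>
      amplification_embeds X op_norm (dual_space Y) (dual_norm Y) (2 * L) n (T n)"
    by metis
  then show ?thesis
    unfolding almost_completely_real_linearly_embeds_def using L1 by (intro exI[of _ "2 * L"]) auto
qed

end
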